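(* Let $(M,g)$ be a generalized gravitational wave spacetime (see context), with Lorentzian distance $d$, least action $S$ and Hamiltonian $H$. Fix $x_0=(e_0,y_0)\in M$, $e_0=(t_0,q_0)$, and regard $d(x)=d(x_0,x)$ as a function of $x=(t,q,y)$ and $S(t,q)=S(e_0,(t,q))$ as a function of $(t,q)\in E$. At every point $x=(t,q,y)$ with $t>t_0$ and $y-y_0>S(t,q)$ such that $S$ is finite in a neighborhood of $(t,q)$ and differentiable at $(t,q)$, one has $$g(\nabla d,\nabla d)+1=\frac{2(t-t_0)^2}{d^2}\Big[\frac{\partial S}{\partial t}+H\Big(t,q,\frac{\partial S}{\partial q}\Big)\Big].$$ Thus the timelike eikonal equation $g(\nabla d,\nabla d)+1=0$ for $d$ at $x$ is equivalent to the Hamilton-Jacobi equation $\frac{\partial S}{\partial t}+H(t,q,\frac{\partial S}{\partial q})=0$ for $S$ at $(t,q)$.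
   Context: Setting. $r\ge 2$; $Q$ is a connected $d$-dimensional ($C^{r+1}$, Hausdorff, paracompact, boundaryless) manifold; $T\subset\mathbb{R}$ is a connected interval, open because spacetimes are without boundary; $E=T\times Q$ with points $e=(t,q)$. On $Q$ there are given a time-dependent Riemannian metric $a_t$, a time-dependent 1-form $b_t$ and a function $V(t,q)$, all $C^r$ in $(t,q)\in E$. The Lagrangian is $L(t,q,v)=\frac12 a_t(v,v)+b_t(v)-V(t,q)$ and the Hamiltonian is $H(t,q,p)=\frac12 a_t^{-1}(p-b_t,p-b_t)+V(t,q)$, $p\in T^*_qQ$. The generalized gravitational wave spacetime is $M=T\times Q\times\mathbb{R}$ with points $x=(t,q,y)=(e,y)$ and Lorentzian metric (signature $(-,+,\dots,+)$) $g=a_t-dt\otimes(dy-b_t)-(dy-b_t)\otimes dt-2V\,dt^2$, time oriented by the timelike vector field $W=\partial_t-(V-\tfrac12)\partial_y$. Least action. For $t_0<t_1$, $S(e_0,e_1)$ is the infimum of $\int_{t_0}^{t_1}L(t,q(t),\dot q(t))\,dt$ over the $C^1$ curves $q:[t_0,t_1]\to Q$ with $q(t_0)=q_0$, $q(t_1)=q_1$; $S(e_0,e_1)=0$ if $e_0=e_1$; $S(e_0,e_1)=+\infty$ otherwise. The Lorentzian distance $d(x_0,x_1)$ is the supremum of the Lorentzian lengths $\int\sqrt{-g(\gamma',\gamma')}$ of the future directed causal curves from $x_0$ to $x_1$ (and $0$ if there are none). $\nabla d$ is the $g$-gradient. *)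

theory Defs
  imports "HOL-Analysis.Analysis"
begin

section \<open>Manifolds of class \<open>C\<^sup>k\<close>\<close>

text \<open>For \<open>S\<close> open in a finite-dimensional space, \<open>Ck_on k S f\<close> is the usual class \<open>C\<^sup>k\<close>.\<close>

primrec Ck_on ::
  "nat \<Rightarrow> 'a::real_normed_vector set \<Rightarrow> ('a \<Rightarrow> 'b::real_normed_vector) \<Rightarrow> bool" where
  "Ck_on 0 S f \<longleftrightarrow> continuous_on S f"
| "Ck_on (Suc k) S f \<longleftrightarrow>
     (\<forall>x\<in>S. f differentiable (at x)) \<and> (\<forall>v. Ck_on k S (\<lambda>x. frechet_derivative f (at x) v))"

definition paracompact_space :: "'a topology \<Rightarrow> bool" where
  "paracompact_space X \<longleftrightarrow>
     (\<forall>\<U>. (\<forall>U\<in>\<U>. openin X U) \<and> \<Union>\<U> = topspace X \<longrightarrow>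
        (\<exists>\<V>. (\<forall>V\<in>\<V>. openin X V) \<and> \<Union>\<V> = topspace X \<and> (\<forall>V\<in>\<V>. \<exists>U\<in>\<U>. V \<subseteq> U) \<and>
             locally_finite_in X \<V>))"

text \<open>A chart is a pair of its domain and its coordinate map; the values of the map outside
  the domain are irrelevant.\<close>

type_synonym ('q, 'e) chart = "'q set \<times> ('q \<Rightarrow> 'e)"

definition chart_inv :: "('q, 'e) chart \<Rightarrow> 'e \<Rightarrow> 'q" where
  "chart_inv \<phi> = inv_into (fst \<phi>) (snd \<phi>)"

definition is_chart :: "('q::topological_space, 'e::euclidean_space) chart \<Rightarrow> bool" where
  "is_chart \<phi> \<longleftrightarrow> open (fst \<phi>) \<and> open (snd \<phi> ` fst \<phi>) \<and>
     homeomorphism (fst \<phi>) (snd \<phi> ` fst \<phi>) (snd \<phi>) (chart_inv \<phi>)"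

text \<open>The manifold is the whole type \<open>'q\<close>; its dimension is \<open>DIM('e)\<close>. The Hausdorff
  property is the class \<open>t2_space\<close>.\<close>

definition Ck_manifold :: "nat \<Rightarrow> ('q::t2_space, 'e::euclidean_space) chart set \<Rightarrow> bool" where
  "Ck_manifold k A \<longleftrightarrow>
     paracompact_space (euclidean :: 'q topology) \<and>
     (\<forall>\<phi>\<in>A. is_chart \<phi>) \<and> (\<Union>\<phi>\<in>A. fst \<phi>) = UNIV \<and>
     (\<forall>\<phi>\<in>A. \<forall>\<psi>\<in>A. Ck_on k (snd \<phi> ` (fst \<phi> \<inter> fst \<psi>)) (snd \<psi> \<circ> chart_inv \<phi>))"

definition charts_at :: "('q, 'e) chart set \<Rightarrow> 'q \<Rightarrow> ('q, 'e) chart set" where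
  "charts_at A q = {\<phi>\<in>A. q \<in> fst \<phi>}"

section \<open>Tangent vectors\<close>

text \<open>A tangent vector at \<open>q\<close> is the family of its coordinate representatives in the charts
  at \<open>q\<close>, transforming with the derivatives of the transition maps. It is extended by \<open>0\<close> to all
  other charts, so that equality of tangent vectors is equality of functions.\<close>

type_synonym ('q, 'e) tvec = "('q, 'e) chart \<Rightarrow> 'e"

definition tangent_space ::
  "('q, 'e::euclidean_space) chart set \<Rightarrow> 'q \<Rightarrow> ('q, 'e) tvec set" where
  "tangent_space A q =
     {v. (\<forall>\<phi>\<in>charts_at A q. \<forall>\<psi>\<in>charts_at A q.
            v \<psi> = frechet_derivative (snd \<psi> \<circ> chart_inv \<phi>) (at (snd \<phi> q)) (v \<phi>)) \<and>
         (\<forall>\<phi>. \<phi> \<notin> charts_at A q \<longrightarrow> v \<phi> = 0)}"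

text \<open>The tangent vector at \<open>q\<close> whose representative in the chart \<open>\<phi>\<close> is \<open>e\<close>.\<close>

definition chart_vec ::
  "('q, 'e::euclidean_space) chart set \<Rightarrow> ('q, 'e) chart \<Rightarrow> 'q \<Rightarrow> 'e \<Rightarrow> ('q, 'e) tvec" where
  "chart_vec A \<phi> q e = (\<lambda>\<psi>. if \<psi> \<in> charts_at A q
     then frechet_derivative (snd \<psi> \<circ> chart_inv \<phi>) (at (snd \<phi> q)) e else 0)"

definition tvec_linear ::
  "('q, 'e::euclidean_space) chart set \<Rightarrow> 'q \<Rightarrow> (('q, 'e) tvec \<Rightarrow> real) \<Rightarrow> bool" where
  "tvec_linear A q p \<longleftrightarrow>
     (\<forall>v\<in>tangent_space A q. \<forall>w\<in>tangent_space A q. p (\<lambda>\<phi>. v \<phi> + w \<phi>) = p v + p w) \<and>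
     (\<forall>v\<in>tangent_space A q. \<forall>c. p (\<lambda>\<phi>. c *\<^sub>R v \<phi>) = c * p v)"

text \<open>The chart chosen is immaterial when \<open>f\<close> is differentiable at \<open>q\<close>, by the chain rule.\<close>

definition some_chart :: "('q, 'e) chart set \<Rightarrow> 'q \<Rightarrow> ('q, 'e) chart" where
  "some_chart A q = (SOME \<phi>. \<phi> \<in> charts_at A q)"

definition dQ ::
  "('q, 'e::euclidean_space) chart set \<Rightarrow> ('q \<Rightarrow> real) \<Rightarrow> 'q \<Rightarrow> ('q, 'e) tvec \<Rightarrow> real" where
  "dQ A f q v = (let \<phi> = some_chart A q in
     frechet_derivative (f \<circ> chart_inv \<phi>) (at (snd \<phi> q)) (v \<phi>))"

text \<open>In both definitions below, \<open>I\<close> is a compact interval and derivatives at its endpoints are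
  one-sided.\<close>

definition velocity ::
  "('q, 'e::euclidean_space) chart set \<Rightarrow> real set \<Rightarrow> (real \<Rightarrow> 'q) \<Rightarrow> real \<Rightarrow> ('q, 'e) tvec" where
  "velocity A I c s = (\<lambda>\<phi>. if \<phi> \<in> charts_at A (c s)
     then vector_derivative (snd \<phi> \<circ> c) (at s within I) else 0)"

definition C1_curve ::
  "('q::topological_space, 'e::euclidean_space) chart set \<Rightarrow> real set \<Rightarrow> (real \<Rightarrow> 'q) \<Rightarrow> bool" where
  "C1_curve A I c \<longleftrightarrow> continuous_on I c \<and>
     (\<forall>\<phi>\<in>A. \<exists>D. continuous_on {s\<in>I. c s \<in> fst \<phi>} D \<and>
        (\<forall>s\<in>I. c s \<in> fst \<phi> \<longrightarrow> (snd \<phi> \<circ> c has_vector_derivative D s) (at s within I)))"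

definition C1_real :: "real set \<Rightarrow> (real \<Rightarrow> real) \<Rightarrow> bool" where
  "C1_real I f \<longleftrightarrow>
     (\<exists>D. continuous_on I D \<and> (\<forall>s\<in>I. (f has_vector_derivative D s) (at s within I)))"

section \<open>Duality\<close>

text \<open>Raising an index on the vector space \<open>X\<close> with the nondegenerate bilinear form \<open>h\<close>, and the
  form induced by \<open>h\<close> on the dual of \<open>X\<close>.\<close>

definition sharp :: "'v set \<Rightarrow> ('v \<Rightarrow> 'v \<Rightarrow> real) \<Rightarrow> ('v \<Rightarrow> real) \<Rightarrow> 'v" where
  "sharp X h \<alpha> = (THE u. u \<in> X \<and> (\<forall>w\<in>X. h u w = \<alpha> w))"

definition dual_form ::
  "'v set \<Rightarrow> ('v \<Rightarrow> 'v \<Rightarrow> real) \<Rightarrow> ('v \<Rightarrow> real) \<Rightarrow> ('v \<Rightarrow> real) \<Rightarrow> real" where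
  "dual_form X h \<alpha> \<beta> = h (sharp X h \<alpha>) (sharp X h \<beta>)"

section \<open>Time-dependent fields on \<open>Q\<close>\<close>

definition Cr_metric ::
  "nat \<Rightarrow> ('q, 'e::euclidean_space) chart set \<Rightarrow> real set \<Rightarrow>
     (real \<Rightarrow> 'q \<Rightarrow> ('q, 'e) tvec \<Rightarrow> ('q, 'e) tvec \<Rightarrow> real) \<Rightarrow> bool" where
  "Cr_metric r A T a \<longleftrightarrow>
     (\<forall>t\<in>T. \<forall>q. \<forall>v\<in>tangent_space A q. tvec_linear A q (a t q v)) \<and>
     (\<forall>t\<in>T. \<forall>q. \<forall>v\<in>tangent_space A q. \<forall>w\<in>tangent_space A q. a t q v w = a t q w v) \<and>
     (\<forall>t\<in>T. \<forall>q. \<forall>v\<in>tangent_space A q. v \<noteq> (\<lambda>_. 0) \<longrightarrow> 0 < a t q v v) \<and>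
     (\<forall>\<phi>\<in>A. \<forall>i\<in>Basis. \<forall>j\<in>Basis. Ck_on r (T \<times> snd \<phi> ` fst \<phi>)
        (\<lambda>(t, z). let q = chart_inv \<phi> z in a t q (chart_vec A \<phi> q i) (chart_vec A \<phi> q j)))"

definition Cr_oneform ::
  "nat \<Rightarrow> ('q, 'e::euclidean_space) chart set \<Rightarrow> real set \<Rightarrow>
     (real \<Rightarrow> 'q \<Rightarrow> ('q, 'e) tvec \<Rightarrow> real) \<Rightarrow> bool" where
  "Cr_oneform r A T b \<longleftrightarrow>
     (\<forall>t\<in>T. \<forall>q. tvec_linear A q (b t q)) \<and>
     (\<forall>\<phi>\<in>A. \<forall>i\<in>Basis. Ck_on r (T \<times> snd \<phi> ` fst \<phi>)
        (\<lambda>(t, z). let q = chart_inv \<phi> z in b t q (chart_vec A \<phi> q i)))"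

definition Cr_function ::
  "nat \<Rightarrow> ('q, 'e::euclidean_space) chart set \<Rightarrow> real set \<Rightarrow> (real \<Rightarrow> 'q \<Rightarrow> real) \<Rightarrow> bool" where
  "Cr_function r A T V \<longleftrightarrow>
     (\<forall>\<phi>\<in>A. Ck_on r (T \<times> snd \<phi> ` fst \<phi>) (\<lambda>(t, z). V t (chart_inv \<phi> z)))"

section \<open>Mechanics\<close>

definition lagrangian ::
  "(real \<Rightarrow> 'q \<Rightarrow> ('q, 'e) tvec \<Rightarrow> ('q, 'e) tvec \<Rightarrow> real) \<Rightarrow>
     (real \<Rightarrow> 'q \<Rightarrow> ('q, 'e) tvec \<Rightarrow> real) \<Rightarrow> (real \<Rightarrow> 'q \<Rightarrow> real) \<Rightarrow>
     real \<Rightarrow> 'q \<Rightarrow> ('q, 'e) tvec \<Rightarrow> real" where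
  "lagrangian a b V t q v = a t q v v / 2 + b t q v - V t q"

definition hamiltonian ::
  "('q, 'e::euclidean_space) chart set \<Rightarrow>
     (real \<Rightarrow> 'q \<Rightarrow> ('q, 'e) tvec \<Rightarrow> ('q, 'e) tvec \<Rightarrow> real) \<Rightarrow>
     (real \<Rightarrow> 'q \<Rightarrow> ('q, 'e) tvec \<Rightarrow> real) \<Rightarrow> (real \<Rightarrow> 'q \<Rightarrow> real) \<Rightarrow>
     real \<Rightarrow> 'q \<Rightarrow> (('q, 'e) tvec \<Rightarrow> real) \<Rightarrow> real" where
  "hamiltonian A a b V t q p =
     dual_form (tangent_space A q) (a t q) (\<lambda>v. p v - b t q v) (\<lambda>v. p v - b t q v) / 2 + V t q"

definition action ::
  "('q, 'e::euclidean_space) chart set \<Rightarrow>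
     (real \<Rightarrow> 'q \<Rightarrow> ('q, 'e) tvec \<Rightarrow> ('q, 'e) tvec \<Rightarrow> real) \<Rightarrow>
     (real \<Rightarrow> 'q \<Rightarrow> ('q, 'e) tvec \<Rightarrow> real) \<Rightarrow> (real \<Rightarrow> 'q \<Rightarrow> real) \<Rightarrow>
     real \<Rightarrow> real \<Rightarrow> (real \<Rightarrow> 'q) \<Rightarrow> real" where
  "action A a b V t0 t1 c =
     integral {t0..t1} (\<lambda>t. lagrangian a b V t (c t) (velocity A {t0..t1} c t))"

definition least_action ::
  "('q::topological_space, 'e::euclidean_space) chart set \<Rightarrow>
     (real \<Rightarrow> 'q \<Rightarrow> ('q, 'e) tvec \<Rightarrow> ('q, 'e) tvec \<Rightarrow> real) \<Rightarrow>
     (real \<Rightarrow> 'q \<Rightarrow> ('q, 'e) tvec \<Rightarrow> real) \<Rightarrow> (real \<Rightarrow> 'q \<Rightarrow> real) \<Rightarrow>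
     real \<times> 'q \<Rightarrow> real \<times> 'q \<Rightarrow> ereal" where
  "least_action A a b V = (\<lambda>(t0, q0) (t1, q1).
     if t0 < t1 then
       Inf {ereal (action A a b V t0 t1 c) | c. C1_curve A {t0..t1} c \<and> c t0 = q0 \<and> c t1 = q1}
     else if (t0, q0) = (t1, q1) then 0
     else \<infinity>)"

section \<open>The spacetime\<close>

text \<open>The spacetime is \<open>T \<times> Q \<times> \<real>\<close>. Its tangent space at \<open>(t, q, y)\<close> is identified as usual with
  \<open>\<real> \<times> T\<^sub>qQ \<times> \<real>\<close>: the components of \<open>v\<close> are \<open>dt(v)\<close>, the projection of \<open>v\<close> to \<open>Q\<close>, and \<open>dy(v)\<close>.\<close>

type_synonym 'q event = "real \<times> 'q \<times> real"
type_synonym ('q, 'e) mvec = "real \<times> ('q, 'e) tvec \<times> real"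

definition tangent_space_M ::
  "('q, 'e::euclidean_space) chart set \<Rightarrow> 'q event \<Rightarrow> ('q, 'e) mvec set" where
  "tangent_space_M A = (\<lambda>(t, q, y). UNIV \<times> tangent_space A q \<times> UNIV)"

definition gw_metric ::
  "(real \<Rightarrow> 'q \<Rightarrow> ('q, 'e) tvec \<Rightarrow> ('q, 'e) tvec \<Rightarrow> real) \<Rightarrow>
     (real \<Rightarrow> 'q \<Rightarrow> ('q, 'e) tvec \<Rightarrow> real) \<Rightarrow> (real \<Rightarrow> 'q \<Rightarrow> real) \<Rightarrow>
     'q event \<Rightarrow> ('q, 'e) mvec \<Rightarrow> ('q, 'e) mvec \<Rightarrow> real" where
  "gw_metric a b V = (\<lambda>(t, q, y) (v\<^sub>t, v, v\<^sub>y) (w\<^sub>t, w, w\<^sub>y).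
     a t q v w - v\<^sub>t * (w\<^sub>y - b t q w) - (v\<^sub>y - b t q v) * w\<^sub>t - 2 * V t q * v\<^sub>t * w\<^sub>t)"

definition time_orientation ::
  "(real \<Rightarrow> 'q \<Rightarrow> real) \<Rightarrow> 'q event \<Rightarrow> ('q, 'e::zero) mvec" where
  "time_orientation V = (\<lambda>(t, q, y). (1, (\<lambda>_. 0), - (V t q - 1/2)))"

definition fd_causal ::
  "(real \<Rightarrow> 'q \<Rightarrow> ('q, 'e::zero) tvec \<Rightarrow> ('q, 'e) tvec \<Rightarrow> real) \<Rightarrow>
     (real \<Rightarrow> 'q \<Rightarrow> ('q, 'e) tvec \<Rightarrow> real) \<Rightarrow> (real \<Rightarrow> 'q \<Rightarrow> real) \<Rightarrow>
     'q event \<Rightarrow> ('q, 'e) mvec \<Rightarrow> bool" where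
  "fd_causal a b V x v \<longleftrightarrow> v \<noteq> (0, (\<lambda>_. 0), 0) \<and>
     gw_metric a b V x v v \<le> 0 \<and> gw_metric a b V x v (time_orientation V x) < 0"

definition velocity_M ::
  "('q, 'e::euclidean_space) chart set \<Rightarrow> real set \<Rightarrow> (real \<Rightarrow> 'q event) \<Rightarrow> real \<Rightarrow>
     ('q, 'e) mvec" where
  "velocity_M A I \<gamma> s =
     (vector_derivative (\<lambda>s. fst (\<gamma> s)) (at s within I),
      velocity A I (\<lambda>s. fst (snd (\<gamma> s))) s,
      vector_derivative (\<lambda>s. snd (snd (\<gamma> s))) (at s within I))"

definition C1_curve_M ::
  "('q::topological_space, 'e::euclidean_space) chart set \<Rightarrow> real set \<Rightarrow> real set \<Rightarrow>
     (real \<Rightarrow> 'q event) \<Rightarrow> bool" where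
  "C1_curve_M A T I \<gamma> \<longleftrightarrow> (\<forall>s\<in>I. fst (\<gamma> s) \<in> T) \<and>
     C1_real I (\<lambda>s. fst (\<gamma> s)) \<and>
     C1_curve A I (\<lambda>s. fst (snd (\<gamma> s))) \<and>
     C1_real I (\<lambda>s. snd (snd (\<gamma> s)))"

text \<open>Causal curves are piecewise \<open>C\<^sup>1\<close>; \<open>\<tau> 0 < \<dots> < \<tau> n\<close> are the break points.\<close>

definition fd_causal_curve ::
  "('q::topological_space, 'e::euclidean_space) chart set \<Rightarrow> real set \<Rightarrow>
     (real \<Rightarrow> 'q \<Rightarrow> ('q, 'e) tvec \<Rightarrow> ('q, 'e) tvec \<Rightarrow> real) \<Rightarrow>
     (real \<Rightarrow> 'q \<Rightarrow> ('q, 'e) tvec \<Rightarrow> real) \<Rightarrow> (real \<Rightarrow> 'q \<Rightarrow> real) \<Rightarrow>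
     real \<Rightarrow> real \<Rightarrow> (real \<Rightarrow> 'q event) \<Rightarrow> bool" where
  "fd_causal_curve A T a b V s0 s1 \<gamma> \<longleftrightarrow> s0 < s1 \<and>
     (\<exists>n \<tau>. \<tau> (0::nat) = s0 \<and> \<tau> n = s1 \<and>
        (\<forall>i<n. \<tau> i < \<tau> (Suc i) \<and> C1_curve_M A T {\<tau> i..\<tau> (Suc i)} \<gamma> \<and>
           (\<forall>s\<in>{\<tau> i..\<tau> (Suc i)}.
              fd_causal a b V (\<gamma> s) (velocity_M A {\<tau> i..\<tau> (Suc i)} \<gamma> s))))"

text \<open>The integrand is meaningless at the finitely many break points, which does not affect the
  integral.\<close>

definition lorentz_length ::
  "('q, 'e::euclidean_space) chart set \<Rightarrow>
     (real \<Rightarrow> 'q \<Rightarrow> ('q, 'e) tvec \<Rightarrow> ('q, 'e) tvec \<Rightarrow> real) \<Rightarrow>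
     (real \<Rightarrow> 'q \<Rightarrow> ('q, 'e) tvec \<Rightarrow> real) \<Rightarrow> (real \<Rightarrow> 'q \<Rightarrow> real) \<Rightarrow>
     real \<Rightarrow> real \<Rightarrow> (real \<Rightarrow> 'q event) \<Rightarrow> real" where
  "lorentz_length A a b V s0 s1 \<gamma> =
     integral {s0..s1} (\<lambda>s. let v = velocity_M A {s0..s1} \<gamma> s
                            in sqrt (- gw_metric a b V (\<gamma> s) v v))"

definition lorentz_dist ::
  "('q::topological_space, 'e::euclidean_space) chart set \<Rightarrow> real set \<Rightarrow>
     (real \<Rightarrow> 'q \<Rightarrow> ('q, 'e) tvec \<Rightarrow> ('q, 'e) tvec \<Rightarrow> real) \<Rightarrow>
     (real \<Rightarrow> 'q \<Rightarrow> ('q, 'e) tvec \<Rightarrow> real) \<Rightarrow> (real \<Rightarrow> 'q \<Rightarrow> real) \<Rightarrow>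
     'q event \<Rightarrow> 'q event \<Rightarrow> ereal" where
  "lorentz_dist A T a b V x0 x1 =
     Sup (insert 0 {ereal (lorentz_length A a b V s0 s1 \<gamma>) | s0 s1 \<gamma>.
            fd_causal_curve A T a b V s0 s1 \<gamma> \<and> \<gamma> s0 = x0 \<and> \<gamma> s1 = x1})"

section \<open>Differentiability on \<open>E = T \<times> Q\<close> and on the spacetime\<close>

definition differentiable_E ::
  "('q, 'e::euclidean_space) chart set \<Rightarrow> (real \<times> 'q \<Rightarrow> real) \<Rightarrow> real \<times> 'q \<Rightarrow> bool" where
  "differentiable_E A f = (\<lambda>(t, q). \<forall>\<phi>\<in>charts_at A q.
     (\<lambda>(s, z). f (s, chart_inv \<phi> z)) differentiable (at (t, snd \<phi> q)))"

definition chart_rep_M :: "('q, 'e) chart \<Rightarrow> ('q event \<Rightarrow> real) \<Rightarrow> real \<times> 'e \<times> real \<Rightarrow> real" where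
  "chart_rep_M \<phi> f = (\<lambda>(s, z, u). f (s, chart_inv \<phi> z, u))"

definition differentiable_M ::
  "('q, 'e::euclidean_space) chart set \<Rightarrow> ('q event \<Rightarrow> real) \<Rightarrow> 'q event \<Rightarrow> bool" where
  "differentiable_M A f = (\<lambda>(t, q, y). \<forall>\<phi>\<in>charts_at A q.
     chart_rep_M \<phi> f differentiable (at (t, snd \<phi> q, y)))"

definition dM ::
  "('q, 'e::euclidean_space) chart set \<Rightarrow> ('q event \<Rightarrow> real) \<Rightarrow> 'q event \<Rightarrow>
     ('q, 'e) mvec \<Rightarrow> real" where
  "dM A f = (\<lambda>(t, q, y) (v\<^sub>t, v, v\<^sub>y). let \<phi> = some_chart A q in
     frechet_derivative (chart_rep_M \<phi> f) (at (t, snd \<phi> q, y)) (v\<^sub>t, v \<phi>, v\<^sub>y))"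

definition gradient_M ::
  "('q, 'e::euclidean_space) chart set \<Rightarrow>
     (real \<Rightarrow> 'q \<Rightarrow> ('q, 'e) tvec \<Rightarrow> ('q, 'e) tvec \<Rightarrow> real) \<Rightarrow>
     (real \<Rightarrow> 'q \<Rightarrow> ('q, 'e) tvec \<Rightarrow> real) \<Rightarrow> (real \<Rightarrow> 'q \<Rightarrow> real) \<Rightarrow>
     ('q event \<Rightarrow> real) \<Rightarrow> 'q event \<Rightarrow> ('q, 'e) mvec" where
  "gradient_M A a b V f x = sharp (tangent_space_M A x) (gw_metric a b V x) (dM A f x)"

end

theory Submission
  imports Defs
begin

text \<open>For \<open>t > t\<^sub>0\<close> and \<open>y - y\<^sub>0 > S\<close> the distance is \<open>d = sqrt (2 (t - t\<^sub>0) (y - y\<^sub>0 - S))\<close>; the claim is then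
  the chain rule and the computation of the \<open>g\<close>-gradient. A curve in \<open>Q\<close> of action \<open>\<alpha> < y - y\<^sub>0\<close>,
  lifted with \<open>y' = L + const\<close>, has constant speed and length \<open>sqrt (2 (t - t\<^sub>0) (y - y\<^sub>0 - \<alpha>))\<close>, which
  gives the lower bound. For the upper bound, a causal curve of length \<open>\<ell>\<close> satisfies, for every \<open>l > 0\<close>,
  \<open>S \<le> y - y\<^sub>0 + 2 l\<^sup>2 (t - t\<^sub>0) - 2 l \<ell>\<close>. This bound is additive along the curve, because \<open>S\<close> satisfies
  the triangle inequality (curves are reparametrized to stop at a junction, so that they join in a \<open>C\<^sup>1\<close>
  way), and so only has to be proved on short pieces up to an error. There the
  curve, which need not be a graph over the \<open>t\<close>-axis since \<open>t'\<close> may vanish, is compared with the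
  straight segment with the same endpoints in a chart, freezing the coefficients.\<close>

section \<open>Charts and tangent vectors\<close>

text \<open>The parameter l is there because the formula for d is not additive along a curve: sqrt
  (2 (t - t0) (y - y0 - S)) is the infimum over l > 0 of l (t - t0) + (y - y0 - S) / (2 l), and for
  fixed l this is affine in t, y and S. The minimiser l = d / (2 (t - t0)) is inserted only after
  the pieces have been added up.

  The kinetic term of the action along a causal curve is a(q', q') / (2 t'), a convex function of
  (q', t') that makes no sense where t' = 0. On a short piece it is replaced by its affine minorants
  a(q', u) - t' a(u, u) / 2, one for each constant vector u; they involve no division and integrate
  to expressions in the endpoints alone. Taking for u the velocity of the straight segment
  afterwards yields Jensen's inequality.

  No minimising curve is used. Finiteness of S near (t, q) makes the formula for d valid on a
  neighbourhood, and differentiability at the single point (t, q) is then enough to differentiate it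
  there.\<close>

lemma Ck_on_continuous_on: "Ck_on k S f \<Longrightarrow> continuous_on S f"
  by (cases k) (auto intro!: continuous_at_imp_continuous_on differentiable_imp_continuous_within)

text \<open>Coordinate expressions exist only on the part of a domain that is mapped into one chart;
  this passes from such relatively open parts to the whole.\<close>

lemma continuous_on_local:
  fixes f :: "'a::t2_space \<Rightarrow> 'b::topological_space"
  assumes "\<And>x. x \<in> X \<Longrightarrow> \<exists>O'. open O' \<and> x \<in> O' \<and> continuous_on (X \<inter> O') f"
  shows "continuous_on X f"
  unfolding continuous_on_eq_continuous_within
proof
  fix x assume x: "x \<in> X"
  from assms[OF x] obtain O' where O': "open O'" "x \<in> O'" "continuous_on (X \<inter> O') f" by blast
  have "at x within X = at x within (X \<inter> O')"
    by (rule at_within_nhd[OF O'(2,1)]) auto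
  then show "continuous (at x within X) f"
    using O' x by (auto simp: continuous_on_eq_continuous_within continuous_within)
qed

text \<open>The class is written \<open>Suc k\<close> so that transition maps are at least C^1;
  being C^1 near a point and having a given velocity there can then be checked in a single
  chart.\<close>

locale atlas =
  fixes k :: nat and A :: "('q::t2_space, 'e::euclidean_space) chart set"
  assumes manifold: "Ck_manifold (Suc k) A"
begin

abbreviation trans_map :: "('q, 'e) chart \<Rightarrow> ('q, 'e) chart \<Rightarrow> 'e \<Rightarrow> 'e" where
  "trans_map \<phi> \<psi> \<equiv> snd \<psi> \<circ> chart_inv \<phi>"

abbreviation trans_deriv :: "('q, 'e) chart \<Rightarrow> ('q, 'e) chart \<Rightarrow> 'e \<Rightarrow> 'e \<Rightarrow> 'e" where
  "trans_deriv \<phi> \<psi> z \<equiv> frechet_derivative (trans_map \<phi> \<psi>) (at z)"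

lemma is_chart: "\<phi> \<in> A \<Longrightarrow> is_chart \<phi>"
  using manifold by (auto simp: Ck_manifold_def)

lemma open_dom: "\<phi> \<in> A \<Longrightarrow> open (fst \<phi>)"
  using is_chart by (auto simp: is_chart_def)

lemma open_img: "\<phi> \<in> A \<Longrightarrow> open (snd \<phi> ` fst \<phi>)"
  using is_chart by (auto simp: is_chart_def)

lemma chart_homeo:
  "\<phi> \<in> A \<Longrightarrow> homeomorphism (fst \<phi>) (snd \<phi> ` fst \<phi>) (snd \<phi>) (chart_inv \<phi>)"
  using is_chart by (auto simp: is_chart_def)

lemma chart_inv_left [simp]: "\<phi> \<in> A \<Longrightarrow> q \<in> fst \<phi> \<Longrightarrow> chart_inv \<phi> (snd \<phi> q) = q"
  using chart_homeo by (auto simp: homeomorphism_def)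

lemma chart_inv_right [simp]:
  "\<phi> \<in> A \<Longrightarrow> z \<in> snd \<phi> ` fst \<phi> \<Longrightarrow> snd \<phi> (chart_inv \<phi> z) = z"
  using chart_homeo by (auto simp: homeomorphism_def)

lemma chart_inv_in: "\<phi> \<in> A \<Longrightarrow> z \<in> snd \<phi> ` fst \<phi> \<Longrightarrow> chart_inv \<phi> z \<in> fst \<phi>"
  by auto

lemma continuous_on_chart: "\<phi> \<in> A \<Longrightarrow> continuous_on (fst \<phi>) (snd \<phi>)"
  using chart_homeo by (auto simp: homeomorphism_def)

lemma continuous_on_chart_inv: "\<phi> \<in> A \<Longrightarrow> continuous_on (snd \<phi> ` fst \<phi>) (chart_inv \<phi>)"
  using chart_homeo by (auto simp: homeomorphism_def)

lemma charts_atD: "\<phi> \<in> charts_at A q \<Longrightarrow> \<phi> \<in> A" "\<phi> \<in> charts_at A q \<Longrightarrow> q \<in> fst \<phi>"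
  by (auto simp: charts_at_def)

lemma ex_chart: obtains \<phi> where "\<phi> \<in> charts_at A q"
proof -
  have "q \<in> (\<Union>\<phi>\<in>A. fst \<phi>)" using manifold by (simp add: Ck_manifold_def)
  then show ?thesis using that by (auto simp: charts_at_def)
qed

lemma some_chart: "some_chart A q \<in> charts_at A q"
  unfolding some_chart_def by (rule someI_ex) (meson ex_chart)

lemma open_overlap:
  assumes "\<phi> \<in> A" "\<psi> \<in> A" shows "open (snd \<phi> ` (fst \<phi> \<inter> fst \<psi>))"
proof -
  have "snd \<phi> ` (fst \<phi> \<inter> fst \<psi>) = chart_inv \<phi> -` fst \<psi> \<inter> snd \<phi> ` fst \<phi>"
    using assms by auto
  then show ?thesis
    using continuous_open_preimage[OF continuous_on_chart_inv open_img open_dom] assms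
    by (metis Int_commute)
qed

lemma trans_Ck:
  assumes "\<phi> \<in> A" "\<psi> \<in> A"
  shows "Ck_on (Suc k) (snd \<phi> ` (fst \<phi> \<inter> fst \<psi>)) (trans_map \<phi> \<psi>)"
  using manifold assms by (simp add: Ck_manifold_def)

lemma trans_has_derivative:
  assumes "\<phi> \<in> charts_at A q" "\<psi> \<in> charts_at A q"
  shows "(trans_map \<phi> \<psi> has_derivative trans_deriv \<phi> \<psi> (snd \<phi> q)) (at (snd \<phi> q))"
proof -
  have "trans_map \<phi> \<psi> differentiable (at (snd \<phi> q))"
    using trans_Ck[of \<phi> \<psi>] assms by (auto simp: charts_at_def)
  then show ?thesis using frechet_derivative_works by blast
qed

lemma linear_trans_deriv:
  assumes "\<phi> \<in> charts_at A q" "\<psi> \<in> charts_at A q"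
  shows "linear (trans_deriv \<phi> \<psi> (snd \<phi> q))"
  using trans_has_derivative[OF assms] has_derivative_linear by blast

lemma trans_deriv_refl:
  assumes "\<phi> \<in> charts_at A q"
  shows "trans_deriv \<phi> \<phi> (snd \<phi> q) e = e"
proof -
  have "((\<lambda>z. z) has_derivative (\<lambda>z. z)) (at (snd \<phi> q))" by simp
  then have "(trans_map \<phi> \<phi> has_derivative (\<lambda>z. z)) (at (snd \<phi> q))"
    by (rule has_derivative_transform_within_open[OF _ open_img[of \<phi>]])
      (use assms in \<open>auto simp: charts_at_def\<close>)
  then show ?thesis by (metis frechet_derivative_at)
qed

lemma trans_deriv_compose:
  assumes "\<phi> \<in> charts_at A q" "\<psi> \<in> charts_at A q" "\<omega> \<in> charts_at A q"
  shows "trans_deriv \<psi> \<omega> (snd \<psi> q) (trans_deriv \<phi> \<psi> (snd \<phi> q) e) = trans_deriv \<phi> \<omega> (snd \<phi> q) e"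
proof -
  have q: "trans_map \<phi> \<psi> (snd \<phi> q) = snd \<psi> q" using assms by (auto simp: charts_at_def)
  have "(trans_map \<psi> \<omega> \<circ> trans_map \<phi> \<psi> has_derivative
      trans_deriv \<psi> \<omega> (snd \<psi> q) \<circ> trans_deriv \<phi> \<psi> (snd \<phi> q)) (at (snd \<phi> q))"
    using diff_chain_at[OF trans_has_derivative[OF assms(1,2)]] trans_has_derivative[OF assms(2,3)] q
    by metis
  then have "(trans_map \<phi> \<omega> has_derivative
      trans_deriv \<psi> \<omega> (snd \<psi> q) \<circ> trans_deriv \<phi> \<psi> (snd \<phi> q)) (at (snd \<phi> q))"
    by (rule has_derivative_transform_within_open[OF _ open_overlap[of \<phi> \<psi>]])
      (use assms in \<open>auto simp: charts_at_def\<close>)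
  then show ?thesis by (metis frechet_derivative_at comp_apply)
qed

text \<open>\<open>Ck_on\<close> gives continuity in the point for each fixed direction only.
  Expanding the direction in a basis makes the continuity joint, as is needed for velocities that
  vary with the point.\<close>

lemma trans_deriv_continuous:
  assumes "\<phi> \<in> A" "\<psi> \<in> A"
  shows "continuous_on (snd \<phi> ` (fst \<phi> \<inter> fst \<psi>) \<times> UNIV) (\<lambda>(z, e). trans_deriv \<phi> \<psi> z e)"
proof -
  let ?Z = "snd \<phi> ` (fst \<phi> \<inter> fst \<psi>)"
  have "continuous_on ?Z (\<lambda>z. trans_deriv \<phi> \<psi> z i)" for i
    using trans_Ck[OF assms] by (auto intro: Ck_on_continuous_on)
  then have "continuous_on (?Z \<times> UNIV) (\<lambda>p. \<Sum>i\<in>Basis. (snd p \<bullet> i) *\<^sub>R trans_deriv \<phi> \<psi> (fst p) i)"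
    by (intro continuous_intros) (auto intro!: continuous_on_compose2[of ?Z _ _ fst] continuous_intros)
  moreover have "trans_deriv \<phi> \<psi> z e = (\<Sum>i\<in>Basis. (e \<bullet> i) *\<^sub>R trans_deriv \<phi> \<psi> z i)" if "z \<in> ?Z" for z e
  proof -
    from that obtain q where "z = snd \<phi> q" "\<phi> \<in> charts_at A q" "\<psi> \<in> charts_at A q"
      using assms by (auto simp: charts_at_def)
    then have lin: "linear (trans_deriv \<phi> \<psi> z)" using linear_trans_deriv by blast
    have "trans_deriv \<phi> \<psi> z e = trans_deriv \<phi> \<psi> z (\<Sum>i\<in>Basis. (e \<bullet> i) *\<^sub>R i)"
      by (simp add: euclidean_representation)
    also have "\<dots> = (\<Sum>i\<in>Basis. (e \<bullet> i) *\<^sub>R trans_deriv \<phi> \<psi> z i)"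
      by (simp only: linear_sum[OF lin] linear_cmul[OF lin])
    finally show ?thesis .
  qed
  ultimately show ?thesis
    unfolding case_prod_unfold by (elim continuous_on_eq) (simp add: mem_Times_iff)
qed

text \<open>From here to \<open>tvec_linear_chart\<close>: evaluation in a chart at \<open>q\<close>
  is a linear isomorphism of the tangent space onto the model space, with inverse
  \<open>chart_vec\<close>. Questions about tangent vectors thereby reduce to one coordinate
  vector.\<close>

lemma chart_vec_self: "\<phi> \<in> charts_at A q \<Longrightarrow> chart_vec A \<phi> q e \<phi> = e"
  by (simp add: chart_vec_def trans_deriv_refl)

lemma chart_vec_tangent: "\<phi> \<in> charts_at A q \<Longrightarrow> chart_vec A \<phi> q e \<in> tangent_space A q"
  by (auto simp: tangent_space_def chart_vec_def trans_deriv_compose)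

lemma tangent_eq_chart_vec:
  assumes "v \<in> tangent_space A q" "\<phi> \<in> charts_at A q" 
  shows "v = chart_vec A \<phi> q (v \<phi>)"
proof
  fix \<psi>
  show "v \<psi> = chart_vec A \<phi> q (v \<phi>) \<psi>"
  proof (cases "\<psi> \<in> charts_at A q")
    case True
    then have "v \<psi> = trans_deriv \<phi> \<psi> (snd \<phi> q) (v \<phi>)"
      using assms unfolding tangent_space_def by blast
    then show ?thesis using True by (simp only: chart_vec_def if_True)
  next
    case False
    then have "v \<psi> = 0" using assms(1) unfolding tangent_space_def by blast
    then show ?thesis using False by (simp add: chart_vec_def)
  qed
qed

lemma tangent_eqI:
  assumes "v \<in> tangent_space A q" "w \<in> tangent_space A q" "\<phi> \<in> charts_at A q" "v \<phi> = w \<phi>"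
  shows "v = w"
  using assms tangent_eq_chart_vec by metis

lemma chart_vec_add:
  assumes "\<phi> \<in> charts_at A q"
  shows "chart_vec A \<phi> q (e + f) = (\<lambda>\<psi>. chart_vec A \<phi> q e \<psi> + chart_vec A \<phi> q f \<psi>)"
  using linear_trans_deriv[OF assms] by (auto simp: chart_vec_def linear_add)

lemma chart_vec_scale:
  assumes "\<phi> \<in> charts_at A q"
  shows "chart_vec A \<phi> q (c *\<^sub>R e) = (\<lambda>\<psi>. c *\<^sub>R chart_vec A \<phi> q e \<psi>)"
  using linear_trans_deriv[OF assms] by (auto simp: chart_vec_def linear_cmul)

lemma chart_vec_0: "\<phi> \<in> charts_at A q \<Longrightarrow> chart_vec A \<phi> q 0 = (\<lambda>_. 0)"
  using chart_vec_scale[of \<phi> q 0 0] by simp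

lemma tangent_add:
  assumes "v \<in> tangent_space A q" "w \<in> tangent_space A q"
  shows "(\<lambda>\<psi>. v \<psi> + w \<psi>) \<in> tangent_space A q"
proof -
  obtain \<phi> where \<phi>: "\<phi> \<in> charts_at A q" by (rule ex_chart)
  show ?thesis
    using tangent_eq_chart_vec[OF assms(1) \<phi>] tangent_eq_chart_vec[OF assms(2) \<phi>]
      chart_vec_add[OF \<phi>] chart_vec_tangent[OF \<phi>] by metis
qed

lemma tangent_scale:
  assumes "v \<in> tangent_space A q"
  shows "(\<lambda>\<psi>. c *\<^sub>R v \<psi>) \<in> tangent_space A q"
proof -
  obtain \<phi> where \<phi>: "\<phi> \<in> charts_at A q" by (rule ex_chart)
  show ?thesis
    using tangent_eq_chart_vec[OF assms(1) \<phi>] chart_vec_scale[OF \<phi>] chart_vec_tangent[OF \<phi>] by metis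
qed

lemma tangent_0: "(\<lambda>_. 0) \<in> tangent_space A q"
proof -
  obtain \<phi> where \<phi>: "\<phi> \<in> charts_at A q" by (rule ex_chart)
  show ?thesis using chart_vec_tangent[OF \<phi>, of 0] by (simp add: chart_vec_0[OF \<phi>])
qed

lemma tvec_linear_chart:
  assumes "tvec_linear A q p" "\<phi> \<in> charts_at A q"
  shows "linear (\<lambda>e. p (chart_vec A \<phi> q e))"
  using assms by (intro linearI)
    (auto simp: chart_vec_add chart_vec_scale tvec_linear_def chart_vec_tangent)

end

section \<open>Curves and fields in charts\<close>

context atlas
begin

lemma eventually_in_chart:
  assumes "continuous (at s within I) c" "\<phi> \<in> charts_at A (c s)"
  shows "\<forall>\<^sub>F x in at s within I. c x \<in> fst \<phi>"
  using assms topological_tendstoD[of c "c s" "at s within I" "fst \<phi>"] open_dom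
  by (auto simp: continuous_within charts_at_def)

lemma has_vector_derivative_change_chart:
  assumes "(snd \<phi> \<circ> c has_vector_derivative w) (at s within I)" "s \<in> I"
    and "continuous (at s within I) c" and \<phi>: "\<phi> \<in> charts_at A (c s)" and \<psi>: "\<psi> \<in> charts_at A (c s)"
  shows "(snd \<psi> \<circ> c has_vector_derivative trans_deriv \<phi> \<psi> (snd \<phi> (c s)) w) (at s within I)"
proof -
  let ?D = "trans_deriv \<phi> \<psi> (snd \<phi> (c s))"
  have "(trans_map \<phi> \<psi> \<circ> (snd \<phi> \<circ> c) has_derivative ?D \<circ> (\<lambda>h. h *\<^sub>R w)) (at s within I)"
    using assms(1) trans_has_derivative[OF \<phi> \<psi>] unfolding has_vector_derivative_def
    by (metis comp_apply diff_chain_within has_derivative_at_withinI)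
  \<comment> \<open>The composite with the transition map equals \<open>snd \<psi> \<circ> c\<close>
    only while \<open>c\<close> stays in the domain of \<phi>, which continuity at \<open>s\<close>
    guarantees near \<open>s\<close>.\<close>
  then have "(snd \<psi> \<circ> c has_derivative ?D \<circ> (\<lambda>h. h *\<^sub>R w)) (at s within I)"
    by (rule has_derivative_transform_eventually)
      (use eventually_in_chart[OF assms(3) \<phi>] \<phi> \<open>s \<in> I\<close> in
        \<open>auto elim!: eventually_mono simp: charts_at_def\<close>)
  moreover have "?D \<circ> (\<lambda>h. h *\<^sub>R w) = (\<lambda>h. h *\<^sub>R ?D w)"
    using linear_trans_deriv[OF \<phi> \<psi>] by (auto simp: linear_cmul)
  ultimately show ?thesis by (simp add: has_vector_derivative_def)
qed

lemma velocity_eqI: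
  assumes "\<alpha> < \<beta>" "s \<in> {\<alpha>..\<beta>}" "\<phi> \<in> charts_at A (c s)"
    and "(snd \<phi> \<circ> c has_vector_derivative w) (at s within {\<alpha>..\<beta>})"
  shows "velocity A {\<alpha>..\<beta>} c s \<phi> = w"
  using assms by (auto simp: velocity_def intro!: vector_derivative_within_closed_interval)

lemma C1_curve_continuous: "C1_curve A I c \<Longrightarrow> continuous_on I c"
  by (simp add: C1_curve_def)

lemma C1_curve_has_velocity:
  assumes "C1_curve A {\<alpha>..\<beta>} c" "\<alpha> < \<beta>" "s \<in> {\<alpha>..\<beta>}" "\<phi> \<in> charts_at A (c s)"
  shows "(snd \<phi> \<circ> c has_vector_derivative velocity A {\<alpha>..\<beta>} c s \<phi>) (at s within {\<alpha>..\<beta>})"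
proof -
  from assms obtain D where "(snd \<phi> \<circ> c has_vector_derivative D s) (at s within {\<alpha>..\<beta>})"
    unfolding C1_curve_def charts_at_def by blast
  then show ?thesis using velocity_eqI[where c = c, OF assms(2-4)] by metis
qed

lemma C1_curve_velocity_continuous:
  assumes c: "C1_curve A {\<alpha>..\<beta>} c" and "\<alpha> < \<beta>" and \<phi>: "\<phi> \<in> A"
  shows "continuous_on {s\<in>{\<alpha>..\<beta>}. c s \<in> fst \<phi>} (\<lambda>s. velocity A {\<alpha>..\<beta>} c s \<phi>)"
proof -
  from c \<phi> obtain D where D: "continuous_on {s\<in>{\<alpha>..\<beta>}. c s \<in> fst \<phi>} D"
    "\<forall>s\<in>{\<alpha>..\<beta>}. c s \<in> fst \<phi> \<longrightarrow> (snd \<phi> \<circ> c has_vector_derivative D s) (at s within {\<alpha>..\<beta>})"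
    unfolding C1_curve_def by blast
  show ?thesis
    by (rule continuous_on_eq[OF D(1)])
      (use D(2) \<open>\<alpha> < \<beta>\<close> \<phi> in \<open>auto intro!: velocity_eqI[symmetric] simp: charts_at_def\<close>)
qed

lemma C1_curve_velocity_tangent:
  assumes c: "C1_curve A {\<alpha>..\<beta>} c" and "\<alpha> < \<beta>" and s: "s \<in> {\<alpha>..\<beta>}"
  shows "velocity A {\<alpha>..\<beta>} c s \<in> tangent_space A (c s)"
proof -
  have cont: "continuous (at s within {\<alpha>..\<beta>}) c"
    using C1_curve_continuous[OF c] s by (simp add: continuous_on_eq_continuous_within)
  have "velocity A {\<alpha>..\<beta>} c s \<psi>
      = trans_deriv \<phi> \<psi> (snd \<phi> (c s)) (velocity A {\<alpha>..\<beta>} c s \<phi>)"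
    if "\<phi> \<in> charts_at A (c s)" "\<psi> \<in> charts_at A (c s)" for \<phi> \<psi>
    by (rule velocity_eqI[where c = c, OF \<open>\<alpha> < \<beta>\<close> s that(2)
      has_vector_derivative_change_chart[OF C1_curve_has_velocity[OF c \<open>\<alpha> < \<beta>\<close> s that(1)] s cont that]])
  moreover have "velocity A {\<alpha>..\<beta>} c s \<phi> = 0" if "\<phi> \<notin> charts_at A (c s)" for \<phi>
    using that by (simp add: velocity_def)
  ultimately show ?thesis unfolding tangent_space_def by blast
qed

lemma C1_curveI:
  assumes "continuous_on I c"
    and "\<And>\<phi>. \<phi> \<in> A \<Longrightarrow> continuous_on {s\<in>I. c s \<in> fst \<phi>} (\<lambda>s. D s \<phi>)"
    and "\<And>\<phi> s. s \<in> I \<Longrightarrow> \<phi> \<in> charts_at A (c s) \<Longrightarrow>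
      (snd \<phi> \<circ> c has_vector_derivative D s \<phi>) (at s within I)"
  shows "C1_curve A I c"
  using assms unfolding C1_curve_def charts_at_def by blast

text \<open>A tangent vector is determined by one representative, so a velocity is identified by a
  derivative in any one chart.\<close>

lemma velocity_eq_tangent:
  assumes "\<alpha> < \<beta>" "s \<in> {\<alpha>..\<beta>}" "C1_curve A {\<alpha>..\<beta>} c" "w \<in> tangent_space A (c s)"
    "\<phi> \<in> charts_at A (c s)" "(snd \<phi> \<circ> c has_vector_derivative w \<phi>) (at s within {\<alpha>..\<beta>})"
  shows "velocity A {\<alpha>..\<beta>} c s = w"
  using assms by (intro tangent_eqI[OF C1_curve_velocity_tangent]) (auto intro: velocity_eqI)

text \<open>The source of competitors for the least action: C^1 curves of the model space that stay
  in the image of a chart. Other charts are reached through the jointly continuous transition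
  derivatives.\<close>

lemma C1_curve_in_chart:
  assumes \<phi>: "\<phi> \<in> A" and "\<alpha> < \<beta>"
    and img: "\<And>s. s \<in> {\<alpha>..\<beta>} \<Longrightarrow> z s \<in> snd \<phi> ` fst \<phi>"
    and der: "\<And>s. s \<in> {\<alpha>..\<beta>} \<Longrightarrow> (z has_vector_derivative z' s) (at s within {\<alpha>..\<beta>})"
    and z': "continuous_on {\<alpha>..\<beta>} z'"
  defines "c \<equiv> chart_inv \<phi> \<circ> z"
  shows "C1_curve A {\<alpha>..\<beta>} c"
    and "s \<in> {\<alpha>..\<beta>} \<Longrightarrow> velocity A {\<alpha>..\<beta>} c s = chart_vec A \<phi> (c s) (z' s)"
proof -
  let ?I = "{\<alpha>..\<beta>}"
  have z: "continuous_on ?I z"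
    using der has_vector_derivative_continuous continuous_on_eq_continuous_within by blast
  have cc: "continuous_on ?I c"
    unfolding c_def using img by (intro continuous_on_compose z
        continuous_on_subset[OF continuous_on_chart_inv[OF \<phi>]]) auto
  have cs: "\<phi> \<in> charts_at A (c s)" "snd \<phi> (c s) = z s" if "s \<in> ?I" for s
    using chart_inv_in[OF \<phi> img[OF that]] \<phi> img[OF that] by (auto simp: charts_at_def c_def)
  have d\<phi>: "(snd \<phi> \<circ> c has_vector_derivative z' s) (at s within ?I)" if "s \<in> ?I" for s
    using der[OF that] unfolding has_vector_derivative_def
    by (rule has_derivative_transform[OF that, rotated]) (use cs in auto)
  show C1: "C1_curve A ?I c"
  proof (rule C1_curveI[where D = "\<lambda>s. chart_vec A \<phi> (c s) (z' s)"])
    fix \<psi> assume \<psi>: "\<psi> \<in> A"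
    have "continuous_on {s \<in> ?I. c s \<in> fst \<psi>} (\<lambda>s. trans_deriv \<phi> \<psi> (z s) (z' s))"
    proof -
      have "continuous_on {s \<in> ?I. c s \<in> fst \<psi>} (\<lambda>s. (z s, z' s))"
        by (intro continuous_on_Pair continuous_on_subset[OF z] continuous_on_subset[OF z']) auto
      from continuous_on_compose2[OF trans_deriv_continuous[OF \<phi> \<psi>] this]
      show ?thesis using cs by (force simp: charts_at_def)
    qed
    then show "continuous_on {s \<in> ?I. c s \<in> fst \<psi>} (\<lambda>s. chart_vec A \<phi> (c s) (z' s) \<psi>)"
      by (rule continuous_on_eq) (use cs \<psi> in \<open>auto simp: chart_vec_def charts_at_def\<close>)
  next
    fix \<psi> s assume s: "s \<in> ?I" and \<psi>: "\<psi> \<in> charts_at A (c s)"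
    have "continuous (at s within ?I) c"
      using cc s by (simp add: continuous_on_eq_continuous_within)
    from has_vector_derivative_change_chart[OF d\<phi>[OF s] s this cs(1)[OF s] \<psi>]
    show "(snd \<psi> \<circ> c has_vector_derivative chart_vec A \<phi> (c s) (z' s) \<psi>) (at s within ?I)"
      using \<psi> by (simp add: chart_vec_def)
  qed (fact cc)
  show "velocity A ?I c s = chart_vec A \<phi> (c s) (z' s)" if s: "s \<in> ?I"
    by (rule velocity_eq_tangent[OF \<open>\<alpha> < \<beta>\<close> s C1 chart_vec_tangent[OF cs(1)[OF s]] cs(1)[OF s]])
      (use d\<phi>[OF s] chart_vec_self[OF cs(1)[OF s]] in simp)
qed

end

section \<open>The metric, the one-form and the potential in coordinates\<close>

locale gw_spacetime = atlas k A
  for k and A :: "('q::t2_space, 'e::euclidean_space) chart set" +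
  fixes r :: nat and T :: "real set"
    and a :: "real \<Rightarrow> 'q \<Rightarrow> ('q, 'e) tvec \<Rightarrow> ('q, 'e) tvec \<Rightarrow> real"
    and b :: "real \<Rightarrow> 'q \<Rightarrow> ('q, 'e) tvec \<Rightarrow> real"
    and V :: "real \<Rightarrow> 'q \<Rightarrow> real"
  assumes open_T: "open T" and connected_T: "connected T"
    and metric: "Cr_metric r A T a" and oneform: "Cr_oneform r A T b"
    and potential: "Cr_function r A T V"
begin

lemma T_Icc: "\<alpha> \<in> T \<Longrightarrow> \<beta> \<in> T \<Longrightarrow> {\<alpha>..\<beta>} \<subseteq> T"
  using connected_T connected_contains_Icc by blast

lemma a_linear:
  "t \<in> T \<Longrightarrow> v \<in> tangent_space A q \<Longrightarrow> tvec_linear A q (a t q v)"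
  using metric by (auto simp: Cr_metric_def)

lemma a_sym:
  "t \<in> T \<Longrightarrow> v \<in> tangent_space A q \<Longrightarrow> w \<in> tangent_space A q \<Longrightarrow> a t q v w = a t q w v"
  using metric by (auto simp: Cr_metric_def)

lemma a_pos:
  "t \<in> T \<Longrightarrow> v \<in> tangent_space A q \<Longrightarrow> v \<noteq> (\<lambda>_. 0) \<Longrightarrow> 0 < a t q v v"
  using metric by (auto simp: Cr_metric_def)

lemma b_linear: "t \<in> T \<Longrightarrow> tvec_linear A q (b t q)"
  using oneform by (auto simp: Cr_oneform_def)

lemma a_scale:
  assumes "t \<in> T" "v \<in> tangent_space A q" "w \<in> tangent_space A q"
  shows "a t q v (\<lambda>\<phi>. c *\<^sub>R w \<phi>) = c * a t q v w" "a t q (\<lambda>\<phi>. c *\<^sub>R v \<phi>) w = c * a t q v w"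
proof -
  have *: "a t q v (\<lambda>\<phi>. c *\<^sub>R w \<phi>) = c * a t q v w"
    if "v \<in> tangent_space A q" "w \<in> tangent_space A q" for v w
    using a_linear[OF assms(1) that(1)] that by (auto simp: tvec_linear_def)
  then show "a t q v (\<lambda>\<phi>. c *\<^sub>R w \<phi>) = c * a t q v w" using assms by blast
  show "a t q (\<lambda>\<phi>. c *\<^sub>R v \<phi>) w = c * a t q v w"
    using *[OF assms(3,2)] assms by (simp add: a_sym tangent_scale)
qed

lemma b_scale:
  assumes "t \<in> T" "v \<in> tangent_space A q"
  shows "b t q (\<lambda>\<phi>. c *\<^sub>R v \<phi>) = c * b t q v"
  using b_linear[OF assms(1), of q] assms(2) by (auto simp: tvec_linear_def)

lemma a_zero: "t \<in> T \<Longrightarrow> a t q (\<lambda>_. 0) (\<lambda>_. 0) = 0"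
  using a_scale(1)[OF _ tangent_0 tangent_0, of t q 0] by simp

lemma b_zero: "t \<in> T \<Longrightarrow> b t q (\<lambda>_. 0) = 0"
  using b_scale[OF _ tangent_0, of t q 0] by simp

lemma a_nonneg: "t \<in> T \<Longrightarrow> v \<in> tangent_space A q \<Longrightarrow> 0 \<le> a t q v v"
  using a_pos[of t v q] a_zero[of t q] by (cases "v = (\<lambda>_. 0)") auto

text \<open>Phrased exactly as the coefficients in \<open>Cr_metric\<close>, so that its regularity
  clause applies by unfolding, but for arbitrary coordinate vectors instead of basis
  vectors.\<close>

definition a_coord :: "('q, 'e) chart \<Rightarrow> real \<Rightarrow> 'e \<Rightarrow> 'e \<Rightarrow> 'e \<Rightarrow> real" where
  "a_coord \<phi> t z e f = (let q = chart_inv \<phi> z in a t q (chart_vec A \<phi> q e) (chart_vec A \<phi> q f))"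

definition b_coord :: "('q, 'e) chart \<Rightarrow> real \<Rightarrow> 'e \<Rightarrow> 'e \<Rightarrow> real" where
  "b_coord \<phi> t z e = (let q = chart_inv \<phi> z in b t q (chart_vec A \<phi> q e))"

lemma a_eq_coord:
  assumes "\<phi> \<in> charts_at A q" "v \<in> tangent_space A q" "w \<in> tangent_space A q"
  shows "a t q v w = a_coord \<phi> t (snd \<phi> q) (v \<phi>) (w \<phi>)"
  using assms charts_atD[OF assms(1)] by (simp add: a_coord_def tangent_eq_chart_vec[symmetric])

lemma b_eq_coord:
  assumes "\<phi> \<in> charts_at A q" "v \<in> tangent_space A q"
  shows "b t q v = b_coord \<phi> t (snd \<phi> q) (v \<phi>)"
  using assms charts_atD[OF assms(1)] by (simp add: b_coord_def tangent_eq_chart_vec[symmetric])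

lemma V_eq_coord: "\<phi> \<in> charts_at A q \<Longrightarrow> V t q = V t (chart_inv \<phi> (snd \<phi> q))"
  by (simp add: charts_at_def)

lemma charts_at_chart_inv:
  "\<phi> \<in> A \<Longrightarrow> z \<in> snd \<phi> ` fst \<phi> \<Longrightarrow> \<phi> \<in> charts_at A (chart_inv \<phi> z)"
  by (auto simp: charts_at_def)

lemma bilinear_a_coord:
  assumes "\<phi> \<in> A" "z \<in> snd \<phi> ` fst \<phi>" "t \<in> T" shows "bilinear (a_coord \<phi> t z)"
proof -
  note \<phi> = charts_at_chart_inv[OF assms(1,2)]
  have "linear (\<lambda>f. a_coord \<phi> t z e f)" for e
    unfolding a_coord_def Let_def
    by (intro tvec_linear_chart a_linear assms chart_vec_tangent \<phi>)
  moreover have "a_coord \<phi> t z e f = a_coord \<phi> t z f e" for e f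
    unfolding a_coord_def Let_def
    by (rule a_sym[OF assms(3) chart_vec_tangent[OF \<phi>] chart_vec_tangent[OF \<phi>]])
  ultimately show ?thesis unfolding bilinear_def by simp
qed

lemma a_coord_sym:
  assumes "\<phi> \<in> A" "z \<in> snd \<phi> ` fst \<phi>" "t \<in> T" shows "a_coord \<phi> t z e f = a_coord \<phi> t z f e"
  unfolding a_coord_def Let_def
  by (intro a_sym assms chart_vec_tangent charts_at_chart_inv)

lemma a_coord_pos:
  assumes "\<phi> \<in> A" "z \<in> snd \<phi> ` fst \<phi>" "t \<in> T" "e \<noteq> 0" shows "0 < a_coord \<phi> t z e e"
proof -
  note \<phi> = charts_at_chart_inv[OF assms(1,2)]
  have "chart_vec A \<phi> (chart_inv \<phi> z) e \<noteq> (\<lambda>_. 0)"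
    using chart_vec_self[OF \<phi>, of e] assms(4) by metis
  then show ?thesis
    unfolding a_coord_def Let_def by (intro a_pos assms chart_vec_tangent \<phi>)
qed

lemma linear_b_coord:
  assumes "\<phi> \<in> A" "z \<in> snd \<phi> ` fst \<phi>" "t \<in> T" shows "linear (b_coord \<phi> t z)"
  unfolding b_coord_def[abs_def] Let_def
  by (intro tvec_linear_chart b_linear assms charts_at_chart_inv)

lemma a_coord_basis_continuous:
  assumes "\<phi> \<in> A" "i \<in> Basis" "j \<in> Basis"
  shows "continuous_on (T \<times> snd \<phi> ` fst \<phi>) (\<lambda>p. a_coord \<phi> (fst p) (snd p) i j)"
proof -
  have "Ck_on r (T \<times> snd \<phi> ` fst \<phi>) (\<lambda>(t, z). a_coord \<phi> t z i j)"
    using metric assms unfolding Cr_metric_def a_coord_def by blast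
  from Ck_on_continuous_on[OF this] show ?thesis by (simp add: case_prod_unfold)
qed

lemma b_coord_basis_continuous:
  assumes "\<phi> \<in> A" "i \<in> Basis"
  shows "continuous_on (T \<times> snd \<phi> ` fst \<phi>) (\<lambda>p. b_coord \<phi> (fst p) (snd p) i)"
proof -
  have "Ck_on r (T \<times> snd \<phi> ` fst \<phi>) (\<lambda>(t, z). b_coord \<phi> t z i)"
    using oneform assms unfolding Cr_oneform_def b_coord_def by blast
  from Ck_on_continuous_on[OF this] show ?thesis by (simp add: case_prod_unfold)
qed

lemma V_coord_continuous:
  assumes "\<phi> \<in> A"
  shows "continuous_on (T \<times> snd \<phi> ` fst \<phi>) (\<lambda>p. V (fst p) (chart_inv \<phi> (snd p)))"
  using potential assms by (auto simp: Cr_function_def case_prod_unfold intro: Ck_on_continuous_on)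

lemma a_coord_expand:
  assumes "\<phi> \<in> A" "z \<in> snd \<phi> ` fst \<phi>" "t \<in> T"
  shows "a_coord \<phi> t z e f = (\<Sum>i\<in>Basis. \<Sum>j\<in>Basis. (e \<bullet> i) * (f \<bullet> j) * a_coord \<phi> t z i j)"
proof -
  note bl = bilinear_a_coord[OF assms]
  have "a_coord \<phi> t z e f =
      a_coord \<phi> t z (\<Sum>i\<in>Basis. (e \<bullet> i) *\<^sub>R i) (\<Sum>j\<in>Basis. (f \<bullet> j) *\<^sub>R j)"
    by (simp add: euclidean_representation)
  also have "\<dots> = (\<Sum>(i,j)\<in>Basis \<times> Basis. a_coord \<phi> t z ((e \<bullet> i) *\<^sub>R i) ((f \<bullet> j) *\<^sub>R j))"
    by (rule bilinear_sum[OF bl])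
  finally show ?thesis
    by (simp add: sum.cartesian_product bilinear_lmul[OF bl] bilinear_rmul[OF bl] mult_ac)
qed

lemma b_coord_expand:
  assumes "\<phi> \<in> A" "z \<in> snd \<phi> ` fst \<phi>" "t \<in> T"
  shows "b_coord \<phi> t z e = (\<Sum>i\<in>Basis. (e \<bullet> i) * b_coord \<phi> t z i)"
proof -
  note l = linear_b_coord[OF assms]
  have "b_coord \<phi> t z e = b_coord \<phi> t z (\<Sum>i\<in>Basis. (e \<bullet> i) *\<^sub>R i)"
    by (simp add: euclidean_representation)
  then show ?thesis by (simp add: linear_sum[OF l] linear_cmul[OF l])
qed

text \<open>The parameter space \<open>X\<close> and the time function \<tau> are arbitrary for two
  reasons: causal curves are not parametrized by time, and for reparametrized curves the time and
  the curve parameter vary independently over a square. The field \<open>v\<close> of tangent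
  vectors along \<open>c\<close> need not be its velocity.\<close>

lemma
  fixes c :: "'x::t2_space \<Rightarrow> 'q"
  assumes \<tau>: "continuous_on X \<tau>" "\<And>x. x \<in> X \<Longrightarrow> \<tau> x \<in> T" and c: "continuous_on X c"
    and v: "\<And>x. x \<in> X \<Longrightarrow> v x \<in> tangent_space A (c x)"
      "\<And>\<phi>. \<phi> \<in> A \<Longrightarrow> continuous_on {x\<in>X. c x \<in> fst \<phi>} (\<lambda>x. v x \<phi>)"
  shows continuous_on_a_along: "continuous_on X (\<lambda>x. a (\<tau> x) (c x) (v x) (v x))"
    and continuous_on_b_along: "continuous_on X (\<lambda>x. b (\<tau> x) (c x) (v x))"
    and continuous_on_V_along: "continuous_on X (\<lambda>x. V (\<tau> x) (c x))"
proof -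
  have loc: "\<exists>O'. open O' \<and> x \<in> O' \<and>
      continuous_on (X \<inter> O') (\<lambda>x. a (\<tau> x) (c x) (v x) (v x)) \<and>
      continuous_on (X \<inter> O') (\<lambda>x. b (\<tau> x) (c x) (v x)) \<and>
      continuous_on (X \<inter> O') (\<lambda>x. V (\<tau> x) (c x))" if x: "x \<in> X" for x
  proof -
    obtain \<phi> where \<phi>: "\<phi> \<in> charts_at A (c x)" by (rule ex_chart)
    then have \<phi>A: "\<phi> \<in> A" and cx: "c x \<in> fst \<phi>" by (auto simp: charts_at_def)
    obtain O' where O': "open O'" "O' \<inter> X = c -` fst \<phi> \<inter> X"
      using c open_dom[OF \<phi>A] unfolding continuous_on_open_invariant by meson
    let ?Y = "X \<inter> O'"
    have Y: "?Y = {x\<in>X. c x \<in> fst \<phi>}" using O' by auto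
    have \<phi>Y: "\<phi> \<in> charts_at A (c x)" if "x \<in> ?Y" for x using that \<phi>A unfolding Y by (auto simp: charts_at_def)
    have zY: "snd \<phi> (c x) \<in> snd \<phi> ` fst \<phi>" "\<tau> x \<in> T" if "x \<in> ?Y" for x
      using that \<tau>(2) unfolding Y by auto
    have "continuous_on ?Y (\<lambda>x. (\<tau> x, snd \<phi> (c x)))"
      by (intro continuous_on_Pair continuous_on_subset[OF \<tau>(1)]
          continuous_on_compose2[OF continuous_on_chart[OF \<phi>A]] continuous_on_subset[OF c])
        (auto simp: Y)
    note pull = continuous_on_compose2[OF _ this, of "T \<times> snd \<phi> ` fst \<phi>", simplified]
    have A: "continuous_on ?Y (\<lambda>x. a_coord \<phi> (\<tau> x) (snd \<phi> (c x)) i j)"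
      if "i \<in> Basis" "j \<in> Basis" for i j
      using pull[OF a_coord_basis_continuous[OF \<phi>A that]] zY by auto
    have B: "continuous_on ?Y (\<lambda>x. b_coord \<phi> (\<tau> x) (snd \<phi> (c x)) i)"
      if "i \<in> Basis" for i
      using pull[OF b_coord_basis_continuous[OF \<phi>A that]] zY by auto
    have VV: "continuous_on ?Y (\<lambda>x. V (\<tau> x) (chart_inv \<phi> (snd \<phi> (c x))))"
      using pull[OF V_coord_continuous[OF \<phi>A]] zY by auto
    have vv: "continuous_on ?Y (\<lambda>x. v x \<phi>)" using v(2)[OF \<phi>A] unfolding Y .
    have "continuous_on ?Y (\<lambda>x. \<Sum>i\<in>Basis. \<Sum>j\<in>Basis. (v x \<phi> \<bullet> i) * (v x \<phi> \<bullet> j) * a_coord \<phi> (\<tau> x) (snd \<phi> (c x)) i j)"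
      by (intro continuous_intros vv A)
    then have 1: "continuous_on ?Y (\<lambda>x. a (\<tau> x) (c x) (v x) (v x))"
      by (rule continuous_on_eq)
        (use zY \<phi>Y v(1) in \<open>auto simp: a_eq_coord[of \<phi>] simp flip: a_coord_expand[OF \<phi>A]\<close>)
    have "continuous_on ?Y (\<lambda>x. \<Sum>i\<in>Basis. (v x \<phi> \<bullet> i) * b_coord \<phi> (\<tau> x) (snd \<phi> (c x)) i)"
      by (intro continuous_intros vv B)
    then have 2: "continuous_on ?Y (\<lambda>x. b (\<tau> x) (c x) (v x))"
      by (rule continuous_on_eq)
        (use zY \<phi>Y v(1) in \<open>auto simp: b_eq_coord[of \<phi>] simp flip: b_coord_expand[OF \<phi>A]\<close>)
    have 3: "continuous_on ?Y (\<lambda>x. V (\<tau> x) (c x))"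
      by (rule continuous_on_eq[OF VV]) (metis \<phi>Y V_eq_coord)
    have "x \<in> O'" using O'(2) x cx by blast
    with 1 2 3 O'(1) show ?thesis by blast
  qed
  show "continuous_on X (\<lambda>x. a (\<tau> x) (c x) (v x) (v x))"
    by (rule continuous_on_local) (use loc in blast)
  show "continuous_on X (\<lambda>x. b (\<tau> x) (c x) (v x))"
    by (rule continuous_on_local) (use loc in blast)
  show "continuous_on X (\<lambda>x. V (\<tau> x) (c x))"
    by (rule continuous_on_local) (use loc in blast)
qed

end

section \<open>Stopping and concatenating curves\<close>

context atlas
begin

lemma
  assumes c: "C1_curve A {\<alpha>..\<beta>} c" and \<alpha>\<beta>: "\<alpha> < \<beta>"
    and \<theta>: "\<And>s. s \<in> {\<alpha>..\<beta>} \<Longrightarrow> \<theta> s \<in> {\<alpha>..\<beta>}"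
    and der: "\<And>s. s \<in> {\<alpha>..\<beta>} \<Longrightarrow> (\<theta> has_vector_derivative \<rho> s) (at s within {\<alpha>..\<beta>})"
    and \<rho>: "continuous_on {\<alpha>..\<beta>} \<rho>"
  shows C1_curve_reparam: "C1_curve A {\<alpha>..\<beta>} (c \<circ> \<theta>)"
    and velocity_reparam: "s \<in> {\<alpha>..\<beta>} \<Longrightarrow>
      velocity A {\<alpha>..\<beta>} (c \<circ> \<theta>) s = (\<lambda>\<phi>. \<rho> s *\<^sub>R velocity A {\<alpha>..\<beta>} c (\<theta> s) \<phi>)"
proof -
  let ?I = "{\<alpha>..\<beta>}"
  have \<theta>c: "continuous_on ?I \<theta>"
    using der has_vector_derivative_continuous continuous_on_eq_continuous_within by blast
  have d: "(snd \<phi> \<circ> (c \<circ> \<theta>) has_vector_derivative \<rho> s *\<^sub>R velocity A ?I c (\<theta> s) \<phi>) (at s within ?I)"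
    if s: "s \<in> ?I" and \<phi>: "\<phi> \<in> charts_at A ((c \<circ> \<theta>) s)" for s \<phi>
  proof -
    have "(snd \<phi> \<circ> c has_vector_derivative velocity A ?I c (\<theta> s) \<phi>) (at (\<theta> s) within ?I)"
      using C1_curve_has_velocity[OF c \<alpha>\<beta> \<theta>[OF s]] \<phi> by simp
    then have "(snd \<phi> \<circ> c has_vector_derivative velocity A ?I c (\<theta> s) \<phi>) (at (\<theta> s) within \<theta> ` ?I)"
      by (rule has_vector_derivative_within_subset) (use \<theta> in auto)
    from vector_diff_chain_within[OF der[OF s] this] show ?thesis by (simp only: o_assoc)
  qed
  show C1: "C1_curve A ?I (c \<circ> \<theta>)"
  proof (rule C1_curveI[OF _ _ d])
    show "continuous_on ?I (c \<circ> \<theta>)"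
      by (intro continuous_on_compose \<theta>c continuous_on_subset[OF C1_curve_continuous[OF c]])
        (use \<theta> in auto)
    fix \<phi> assume \<phi>: "\<phi> \<in> A"
    show "continuous_on {s \<in> ?I. (c \<circ> \<theta>) s \<in> fst \<phi>} (\<lambda>s. \<rho> s *\<^sub>R velocity A ?I c (\<theta> s) \<phi>)"
    proof (intro continuous_on_scaleR)
      show "continuous_on {s \<in> ?I. (c \<circ> \<theta>) s \<in> fst \<phi>} (\<lambda>s. velocity A ?I c (\<theta> s) \<phi>)"
      proof (rule continuous_on_compose2[OF C1_curve_velocity_continuous[OF c \<alpha>\<beta> \<phi>]
              continuous_on_subset[OF \<theta>c]])
        show "\<theta> ` {s \<in> ?I. (c \<circ> \<theta>) s \<in> fst \<phi>} \<subseteq> {s \<in> ?I. c s \<in> fst \<phi>}"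
          using \<theta> by auto
      qed blast
    qed (auto intro: continuous_on_subset[OF \<rho>])
  qed
  show "velocity A ?I (c \<circ> \<theta>) s = (\<lambda>\<phi>. \<rho> s *\<^sub>R velocity A ?I c (\<theta> s) \<phi>)" if s: "s \<in> ?I"
  proof -
    obtain \<phi> where \<phi>: "\<phi> \<in> charts_at A ((c \<circ> \<theta>) s)" by (rule ex_chart)
    have "(\<lambda>\<phi>. \<rho> s *\<^sub>R velocity A ?I c (\<theta> s) \<phi>) \<in> tangent_space A ((c \<circ> \<theta>) s)"
      using tangent_scale[OF C1_curve_velocity_tangent[OF c \<alpha>\<beta> \<theta>[OF s]]] by simp
    from velocity_eq_tangent[where c = "c \<circ> \<theta>", OF \<alpha>\<beta> s C1 this \<phi> d[OF s \<phi>]] show ?thesis .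
  qed
qed

text \<open>Equality of the two velocities as tangent vectors makes the one-sided derivatives agree
  in every chart at the junction; the closures of the two halves meet only there, so nothing else
  has to match.\<close>

lemma
  assumes c1: "C1_curve A {\<alpha>..\<beta>} c1" and c2: "C1_curve A {\<beta>..\<gamma>} c2"
    and \<alpha>\<beta>: "\<alpha> < \<beta>" and \<beta>\<gamma>: "\<beta> < \<gamma>" and eq: "c1 \<beta> = c2 \<beta>"
    and veq: "velocity A {\<alpha>..\<beta>} c1 \<beta> = velocity A {\<beta>..\<gamma>} c2 \<beta>"
  defines "c \<equiv> \<lambda>s. if s \<le> \<beta> then c1 s else c2 s"
  shows C1_curve_glue: "C1_curve A {\<alpha>..\<gamma>} c"
    and velocity_glue: "s \<in> {\<alpha>..\<gamma>} \<Longrightarrow> velocity A {\<alpha>..\<gamma>} c s =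
      (if s \<le> \<beta> then velocity A {\<alpha>..\<beta>} c1 s else velocity A {\<beta>..\<gamma>} c2 s)"
proof -
  let ?D = "\<lambda>s. if s \<le> \<beta> then velocity A {\<alpha>..\<beta>} c1 s else velocity A {\<beta>..\<gamma>} c2 s"
  have d: "(snd \<phi> \<circ> c has_vector_derivative ?D s \<phi>) (at s within {\<alpha>..\<gamma>})"
    if s: "s \<in> {\<alpha>..\<gamma>}" and \<phi>: "\<phi> \<in> charts_at A (c s)" for s \<phi>
  proof -
    let ?S = "{\<alpha>..\<beta>}" and ?T = "{\<beta>..\<gamma>}"
    have clos: "closure ?S \<inter> closure ?T = {\<beta>}" using \<alpha>\<beta> \<beta>\<gamma> by auto
    have un: "?S \<union> {\<beta>} = ?S" "?T \<union> {\<beta>} = ?T" using \<alpha>\<beta> \<beta>\<gamma> by auto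
    have "((\<lambda>x. if x \<in> ?S then (snd \<phi> \<circ> c1) x else (snd \<phi> \<circ> c2) x) has_vector_derivative
        (if s \<in> ?S then velocity A ?S c1 s \<phi> else velocity A ?T c2 s \<phi>)) (at s within {\<alpha>..\<gamma>})"
    proof (rule has_vector_derivative_If_within_closures[where f' = "\<lambda>s. velocity A ?S c1 s \<phi>"
          and g' = "\<lambda>s. velocity A ?T c2 s \<phi>" and T = ?T], unfold clos un)
      assume "s \<in> ?S"
      then show "(snd \<phi> \<circ> c1 has_vector_derivative velocity A ?S c1 s \<phi>) (at s within ?S)"
        using C1_curve_has_velocity[OF c1 \<alpha>\<beta>] \<phi> by (simp add: c_def)
    next
      assume sT: "s \<in> ?T"
      then have "c s = c2 s" using eq by (auto simp: c_def)
      then show "(snd \<phi> \<circ> c2 has_vector_derivative velocity A ?T c2 s \<phi>) (at s within ?T)"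
        using C1_curve_has_velocity[OF c2 \<beta>\<gamma> sT] \<phi> by simp
    qed (use s \<alpha>\<beta> \<beta>\<gamma> eq veq in \<open>auto simp: order_antisym_conv\<close>)
    then have "(snd \<phi> \<circ> c has_vector_derivative
        (if s \<in> ?S then velocity A ?S c1 s \<phi> else velocity A ?T c2 s \<phi>)) (at s within {\<alpha>..\<gamma>})"
      unfolding has_vector_derivative_def
      by (rule has_derivative_transform[OF s, rotated]) (auto simp: c_def)
    then show ?thesis using s by (auto split: if_splits)
  qed
  show C1: "C1_curve A {\<alpha>..\<gamma>} c"
  proof (rule C1_curveI[OF _ _ d])
    show "continuous_on {\<alpha>..\<gamma>} c"
      unfolding c_def
      by (rule continuous_on_cases_le[where h = "\<lambda>x. x"])
        (auto intro!: continuous_intros continuous_on_subset[OF C1_curve_continuous[OF c1]]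
          continuous_on_subset[OF C1_curve_continuous[OF c2]] simp: eq)
    fix \<phi> assume \<phi>: "\<phi> \<in> A"
    let ?X = "{s \<in> {\<alpha>..\<gamma>}. c s \<in> fst \<phi>}"
    have "continuous_on ?X (\<lambda>s. if s \<le> \<beta> then velocity A {\<alpha>..\<beta>} c1 s \<phi> else velocity A {\<beta>..\<gamma>} c2 s \<phi>)"
    proof (rule continuous_on_cases_le[where h = "\<lambda>x. x"])
      show "continuous_on {x \<in> ?X. x \<le> \<beta>} (\<lambda>s. velocity A {\<alpha>..\<beta>} c1 s \<phi>)"
        by (rule continuous_on_subset[OF C1_curve_velocity_continuous[OF c1 \<alpha>\<beta> \<phi>]])
          (auto simp: c_def)
      show "continuous_on {x \<in> ?X. \<beta> \<le> x} (\<lambda>s. velocity A {\<beta>..\<gamma>} c2 s \<phi>)"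
        by (rule continuous_on_subset[OF C1_curve_velocity_continuous[OF c2 \<beta>\<gamma> \<phi>]])
          (use eq in \<open>auto simp: c_def split: if_splits\<close>)
    qed (auto intro!: continuous_intros simp: veq)
    then show "continuous_on ?X (\<lambda>s. ?D s \<phi>)"
      by (simp add: if_distribR)
  qed
  show "velocity A {\<alpha>..\<gamma>} c s = ?D s" if s: "s \<in> {\<alpha>..\<gamma>}"
  proof -
    obtain \<phi> where \<phi>: "\<phi> \<in> charts_at A (c s)" by (rule ex_chart)
    have "?D s \<in> tangent_space A (c s)"
      using C1_curve_velocity_tangent[OF c1 \<alpha>\<beta>] C1_curve_velocity_tangent[OF c2 \<beta>\<gamma>] s
      by (auto simp: c_def)
    moreover have "\<alpha> < \<gamma>" using \<alpha>\<beta> \<beta>\<gamma> by simp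
    ultimately show ?thesis
      by (intro velocity_eq_tangent[OF _ s C1 _ \<phi>] d[OF s \<phi>])
  qed
qed

end

context gw_spacetime
begin

lemma
  assumes c: "C1_curve A {\<alpha>..\<beta>} c" and "\<alpha> < \<beta>"
    and \<tau>: "continuous_on {\<alpha>..\<beta>} \<tau>" "\<And>s. s \<in> {\<alpha>..\<beta>} \<Longrightarrow> \<tau> s \<in> T"
  shows continuous_on_a_velocity: "continuous_on {\<alpha>..\<beta>}
      (\<lambda>s. a (\<tau> s) (c s) (velocity A {\<alpha>..\<beta>} c s) (velocity A {\<alpha>..\<beta>} c s))"
    and continuous_on_b_velocity: "continuous_on {\<alpha>..\<beta>} (\<lambda>s. b (\<tau> s) (c s) (velocity A {\<alpha>..\<beta>} c s))"
    and continuous_on_V_curve: "continuous_on {\<alpha>..\<beta>} (\<lambda>s. V (\<tau> s) (c s))"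
  using assms
  by (intro continuous_on_a_along continuous_on_b_along
      continuous_on_V_along[where v = "velocity A {\<alpha>..\<beta>} c"]
      C1_curve_velocity_tangent C1_curve_continuous C1_curve_velocity_continuous; simp)+

lemma continuous_on_lagrangian:
  assumes "C1_curve A {\<alpha>..\<beta>} c" "\<alpha> < \<beta>" "\<alpha> \<in> T" "\<beta> \<in> T"
  shows "continuous_on {\<alpha>..\<beta>} (\<lambda>s. lagrangian a b V s (c s) (velocity A {\<alpha>..\<beta>} c s))"
  unfolding lagrangian_def using T_Icc[OF assms(3,4)] assms
  by (intro continuous_intros continuous_on_a_velocity continuous_on_b_velocity continuous_on_V_curve) auto

end

text \<open>Reparametrizations of \<open>[-1, 1]\<close>, with derivative \<open>(2N + 1)(1 - x^(2N))/(2N)\<close>, that come to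
  rest at both ends and converge to the identity.\<close>

lemma stop_reparam_bound:
  fixes x :: real
  assumes "\<bar>x\<bar> \<le> 1"
  shows "\<bar>(2 * real N + 1) * x - x ^ (2 * N + 1)\<bar> \<le> 2 * real N"
proof -
  have *: "0 \<le> (2 * real N + 1) * x - x ^ (2 * N + 1) \<and> (2 * real N + 1) * x - x ^ (2 * N + 1) \<le> 2 * real N"
    if "0 \<le> x" "x \<le> 1" for x :: real
  proof -
    \<comment> \<open>The tangent line at 1 lies below the power, which is precisely the upper
      bound. The lower bound comes from x^(2N+1) \<le> x.\<close>
    have "1 + real (2 * N + 1) * (x - 1) \<le> (1 + (x - 1)) ^ (2 * N + 1)"
      by (rule Bernoulli_inequality) (use that in simp)
    moreover have "x ^ (2 * N + 1) \<le> x ^ 1" using that by (intro power_decreasing) auto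
    moreover have "0 \<le> real N * x" using that by simp
    ultimately show ?thesis by (simp add: algebra_simps)
  qed
  show ?thesis
  proof (cases "0 \<le> x")
    case True
    then show ?thesis using *[of x] assms by auto
  next
    case False
    have "(- x) ^ (2 * N + 1) = - (x ^ (2 * N + 1))" by simp
    then show ?thesis using *[of "- x"] assms False by (simp add: abs_le_iff)
  qed
qed

lemma stop_reparam:
  fixes \<alpha> \<beta> :: real
  assumes "\<alpha> < \<beta>"
  obtains \<theta> \<rho> :: "nat \<Rightarrow> real \<Rightarrow> real" where
    "\<And>n s. s \<in> {\<alpha>..\<beta>} \<Longrightarrow> \<theta> n s \<in> {\<alpha>..\<beta>}"
    "\<And>n s. (\<theta> n has_vector_derivative \<rho> n s) (at s within {\<alpha>..\<beta>})"
    "\<And>n. continuous_on {\<alpha>..\<beta>} (\<rho> n)" "\<And>n s. s \<in> {\<alpha>..\<beta>} \<Longrightarrow> \<bar>\<rho> n s\<bar> \<le> 2"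
    "\<And>n. \<theta> n \<alpha> = \<alpha>" "\<And>n. \<theta> n \<beta> = \<beta>" "\<And>n. \<rho> n \<alpha> = 0" "\<And>n. \<rho> n \<beta> = 0"
    "\<And>s. s \<in> {\<alpha><..<\<beta>} \<Longrightarrow> (\<lambda>n. \<theta> n s) \<longlonglongrightarrow> s"
    "\<And>s. s \<in> {\<alpha><..<\<beta>} \<Longrightarrow> (\<lambda>n. \<rho> n s) \<longlonglongrightarrow> 1"
proof -
  \<comment> \<open>The midpoint and the half-length: \<open>X\<close> below carries the interval to
    [-1, 1]. The exponent parameter N is \<open>Suc n\<close>, so that dividing by 2N is
    harmless.\<close>
  define m h where "m = (\<alpha> + \<beta>) / 2" and "h = (\<beta> - \<alpha>) / 2"
  have h: "0 < h" using assms by (simp add: h_def)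
  have ends: "\<alpha> = m - h" "\<beta> = m + h" by (auto simp: m_def h_def field_simps)
  define X where "X s = (s - m) / h" for s
  define \<theta> where "\<theta> n s = m + h * (((2 * real (Suc n) + 1) * X s - X s ^ (2 * Suc n + 1)) / (2 * real (Suc n)))"
    for n s
  define \<rho> where "\<rho> n s = (2 * real (Suc n) + 1) * (1 - X s ^ (2 * Suc n)) / (2 * real (Suc n))" for n s
  have X1: "\<bar>X s\<bar> \<le> 1" if "s \<in> {\<alpha>..\<beta>}" for s
    using that h by (auto simp: X_def ends abs_le_iff field_simps)
  have X1': "\<bar>X s\<bar> < 1" if "s \<in> {\<alpha><..<\<beta>}" for s
    using that h by (auto simp: X_def ends abs_less_iff field_simps)
  have lim: "(\<lambda>n. (2 * real (Suc n) + 1) / (2 * real (Suc n))) \<longlonglongrightarrow> 1"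
  proof -
    have "(\<lambda>n. 1 + (1 / 2) * inverse (real (Suc n))) \<longlonglongrightarrow> 1 + (1 / 2) * 0"
      by (intro tendsto_intros LIMSEQ_inverse_real_of_nat)
    then show ?thesis by (simp add: field_simps)
  qed
  have pow0: "(\<lambda>n. X s ^ (2 * Suc n + j)) \<longlonglongrightarrow> 0" if "s \<in> {\<alpha><..<\<beta>}" for s j
  proof -
    have "strict_mono (\<lambda>n. 2 * Suc n + j)" by (rule strict_monoI) simp
    from LIMSEQ_subseq_LIMSEQ[OF LIMSEQ_abs_realpow_zero2[OF X1'[OF that]] this]
    show ?thesis by (simp only: o_def)
  qed
  show thesis
  proof
    show "\<theta> n s \<in> {\<alpha>..\<beta>}" if "s \<in> {\<alpha>..\<beta>}" for n s
    proof -
      define u where "u = ((2 * real (Suc n) + 1) * X s - X s ^ (2 * Suc n + 1)) / (2 * real (Suc n))"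
      have "\<bar>u\<bar> \<le> 1"
        using stop_reparam_bound[OF X1[OF that], of "Suc n"] by (simp add: u_def)
      then have "\<bar>h * u\<bar> \<le> h" using h by (simp add: abs_mult mult_left_le)
      moreover have "\<theta> n s = m + h * u" by (simp add: \<theta>_def u_def)
      ultimately show ?thesis by (auto simp: ends abs_le_iff)
    qed
    show "(\<theta> n has_vector_derivative \<rho> n s) (at s within {\<alpha>..\<beta>})" for n s
    proof -
      let ?c = "2 * real (Suc n) + 1"
      have X': "(X has_real_derivative 1 / h) (at s within {\<alpha>..\<beta>})"
        unfolding X_def[abs_def] using h by (auto intro!: derivative_eq_intros)
      have pow': "((\<lambda>x. x ^ (2 * Suc n + 1)) has_real_derivative ?c * X s ^ (2 * Suc n)) (at (X s))"
        using DERIV_pow[of "2 * Suc n + 1" "X s" UNIV] by (simp del: power_Suc add: add_ac)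
      have "((\<lambda>x. h * ((?c * x - x ^ (2 * Suc n + 1)) / (2 * real (Suc n)))) has_real_derivative
          h * ((?c - ?c * X s ^ (2 * Suc n)) / (2 * real (Suc n)))) (at (X s))"
        by (intro DERIV_cmult DERIV_cdivide DERIV_diff DERIV_cmult_Id pow')
      from DERIV_chain2[OF this X']
      have "((\<lambda>s. h * ((?c * X s - X s ^ (2 * Suc n + 1)) / (2 * real (Suc n)))) has_real_derivative
          h * ((?c - ?c * X s ^ (2 * Suc n)) / (2 * real (Suc n))) * (1 / h)) (at s within {\<alpha>..\<beta>})" .
      also have "h * ((?c - ?c * X s ^ (2 * Suc n)) / (2 * real (Suc n))) * (1 / h) = \<rho> n s"
        using h unfolding \<rho>_def by (simp only: right_diff_distrib mult_1_right) simp
      finally have "((\<lambda>s. h * ((?c * X s - X s ^ (2 * Suc n + 1)) / (2 * real (Suc n)))) has_real_derivative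
          \<rho> n s) (at s within {\<alpha>..\<beta>})" .
      from DERIV_add[OF DERIV_const[of m] this] show ?thesis
        unfolding has_real_derivative_iff_has_vector_derivative[symmetric] \<theta>_def[abs_def]
        by (simp only: add_0_left)
    qed
    show "continuous_on {\<alpha>..\<beta>} (\<rho> n)" for n
      unfolding \<rho>_def[abs_def] X_def using h by (intro continuous_intros) auto
    show "\<bar>\<rho> n s\<bar> \<le> 2" if "s \<in> {\<alpha>..\<beta>}" for n s
    proof -
      have "0 \<le> X s ^ (2 * Suc n)" by (rule zero_le_even_power) simp
      moreover have "X s ^ (2 * Suc n) \<le> 1"
        unfolding power_mult by (rule power_le_one) (use X1[OF that] in \<open>auto simp: abs_square_le_1\<close>)
      ultimately have "\<bar>1 - X s ^ (2 * Suc n)\<bar> \<le> 1" by simp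
      moreover have "\<bar>(2 * real (Suc n) + 1) / (2 * real (Suc n))\<bar> \<le> 2" by (simp add: field_simps)
      ultimately have "\<bar>(2 * real (Suc n) + 1) / (2 * real (Suc n))\<bar> * \<bar>1 - X s ^ (2 * Suc n)\<bar> \<le> 2 * 1"
        by (intro mult_mono) auto
      then show ?thesis by (simp add: \<rho>_def abs_mult)
    qed
    show "(\<lambda>n. \<theta> n s) \<longlonglongrightarrow> s" if "s \<in> {\<alpha><..<\<beta>}" for s
    proof -
      have "(\<lambda>n. m + h * ((2 * real (Suc n) + 1) / (2 * real (Suc n)) * X s
          - X s ^ (2 * Suc n + 1) * (1 / 2 * inverse (real (Suc n))))) \<longlonglongrightarrow> m + h * (1 * X s - 0 * (1 / 2 * 0))"
        by (intro tendsto_intros lim pow0[OF that] LIMSEQ_inverse_real_of_nat)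
      moreover have "m + h * (1 * X s - 0 * (1 / 2 * 0)) = s" using h by (simp add: X_def)
      moreover have "(u * x - p) / (2 * v) = u / (2 * v) * x - p * (1 / 2 * inverse v)" for u x p v :: real
        by (cases "v = 0") (simp_all add: field_simps)
      ultimately show ?thesis unfolding \<theta>_def by (simp only:)
    qed
    show "(\<lambda>n. \<rho> n s) \<longlonglongrightarrow> 1" if "s \<in> {\<alpha><..<\<beta>}" for s
    proof -
      have "(\<lambda>n. (2 * real (Suc n) + 1) / (2 * real (Suc n)) * (1 - X s ^ (2 * Suc n + 0))) \<longlonglongrightarrow> 1 * (1 - 0)"
        by (intro tendsto_intros lim pow0[OF that])
      then show ?thesis by (simp add: \<rho>_def[abs_def])
    qed
    have "X \<alpha> = - 1" "X \<beta> = 1" using h by (simp_all add: X_def ends)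
    then show "\<theta> n \<alpha> = \<alpha>" "\<theta> n \<beta> = \<beta>" "\<rho> n \<alpha> = 0" "\<rho> n \<beta> = 0" for n
      by (simp_all add: \<theta>_def \<rho>_def ends divide_simps) (simp_all add: algebra_simps)?
  qed
qed

context gw_spacetime
begin

text \<open>Along the reparametrized curves the Lagrangian is uniformly bounded and converges to the
  original one except at the two endpoints, so the actions converge by dominated
  convergence.\<close>

lemma stop_curve:
  assumes c: "C1_curve A {\<alpha>..\<beta>} c" and \<alpha>\<beta>: "\<alpha> < \<beta>" "\<alpha> \<in> T" "\<beta> \<in> T" and "0 < \<epsilon>"
  obtains c' where "C1_curve A {\<alpha>..\<beta>} c'" "c' \<alpha> = c \<alpha>" "c' \<beta> = c \<beta>"
    "velocity A {\<alpha>..\<beta>} c' \<alpha> = (\<lambda>_. 0)" "velocity A {\<alpha>..\<beta>} c' \<beta> = (\<lambda>_. 0)"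
    "action A a b V \<alpha> \<beta> c' < action A a b V \<alpha> \<beta> c + \<epsilon>"
proof -
  let ?I = "{\<alpha>..\<beta>}"
  obtain \<theta> \<rho> where \<theta>: "\<And>n s. s \<in> ?I \<Longrightarrow> \<theta> n s \<in> ?I"
      "\<And>n s. (\<theta> n has_vector_derivative \<rho> n s) (at s within ?I)"
      "\<And>n. continuous_on ?I (\<rho> n)" "\<And>n s. s \<in> ?I \<Longrightarrow> \<bar>\<rho> n s\<bar> \<le> 2"
      "\<And>n. \<theta> n \<alpha> = \<alpha>" "\<And>n. \<theta> n \<beta> = \<beta>" "\<And>n. \<rho> n \<alpha> = 0" "\<And>n. \<rho> n \<beta> = 0"
      "\<And>s. s \<in> {\<alpha><..<\<beta>} \<Longrightarrow> (\<lambda>n. \<theta> n s) \<longlonglongrightarrow> s"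
      "\<And>s. s \<in> {\<alpha><..<\<beta>} \<Longrightarrow> (\<lambda>n. \<rho> n s) \<longlonglongrightarrow> 1"
    using stop_reparam[OF \<alpha>\<beta>(1)] by blast
  note IT = T_Icc[OF \<alpha>\<beta>(2,3)]
  let ?v = "velocity A ?I c"
  \<comment> \<open>The first component of \<open>p\<close> is the time at which the coefficients
    are taken, the second the parameter of the curve. Reparametrizing moves the point of the curve
    but not the time, so the two must be separated.\<close>
  define F where "F p = a (fst p) (c (snd p)) (?v (snd p)) (?v (snd p))" for p
  define B where "B p = b (fst p) (c (snd p)) (?v (snd p))" for p
  define W where "W p = V (fst p) (c (snd p))" for p
  have cc: "continuous_on (?I \<times> ?I) (\<lambda>p. c (snd p))"
    by (intro continuous_on_compose2[OF C1_curve_continuous[OF c]] continuous_intros) auto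
  have vt: "?v (snd p) \<in> tangent_space A (c (snd p))" if "p \<in> ?I \<times> ?I" for p
    using that by (auto intro!: C1_curve_velocity_tangent[OF c \<alpha>\<beta>(1)])
  have vc: "continuous_on {p \<in> ?I \<times> ?I. c (snd p) \<in> fst \<phi>} (\<lambda>p. ?v (snd p) \<phi>)" if "\<phi> \<in> A" for \<phi>
    by (intro continuous_on_compose2[OF C1_curve_velocity_continuous[OF c \<alpha>\<beta>(1) that]] continuous_intros)
      auto
  have FBW: "continuous_on (?I \<times> ?I) F" "continuous_on (?I \<times> ?I) B" "continuous_on (?I \<times> ?I) W"
    unfolding F_def B_def W_def using IT
    by (intro continuous_on_a_along continuous_on_b_along
        continuous_on_V_along[where v = "\<lambda>p. ?v (snd p)"] cc vt vc continuous_intros; force)+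
  have "\<exists>M. \<forall>p\<in>?I \<times> ?I. \<bar>G p\<bar> \<le> M" if G: "continuous_on (?I \<times> ?I) G" for G :: "real \<times> real \<Rightarrow> real"
  proof -
    have "compact (G ` (?I \<times> ?I))"
      by (intro compact_continuous_image G compact_Times compact_Icc)
    then show ?thesis using compact_imp_bounded bounded_iff by (metis image_eqI real_norm_def)
  qed
  with FBW obtain M1 M2 M3 where M: "\<And>p. p \<in> ?I \<times> ?I \<Longrightarrow> \<bar>F p\<bar> \<le> M1"
    "\<And>p. p \<in> ?I \<times> ?I \<Longrightarrow> \<bar>B p\<bar> \<le> M2" "\<And>p. p \<in> ?I \<times> ?I \<Longrightarrow> \<bar>W p\<bar> \<le> M3" by meson
  define c' where "c' n = c \<circ> \<theta> n" for n
  have C1: "C1_curve A ?I (c' n)" for n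
    unfolding c'_def by (rule C1_curve_reparam[OF c \<alpha>\<beta>(1) \<theta>(1-3)])
  have vel: "velocity A ?I (c' n) s = (\<lambda>\<phi>. \<rho> n s *\<^sub>R ?v (\<theta> n s) \<phi>)" if "s \<in> ?I" for n s
    unfolding c'_def by (rule velocity_reparam[OF c \<alpha>\<beta>(1) \<theta>(1-3) that])
  define L where "L n s = lagrangian a b V s (c' n s) (velocity A ?I (c' n) s)" for n s
  have L: "L n s = \<rho> n s * (\<rho> n s * F (s, \<theta> n s)) / 2 + \<rho> n s * B (s, \<theta> n s) - W (s, \<theta> n s)"
    if s: "s \<in> ?I" for n s
  proof -
    have "?v (\<theta> n s) \<in> tangent_space A (c (\<theta> n s))" "s \<in> T"
      using C1_curve_velocity_tangent[OF c \<alpha>\<beta>(1) \<theta>(1)[OF s]] IT s by auto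
    then show ?thesis
      unfolding L_def lagrangian_def vel[OF s]
      by (simp add: a_scale b_scale tangent_scale c'_def F_def B_def W_def)
  qed
  \<comment> \<open>At the endpoints every reparametrized curve is at rest, so only the potential
    survives in the limit. These two points do not affect the integral.\<close>
  define g where "g s = (if s \<in> {\<alpha><..<\<beta>} then lagrangian a b V s (c s) (?v s) else - W (s, s))" for s
  have "(\<lambda>n. integral ?I (L n)) \<longlonglongrightarrow> integral ?I g"
  proof (rule dominated_convergence(2))
    show "L n integrable_on ?I" for n
      unfolding L_def using continuous_on_lagrangian[OF C1 \<alpha>\<beta>] integrable_continuous_real by blast
    \<comment> \<open>From |\<rho>| \<le> 2: the quadratic term is at most 4 \<open>M1\<close> / 2
      and the linear term at most 2 \<open>M2\<close>.\<close>
    show "(\<lambda>_. 2 * M1 + 2 * M2 + M3) integrable_on ?I" by (rule integrable_const_ivl)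
    show "norm (L n s) \<le> 2 * M1 + 2 * M2 + M3" if s: "s \<in> ?I" for n s
    proof -
      have p: "(s, \<theta> n s) \<in> ?I \<times> ?I" using \<theta>(1) s by auto
      have "\<bar>\<rho> n s * (\<rho> n s * F (s, \<theta> n s))\<bar> \<le> 2 * (2 * M1)"
        unfolding abs_mult using \<theta>(4)[OF s] M(1)[OF p] by (intro mult_mono) auto
      moreover have "\<bar>\<rho> n s * B (s, \<theta> n s)\<bar> \<le> 2 * M2"
        unfolding abs_mult using \<theta>(4)[OF s] M(2)[OF p] by (intro mult_mono) auto
      ultimately show ?thesis using M(3)[OF p] unfolding L[OF s] by (simp add: abs_le_iff)
    qed
    show "(\<lambda>n. L n s) \<longlonglongrightarrow> g s" if s: "s \<in> ?I" for s
    proof (cases "s \<in> {\<alpha><..<\<beta>}")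
      case True
      have lim: "(\<lambda>n. G (s, \<theta> n s)) \<longlonglongrightarrow> G (s, s)" if G: "continuous_on (?I \<times> ?I) G" for G :: "real \<times> real \<Rightarrow> real"
      proof (rule continuous_on_tendsto_compose[OF G])
        show "(\<lambda>n. (s, \<theta> n s)) \<longlonglongrightarrow> (s, s)" by (intro tendsto_intros \<theta>(9) True)
      qed (use s \<theta>(1) in auto)
      have "(\<lambda>n. L n s) \<longlonglongrightarrow> 1 * (1 * F (s, s)) / 2 + 1 * B (s, s) - W (s, s)"
        unfolding L[OF s] by (intro tendsto_intros \<theta>(10) True lim FBW) simp
      then show ?thesis using True by (simp add: g_def lagrangian_def F_def B_def W_def)
    next
      case False
      then have "s = \<alpha> \<or> s = \<beta>" using s by auto
      then have "L n s = g s" for n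
        unfolding L[OF s] using False \<theta> by (auto simp: g_def)
      then show ?thesis by simp
    qed
  qed
  moreover have "integral ?I g = action A a b V \<alpha> \<beta> c"
    unfolding action_def by (rule integral_spike[of "{\<alpha>, \<beta>}"]) (auto simp: g_def)
  ultimately have "(\<lambda>n. action A a b V \<alpha> \<beta> (c' n)) \<longlonglongrightarrow> action A a b V \<alpha> \<beta> c"
    by (simp add: L_def[abs_def] action_def)
  then have "\<forall>\<^sub>F n in sequentially. action A a b V \<alpha> \<beta> (c' n) < action A a b V \<alpha> \<beta> c + \<epsilon>"
    by (rule order_tendstoD(2)) (use \<open>0 < \<epsilon>\<close> in simp)
  then obtain n where "action A a b V \<alpha> \<beta> (c' n) < action A a b V \<alpha> \<beta> c + \<epsilon>"
    using eventually_happens'[OF sequentially_bot] by blast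
  then show thesis
    using that[OF C1[of n]] vel[of \<alpha> n] vel[of \<beta> n] \<theta>(5-8) \<alpha>\<beta>(1) by (simp add: c'_def)
qed

lemma action_glue:
  assumes c1: "C1_curve A {\<alpha>..\<beta>} c1" and c2: "C1_curve A {\<beta>..\<gamma>} c2"
    and "\<alpha> < \<beta>" "\<beta> < \<gamma>" "c1 \<beta> = c2 \<beta>" "velocity A {\<alpha>..\<beta>} c1 \<beta> = velocity A {\<beta>..\<gamma>} c2 \<beta>"
    and T: "\<alpha> \<in> T" "\<gamma> \<in> T"
  shows "action A a b V \<alpha> \<gamma> (\<lambda>s. if s \<le> \<beta> then c1 s else c2 s) =
    action A a b V \<alpha> \<beta> c1 + action A a b V \<beta> \<gamma> c2"
proof -
  have \<beta>: "\<beta> \<in> T" using T_Icc[OF T] assms by auto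
  let ?c = "\<lambda>s. if s \<le> \<beta> then c1 s else c2 s"
  let ?L = "\<lambda>s. lagrangian a b V s (?c s) (velocity A {\<alpha>..\<gamma>} ?c s)"
  note vel = velocity_glue[OF assms(1-6)]
  have "((\<lambda>s. lagrangian a b V s (c1 s) (velocity A {\<alpha>..\<beta>} c1 s)) has_integral
      action A a b V \<alpha> \<beta> c1) {\<alpha>..\<beta>}"
    unfolding action_def using continuous_on_lagrangian[OF c1 \<open>\<alpha> < \<beta>\<close> T(1) \<beta>]
    by (intro integrable_integral integrable_continuous_real)
  then have 1: "(?L has_integral action A a b V \<alpha> \<beta> c1) {\<alpha>..\<beta>}"
    by (rule has_integral_eq[rotated]) (use vel assms(3,4) in auto)
  have "((\<lambda>s. lagrangian a b V s (c2 s) (velocity A {\<beta>..\<gamma>} c2 s)) has_integral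
      action A a b V \<beta> \<gamma> c2) {\<beta>..\<gamma>}"
    unfolding action_def using continuous_on_lagrangian[OF c2 \<open>\<beta> < \<gamma>\<close> \<beta> T(2)]
    by (intro integrable_integral integrable_continuous_real)
  then have 2: "(?L has_integral action A a b V \<beta> \<gamma> c2) {\<beta>..\<gamma>}"
    by (rule has_integral_eq[rotated]) (use vel assms(3-6) in \<open>auto simp: order_antisym_conv\<close>)
  show ?thesis
    using has_integral_combine[OF _ _ 1 2] assms(3,4)
    unfolding action_def[of A a b V \<alpha> \<gamma>] by (intro integral_unique) simp
qed

section \<open>The triangle inequality for the least action\<close>

abbreviation S :: "real \<times> 'q \<Rightarrow> real \<times> 'q \<Rightarrow> ereal" where
  "S \<equiv> least_action A a b V"

lemma least_action_le_action:
  assumes "\<alpha> < \<beta>" "C1_curve A {\<alpha>..\<beta>} c" shows "S (\<alpha>, c \<alpha>) (\<beta>, c \<beta>) \<le> ereal (action A a b V \<alpha> \<beta> c)"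
  using assms by (auto simp: least_action_def intro!: Inf_lower)

lemma least_action_lessD:
  assumes "\<alpha> < \<beta>" "S (\<alpha>, p) (\<beta>, q) < ereal x"
  obtains c where "C1_curve A {\<alpha>..\<beta>} c" "c \<alpha> = p" "c \<beta> = q" "action A a b V \<alpha> \<beta> c < x"
  using assms by (auto simp: least_action_def Inf_less_iff)

lemma least_action_refl: "S e e = 0"
  by (cases e) (simp add: least_action_def)

text \<open>Stated with real upper bounds because \<open>S\<close> can be infinite of either sign,
  so that a sum of two values could be \<infinity> - \<infinity>.\<close>

lemma least_action_triangle:
  assumes T: "t0 \<in> T" "t2 \<in> T"
    and le1: "S (t0, q0) (t1, q1) \<le> ereal x" and le2: "S (t1, q1) (t2, q2) \<le> ereal y"
  shows "S (t0, q0) (t2, q2) \<le> ereal (x + y)"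
proof -
  \<comment> \<open>A finite upper bound excludes the value \<infinity> that
    \<open>least_action\<close> takes for events not ordered in time. For equal events the value 0
    makes the bound nonnegative, and it may be dropped from the sum.\<close>
  have 1: "t0 < t1 \<or> (t0, q0) = (t1, q1)" using le1 by (auto simp: least_action_def split: if_splits)
  have 2: "t1 < t2 \<or> (t1, q1) = (t2, q2)" using le2 by (auto simp: least_action_def split: if_splits)
  consider "(t0, q0) = (t1, q1)" | "(t1, q1) = (t2, q2)" | "t0 < t1" "t1 < t2" using 1 2 by blast
  then show ?thesis
  proof cases
    case 1
    then have "0 \<le> x" using le1 by (simp add: least_action_refl flip: zero_ereal_def)
    then show ?thesis using le2 1 order_trans[of _ "ereal y" "ereal (x + y)"] by simp
  next
    case 2
    then have "0 \<le> y" using le2 by (simp add: least_action_refl flip: zero_ereal_def)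
    then show ?thesis using le1 2 order_trans[of _ "ereal x" "ereal (x + y)"] by simp
  next
    case 3
    have t1: "t1 \<in> T" using T_Icc[OF T] 3 by auto
    show ?thesis
    proof (rule ereal_le_epsilon2)
      fix \<epsilon> :: real assume \<epsilon>: "0 < \<epsilon>"
      \<comment> \<open>Four errors: each of the two curves is only nearly minimising, and each is
        then stopped at its ends.\<close>
      then have \<epsilon>4: "0 < \<epsilon> / 4" by simp
      have "S (t0, q0) (t1, q1) < ereal (x + \<epsilon> / 4)" "S (t1, q1) (t2, q2) < ereal (y + \<epsilon> / 4)"
        using le1 le2 \<epsilon> by (auto elim!: le_less_trans)
      then obtain c1 c2 where c1: "C1_curve A {t0..t1} c1" "c1 t0 = q0" "c1 t1 = q1"
          "action A a b V t0 t1 c1 < x + \<epsilon> / 4"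
        and c2: "C1_curve A {t1..t2} c2" "c2 t1 = q1" "c2 t2 = q2" "action A a b V t1 t2 c2 < y + \<epsilon> / 4"
        by (metis least_action_lessD 3)
      obtain c1' where c1': "C1_curve A {t0..t1} c1'" "c1' t0 = c1 t0" "c1' t1 = c1 t1"
          "velocity A {t0..t1} c1' t0 = (\<lambda>_. 0)" "velocity A {t0..t1} c1' t1 = (\<lambda>_. 0)"
          "action A a b V t0 t1 c1' < action A a b V t0 t1 c1 + \<epsilon> / 4"
        by (rule stop_curve[OF c1(1) 3(1) T(1) t1 \<epsilon>4])
      obtain c2' where c2': "C1_curve A {t1..t2} c2'" "c2' t1 = c2 t1" "c2' t2 = c2 t2"
          "velocity A {t1..t2} c2' t1 = (\<lambda>_. 0)" "velocity A {t1..t2} c2' t2 = (\<lambda>_. 0)"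
          "action A a b V t1 t2 c2' < action A a b V t1 t2 c2 + \<epsilon> / 4"
        by (rule stop_curve[OF c2(1) 3(2) t1 T(2) \<epsilon>4])
      let ?c = "\<lambda>s. if s \<le> t1 then c1' s else c2' s"
      have eq: "c1' t1 = c2' t1" using c1'(3) c2'(2) c1(3) c2(2) by simp
      note g = c1'(1) c2'(1) 3 eq
        trans[OF c1'(5) c2'(4)[symmetric]]
      have "t0 < t2" using 3 by simp
      from least_action_le_action[OF this C1_curve_glue[OF g]]
      have "S (t0, q0) (t2, q2) \<le> ereal (action A a b V t0 t2 ?c)"
        using 3 c1'(2) c2'(3) c1(2) c2(3) by simp
      also have "action A a b V t0 t2 ?c \<le> x + y + \<epsilon>"
        using action_glue[OF g T] c1'(6) c2'(6) c1(4) c2(4) by simp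
      finally show "S (t0, q0) (t2, q2) \<le> ereal (x + y) + ereal \<epsilon>" by simp
    qed
  qed
qed

end

section \<open>Length bounded by action\<close>

text \<open>Homogeneity reduces the claim to the unit sphere, where compactness provides a positive
  minimum.\<close>

lemma bilinear_pos_def_bound:
  fixes B :: "'e::euclidean_space \<Rightarrow> 'e \<Rightarrow> real"
  assumes "bilinear B" "\<And>e. e \<noteq> 0 \<Longrightarrow> 0 < B e e"
  obtains m where "0 < m" "\<And>e. m * (norm e)\<^sup>2 \<le> B e e"
proof -
  have cont: "continuous_on (sphere 0 1) (\<lambda>e. B e e)"
    by (rule bounded_bilinear.continuous_on[OF assms(1)[unfolded bilinear_conv_bounded_bilinear]
          continuous_on_id continuous_on_id])
  obtain i :: 'e where "i \<in> Basis" using nonempty_Basis by blast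
  then have "sphere (0::'e) 1 \<noteq> {}" by auto
  then obtain e0 where e0: "e0 \<in> sphere 0 1" "\<And>e. e \<in> sphere 0 1 \<Longrightarrow> B e0 e0 \<le> B e e"
    using continuous_attains_inf[OF compact_sphere _ cont] by blast
  show thesis
  proof
    show "0 < B e0 e0" using e0(1) by (intro assms(2)) auto
    show "B e0 e0 * (norm e)\<^sup>2 \<le> B e e" for e
    proof (cases "e = 0")
      case True
      then show ?thesis using bilinear_lzero[OF assms(1)] by simp
    next
      case False
      have "B e0 e0 \<le> B (inverse (norm e) *\<^sub>R e) (inverse (norm e) *\<^sub>R e)"
        using False by (intro e0(2)) simp
      also have "\<dots> = B e e / (norm e)\<^sup>2"
        by (simp add: bilinear_lmul[OF assms(1)] bilinear_rmul[OF assms(1)] power2_eq_square divide_inverse)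
      finally show ?thesis using False by (simp add: pos_le_divide_eq)
    qed
  qed
qed

text \<open>\<open>\<tau>\<close>, \<open>N\<close> and \<open>\<alpha>\<close> stand for \<open>t'\<close>, \<open>y' - b(q') + V t'\<close> and \<open>a(q', q')\<close> at a point of a causal curve,
  whose squared speed is \<open>2 \<tau> N - \<alpha>\<close>.\<close>

lemma two_mult_sqrt_le:
  fixes l :: real
  assumes "0 < \<tau>" "0 < l" "\<alpha> \<le> 2 * \<tau> * N"
  shows "2 * l * sqrt (2 * \<tau> * N - \<alpha>) \<le> 2 * l\<^sup>2 * \<tau> + (N - \<alpha> / (2 * \<tau>))"
proof -
  define p where "p = sqrt (2 * \<tau> * N - \<alpha>)"
  have p2: "p\<^sup>2 = 2 * \<tau> * N - \<alpha>" unfolding p_def using assms(3) by simp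
  \<comment> \<open>Expanding this square and dividing by 2 \<tau> is the claim; equality holds when
    the speed \<open>p\<close> is 2 l \<tau>.\<close>
  have "0 \<le> (p - 2 * l * \<tau>)\<^sup>2" by simp
  then have "4 * l * \<tau> * p \<le> p\<^sup>2 + (2 * l * \<tau>)\<^sup>2" by (simp add: power2_diff algebra_simps)
  moreover have "2 * \<tau> * (2 * l\<^sup>2 * \<tau> + (N - \<alpha> / (2 * \<tau>))) = (2 * l * \<tau>)\<^sup>2 + (2 * \<tau> * N - \<alpha>)"
    using assms(1) by (simp add: right_diff_distrib distrib_left power2_eq_square)
  ultimately have "2 * \<tau> * (2 * l * p) \<le> 2 * \<tau> * (2 * l\<^sup>2 * \<tau> + (N - \<alpha> / (2 * \<tau>)))"
    unfolding p2 by (simp add: mult_ac)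
  then show ?thesis using assms(1) unfolding p_def by simp
qed

context gw_spacetime
begin

lemma coord_near:
  assumes \<phi>: "\<phi> \<in> A" and z0: "z0 \<in> snd \<phi> ` fst \<phi>" and t0: "t0 \<in> T" and \<delta>: "0 < \<delta>"
  obtains \<rho> where "0 < \<rho>"
    and "\<And>t z. \<bar>t - t0\<bar> < \<rho> \<Longrightarrow> dist z z0 < \<rho> \<Longrightarrow> t \<in> T \<and> z \<in> snd \<phi> ` fst \<phi> \<and>
      (\<forall>e. \<bar>a_coord \<phi> t z e e - a_coord \<phi> t0 z0 e e\<bar> \<le> \<delta> * a_coord \<phi> t0 z0 e e) \<and>
      (\<forall>e. \<bar>b_coord \<phi> t z e - b_coord \<phi> t0 z0 e\<bar> \<le> \<delta> * norm e) \<and>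
      \<bar>V t (chart_inv \<phi> z) - V t0 (chart_inv \<phi> z0)\<bar> \<le> \<delta>"
proof -
  let ?X = "T \<times> snd \<phi> ` fst \<phi>"
  let ?n = "real DIM('e)"
  have n: "0 < ?n" by simp
  obtain m where m: "0 < m" "\<And>e. m * (norm e)\<^sup>2 \<le> a_coord \<phi> t0 z0 e e"
    using bilinear_pos_def_bound[OF bilinear_a_coord[OF \<phi> z0 t0] a_coord_pos[OF \<phi> z0 t0]] by blast
  have op: "open ?X" by (intro open_Times open_T open_img \<phi>)
  have p0: "(t0, z0) \<in> ?X" using z0 t0 by simp
  have ev: "\<forall>\<^sub>F p in nhds (t0, z0). \<bar>f p - f (t0, z0)\<bar> < \<epsilon>"
    if "continuous_on ?X f" "0 < \<epsilon>" for f :: "real \<times> 'e \<Rightarrow> real" and \<epsilon>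
  proof -
    have "isCont f (t0, z0)" using that(1) p0 unfolding continuous_on_eq_continuous_at[OF op] by blast
    then have "(f \<longlongrightarrow> f (t0, z0)) (nhds (t0, z0))" by (simp add: isCont_def tendsto_at_iff_tendsto_nhds)
    from tendstoD[OF this that(2)] show ?thesis by (simp add: dist_real_def)
  qed
  have "\<forall>\<^sub>F p in nhds (t0, z0). p \<in> ?X \<and>
      (\<forall>i\<in>Basis. \<forall>j\<in>Basis. \<bar>a_coord \<phi> (fst p) (snd p) i j - a_coord \<phi> t0 z0 i j\<bar> < \<delta> * m / ?n\<^sup>2) \<and>
      (\<forall>i\<in>Basis. \<bar>b_coord \<phi> (fst p) (snd p) i - b_coord \<phi> t0 z0 i\<bar> < \<delta> / ?n) \<and>
      \<bar>V (fst p) (chart_inv \<phi> (snd p)) - V t0 (chart_inv \<phi> z0)\<bar> < \<delta>"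
    using ev[OF a_coord_basis_continuous[OF \<phi>], of _ _ "\<delta> * m / ?n\<^sup>2"]
      ev[OF b_coord_basis_continuous[OF \<phi>], of _ "\<delta> / ?n"] ev[OF V_coord_continuous[OF \<phi>] \<delta>] \<delta> m(1) n
    by (intro eventually_conj eventually_ball_finite ballI finite_Basis
        eventually_nhds_in_open[OF op p0]) auto
  then obtain d where d: "0 < d" and near: "\<And>p. dist p (t0, z0) < d \<Longrightarrow> p \<in> ?X \<and>
      (\<forall>i\<in>Basis. \<forall>j\<in>Basis. \<bar>a_coord \<phi> (fst p) (snd p) i j - a_coord \<phi> t0 z0 i j\<bar> < \<delta> * m / ?n\<^sup>2) \<and>
      (\<forall>i\<in>Basis. \<bar>b_coord \<phi> (fst p) (snd p) i - b_coord \<phi> t0 z0 i\<bar> < \<delta> / ?n) \<and>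
      \<bar>V (fst p) (chart_inv \<phi> (snd p)) - V t0 (chart_inv \<phi> z0)\<bar> < \<delta>"
    unfolding eventually_nhds_metric by blast
  show thesis
  proof
    show "0 < d / 2" using d by simp
    fix t z assume tz: "\<bar>t - t0\<bar> < d / 2" "dist z z0 < d / 2"
    have "dist (t, z) (t0, z0) \<le> dist t t0 + dist z z0"
      by (simp add: dist_Pair_Pair sqrt_sum_squares_le_sum)
    then have "dist (t, z) (t0, z0) < d" using tz by (simp add: dist_real_def)
    note near = near[OF this, simplified]
    have t: "t \<in> T" and z: "z \<in> snd \<phi> ` fst \<phi>" using near by auto
    have "\<bar>a_coord \<phi> t z e e - a_coord \<phi> t0 z0 e e\<bar> \<le> \<delta> * a_coord \<phi> t0 z0 e e" for e
    proof -
      have "\<bar>a_coord \<phi> t z e e - a_coord \<phi> t0 z0 e e\<bar> =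
        \<bar>\<Sum>i\<in>Basis. \<Sum>j\<in>Basis. (e \<bullet> i) * (e \<bullet> j) * (a_coord \<phi> t z i j - a_coord \<phi> t0 z0 i j)\<bar>"
        by (simp add: a_coord_expand[OF \<phi> z t, of e e] a_coord_expand[OF \<phi> z0 t0, of e e]
            sum_subtractf right_diff_distrib)
      also have "\<dots> \<le> (\<Sum>i\<in>(Basis::'e set). \<Sum>j\<in>(Basis::'e set). (norm e)\<^sup>2 * (\<delta> * m / ?n\<^sup>2))"
      proof (intro order_trans[OF sum_abs] sum_mono)
        fix i j :: 'e assume ij: "i \<in> Basis" "j \<in> Basis"
        have "\<bar>e \<bullet> i\<bar> * \<bar>e \<bullet> j\<bar> \<le> norm e * norm e"
          using ij by (intro mult_mono Basis_le_norm) auto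
        then show "\<bar>(e \<bullet> i) * (e \<bullet> j) * (a_coord \<phi> t z i j - a_coord \<phi> t0 z0 i j)\<bar>
            \<le> (norm e)\<^sup>2 * (\<delta> * m / ?n\<^sup>2)"
          unfolding abs_mult power2_eq_square[of "norm e"]
          by (rule mult_mono) (use near ij in \<open>auto intro: less_imp_le\<close>)
      qed
      also have "\<dots> = \<delta> * (m * (norm e)\<^sup>2)" using n by (simp add: power2_eq_square)
      also have "\<dots> \<le> \<delta> * a_coord \<phi> t0 z0 e e" using m(2) \<delta> by (intro mult_left_mono) auto
      finally show ?thesis .
    qed
    moreover have "\<bar>b_coord \<phi> t z e - b_coord \<phi> t0 z0 e\<bar> \<le> \<delta> * norm e" for e
    proof -
      have "\<bar>b_coord \<phi> t z e - b_coord \<phi> t0 z0 e\<bar> =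
        \<bar>\<Sum>i\<in>Basis. (e \<bullet> i) * (b_coord \<phi> t z i - b_coord \<phi> t0 z0 i)\<bar>"
        by (simp add: b_coord_expand[OF \<phi> z t, of e] b_coord_expand[OF \<phi> z0 t0, of e]
            sum_subtractf right_diff_distrib)
      also have "\<dots> \<le> (\<Sum>i\<in>(Basis::'e set). norm e * (\<delta> / ?n))"
      proof (intro order_trans[OF sum_abs] sum_mono)
        fix i :: 'e assume i: "i \<in> Basis"
        show "\<bar>(e \<bullet> i) * (b_coord \<phi> t z i - b_coord \<phi> t0 z0 i)\<bar> \<le> norm e * (\<delta> / ?n)"
          unfolding abs_mult
          by (rule mult_mono) (use near i Basis_le_norm[OF i] in \<open>auto intro: less_imp_le\<close>)
      qed
      also have "\<dots> = \<delta> * norm e" using n by simp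
      finally show ?thesis .
    qed
    ultimately show "t \<in> T \<and> z \<in> snd \<phi> ` fst \<phi> \<and>
      (\<forall>e. \<bar>a_coord \<phi> t z e e - a_coord \<phi> t0 z0 e e\<bar> \<le> \<delta> * a_coord \<phi> t0 z0 e e) \<and>
      (\<forall>e. \<bar>b_coord \<phi> t z e - b_coord \<phi> t0 z0 e\<bar> \<le> \<delta> * norm e) \<and>
      \<bar>V t (chart_inv \<phi> z) - V t0 (chart_inv \<phi> z0)\<bar> \<le> \<delta>"
      using near t z by auto
  qed
qed

text \<open>The straight coordinate segment is one competitor in the infimum, and its velocity has
  the constant representative \<open>u\<close>; so a pointwise bound of the Lagrangian is
  enough.\<close>

lemma action_segment_le:
  assumes \<phi>: "\<phi> \<in> A" and "\<alpha> < \<beta>"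
    and img: "\<And>t. t \<in> {\<alpha>..\<beta>} \<Longrightarrow> t \<in> T \<and> z + (t - \<alpha>) *\<^sub>R u \<in> snd \<phi> ` fst \<phi>"
    and bound: "\<And>t. t \<in> {\<alpha>..\<beta>} \<Longrightarrow> a_coord \<phi> t (z + (t - \<alpha>) *\<^sub>R u) u u / 2
      + b_coord \<phi> t (z + (t - \<alpha>) *\<^sub>R u) u - V t (chart_inv \<phi> (z + (t - \<alpha>) *\<^sub>R u)) \<le> M"
  shows "S (\<alpha>, chart_inv \<phi> z) (\<beta>, chart_inv \<phi> (z + (\<beta> - \<alpha>) *\<^sub>R u)) \<le> ereal (M * (\<beta> - \<alpha>))"
proof -
  let ?c = "chart_inv \<phi> \<circ> (\<lambda>t. z + (t - \<alpha>) *\<^sub>R u)"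
  have der: "((\<lambda>t. z + (t - \<alpha>) *\<^sub>R u) has_vector_derivative u) (at s within {\<alpha>..\<beta>})" for s
    by (auto intro!: derivative_eq_intros simp: has_vector_derivative_def)
  have "continuous_on {\<alpha>..\<beta>} (\<lambda>_. u)" by simp
  note c = C1_curve_in_chart[OF \<phi> \<open>\<alpha> < \<beta>\<close> _ der this, OF img[THEN conjunct2]]
  have T: "\<alpha> \<in> T" "\<beta> \<in> T" using img \<open>\<alpha> < \<beta>\<close> by auto
  have "action A a b V \<alpha> \<beta> ?c \<le> integral {\<alpha>..\<beta>} (\<lambda>_. M)"
    unfolding action_def
  proof (intro integral_le integrable_continuous_real continuous_on_lagrangian c \<open>\<alpha> < \<beta>\<close> T continuous_on_const)
    fix t assume t: "t \<in> {\<alpha>..\<beta>}"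
    show "lagrangian a b V t (?c t) (velocity A {\<alpha>..\<beta>} ?c t) \<le> M"
      using bound[OF t] unfolding c(2)[OF _ t, simplified] by (simp add: lagrangian_def a_coord_def b_coord_def Let_def)
  qed
  then have "action A a b V \<alpha> \<beta> ?c \<le> M * (\<beta> - \<alpha>)" using \<open>\<alpha> < \<beta>\<close> by (simp add: mult.commute)
  moreover have "S (\<alpha>, ?c \<alpha>) (\<beta>, ?c \<beta>) \<le> ereal (action A a b V \<alpha> \<beta> ?c)"
    by (rule least_action_le_action[OF \<open>\<alpha> < \<beta>\<close> c(1)])
  ultimately show ?thesis using order_trans by fastforce
qed

end

section \<open>The additive bound on one C^1 piece of a causal curve\<close>

locale causal_C1_piece = gw_spacetime +
  fixes s0 s1 :: real and \<tau> \<tau>' \<upsilon> \<upsilon>' :: "real \<Rightarrow> real" and c :: "real \<Rightarrow> 'a"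
  assumes s01: "s0 < s1" and c: "C1_curve A {s0..s1} c"
    and \<tau>_deriv: "\<And>s. s \<in> {s0..s1} \<Longrightarrow> (\<tau> has_vector_derivative \<tau>' s) (at s within {s0..s1})"
    and \<tau>'_cont: "continuous_on {s0..s1} \<tau>'" and \<tau>_T: "\<And>s. s \<in> {s0..s1} \<Longrightarrow> \<tau> s \<in> T"
    and \<upsilon>_deriv: "\<And>s. s \<in> {s0..s1} \<Longrightarrow> (\<upsilon> has_vector_derivative \<upsilon>' s) (at s within {s0..s1})"
    and \<upsilon>'_cont: "continuous_on {s0..s1} \<upsilon>'"
    and causal: "\<And>s. s \<in> {s0..s1} \<Longrightarrow> fd_causal a b V (\<tau> s, c s, \<upsilon> s) (\<tau>' s, velocity A {s0..s1} c s, \<upsilon>' s)"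
begin

abbreviation "v \<equiv> velocity A {s0..s1} c"

definition "N s = \<upsilon>' s - b (\<tau> s) (c s) (v s) + V (\<tau> s) (c s) * \<tau>' s"

definition "av s = a (\<tau> s) (c s) (v s) (v s)"

lemma v_tangent: "s \<in> {s0..s1} \<Longrightarrow> v s \<in> tangent_space A (c s)"
  by (rule C1_curve_velocity_tangent[OF c s01])

lemma minus_metric_eq:
  "s \<in> {s0..s1} \<Longrightarrow> - gw_metric a b V (\<tau> s, c s, \<upsilon> s) (\<tau>' s, v s, \<upsilon>' s) (\<tau>' s, v s, \<upsilon>' s)
    = 2 * \<tau>' s * N s - av s"
  by (simp add: gw_metric_def N_def av_def algebra_simps)

text \<open>Causality gives \<tau>' N \<ge> 0, and pairing the velocity with the time orientation
  gives N + \<tau>' / 2 > 0; together they rule out negative values. The value \<tau>' = 0 remains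
  possible: it occurs for the lightlike direction of y.\<close>

lemma causal_components:
  assumes s: "s \<in> {s0..s1}"
  shows "0 \<le> \<tau>' s" "0 \<le> N s" "av s \<le> 2 * \<tau>' s * N s"
proof -
  note vt = v_tangent[OF s] and T = \<tau>_T[OF s]
  have a0: "a (\<tau> s) (c s) (v s) (\<lambda>_. 0) = 0"
    using a_scale(1)[OF T vt vt, of 0] by simp
  show le: "av s \<le> 2 * \<tau>' s * N s"
    using causal[OF s] minus_metric_eq[OF s] by (simp add: fd_causal_def)
  have pos: "0 < N s + \<tau>' s / 2"
    using causal[OF s] a0 b_zero[OF T, of "c s"]
    by (simp add: fd_causal_def gw_metric_def time_orientation_def N_def algebra_simps)
  have "0 \<le> av s" unfolding av_def by (rule a_nonneg[OF T vt])
  then have "0 \<le> \<tau>' s * N s" using le by simp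
  then show "0 \<le> \<tau>' s" "0 \<le> N s"
    using pos by (auto simp: zero_le_mult_iff)
qed

lemma \<tau>_cont: "continuous_on {s0..s1} \<tau>"
  using \<tau>_deriv has_vector_derivative_continuous continuous_on_eq_continuous_within by blast

lemma N_cont: "continuous_on {s0..s1} N"
  unfolding N_def by (intro continuous_intros \<upsilon>'_cont \<tau>'_cont continuous_on_b_velocity[OF c s01]
      continuous_on_V_curve[OF c s01] \<tau>_cont \<tau>_T)

lemma av_cont: "continuous_on {s0..s1} av"
  unfolding av_def by (intro continuous_on_a_velocity[OF c s01] \<tau>_cont \<tau>_T)

text \<open>The integrand of the additive bound: its integral over the piece is the increment of y
  plus 2 l^2 times the increment of t, minus 2 l times the length.\<close>

definition "E l s = \<upsilon>' s + 2 * l\<^sup>2 * \<tau>' s - 2 * l * sqrt (2 * \<tau>' s * N s - av s)"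

lemma E_cont: "continuous_on {s0..s1} (E l)"
  unfolding E_def by (intro continuous_intros \<upsilon>'_cont \<tau>'_cont N_cont av_cont)

text \<open>The minorants with constant \<open>u\<close> bound \<open>E l\<close> from below by a
  function affine in the velocity, whose integral depends on the endpoints only. With
  \<open>u\<close> the velocity of the straight segment this integral is the action of the segment
  up to freezing errors, and that action bounds \<open>S\<close> from above. The position of
  \<open>s\<close> between \<open>x\<close> and \<open>y\<close> is the form required for
  subdividing the interval.\<close>

lemma local_estimate:
  assumes l: "0 < l" and s: "s \<in> {s0..s1}" and \<eta>: "0 < \<eta>"
  obtains d where "0 < d" "\<And>x y. s0 \<le> x \<Longrightarrow> x \<le> s \<Longrightarrow> s \<le> y \<Longrightarrow> y \<le> s1 \<Longrightarrow> y - x < d \<Longrightarrow>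
    S (\<tau> x, c x) (\<tau> y, c y) \<le> ereal (integral {x..y} (E l) + \<eta> * (y - x))"
proof -
  let ?I = "{s0..s1}"
  obtain \<phi> where \<phi>: "\<phi> \<in> charts_at A (c s)" by (rule ex_chart)
  then have \<phi>A: "\<phi> \<in> A" and cs: "c s \<in> fst \<phi>" by (auto simp: charts_at_def)
  define z where "z x = snd \<phi> (c x)" for x
  define z' where "z' x = v x \<phi>" for x
  define t0 z0 where "t0 = \<tau> s" and "z0 = z s"
  have t0: "t0 \<in> T" and z0: "z0 \<in> snd \<phi> ` fst \<phi>"
    using \<tau>_T[OF s] cs by (auto simp: t0_def z0_def z_def)
  define a0 b0 V0 where "a0 = a_coord \<phi> t0 z0" and "b0 = b_coord \<phi> t0 z0" and "V0 = V t0 (chart_inv \<phi> z0)"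
  have bl: "bilinear a0" unfolding a0_def by (rule bilinear_a_coord[OF \<phi>A z0 t0])
  have lin: "linear b0" unfolding b0_def by (rule linear_b_coord[OF \<phi>A z0 t0])
  have a0_pos: "0 < a0 e e" if "e \<noteq> 0" for e
    unfolding a0_def by (rule a_coord_pos[OF \<phi>A z0 t0 that])
  have a0_nonneg: "0 \<le> a0 e e" for e
    using a0_pos[of e] bilinear_lzero[OF bl] by (cases "e = 0") auto
  have a0_sym: "a0 e f = a0 f e" for e f unfolding a0_def by (rule a_coord_sym[OF \<phi>A z0 t0])
  define K where "K = norm (z' s) + 1"
  obtain K' where K': "0 \<le> K'" "\<And>x. x \<in> ?I \<Longrightarrow> \<tau>' x \<le> K'"
  proof -
    have "compact (\<tau>' ` ?I)" by (intro compact_continuous_image \<tau>'_cont compact_Icc)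
    then obtain B where "\<And>x. x \<in> ?I \<Longrightarrow> norm (\<tau>' x) \<le> B"
      using compact_imp_bounded bounded_iff by (metis image_eqI)
    then show thesis using s by (intro that[of "max 0 B"]) (auto simp: abs_le_iff le_max_iff_disj)
  qed
  obtain C where C: "0 \<le> C" "\<And>x. x \<in> ?I \<Longrightarrow> N x \<le> C"
  proof -
    have "compact (N ` ?I)" by (intro compact_continuous_image N_cont compact_Icc)
    then obtain B where "\<And>x. x \<in> ?I \<Longrightarrow> norm (N x) \<le> B"
      using compact_imp_bounded bounded_iff by (metis image_eqI)
    then show thesis using s by (intro that[of "max 0 B"]) (auto simp: abs_le_iff le_max_iff_disj)
  qed
  have K: "0 < K" by (simp add: K_def add_nonneg_pos)
  \<comment> \<open>The sum of the errors per unit of parameter, divided by \<delta>: freezing the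
    one-form and the potential costs K + K' along the curve and again along the segment, and the
    factors 1 - \<delta> and 1 + \<delta> on a kinetic term of at most 2 C cost 4 C.\<close>
  define D where "D = 4 * C + 2 * K + 2 * K'"
  have D: "0 < D" using C(1) K K'(1) by (simp add: D_def)
  define \<delta> where "\<delta> = min (1/2) (\<eta> / D)"
  have \<delta>: "0 < \<delta>" "\<delta> \<le> 1/2" "\<delta> * D \<le> \<eta>"
    using \<eta> D by (auto simp: \<delta>_def min_def field_simps)
  obtain \<rho> where \<rho>: "0 < \<rho>"
    and near: "\<And>t z. \<bar>t - t0\<bar> < \<rho> \<Longrightarrow> dist z z0 < \<rho> \<Longrightarrow> t \<in> T \<and> z \<in> snd \<phi> ` fst \<phi> \<and>
      (\<forall>e. \<bar>a_coord \<phi> t z e e - a0 e e\<bar> \<le> \<delta> * a0 e e) \<and>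
      (\<forall>e. \<bar>b_coord \<phi> t z e - b0 e\<bar> \<le> \<delta> * norm e) \<and> \<bar>V t (chart_inv \<phi> z) - V0\<bar> \<le> \<delta>"
    using coord_near[OF \<phi>A z0 t0 \<delta>(1)] unfolding a0_def b0_def V0_def by metis
  have cc: "continuous (at s within ?I) c"
    using C1_curve_continuous[OF c] s by (simp add: continuous_on_eq_continuous_within)
  have "\<forall>\<^sub>F x in at s within ?I. c x \<in> fst \<phi> \<and> \<bar>\<tau> x - t0\<bar> < \<rho> \<and> dist (z x) z0 < \<rho> \<and> norm (z' x) < K"
  proof (intro eventually_conj)
    show ev: "\<forall>\<^sub>F x in at s within ?I. c x \<in> fst \<phi>" by (rule eventually_in_chart[OF cc \<phi>])
    have "(\<tau> \<longlongrightarrow> t0) (at s within ?I)" using \<tau>_cont s by (simp add: continuous_on_def t0_def)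
    then show "\<forall>\<^sub>F x in at s within ?I. \<bar>\<tau> x - t0\<bar> < \<rho>"
      using tendstoD[of \<tau> t0 "at s within ?I" \<rho>] \<rho> by (simp add: dist_real_def)
    have "isCont (snd \<phi>) (c s)"
      using continuous_on_chart[OF \<phi>A] open_dom[OF \<phi>A] cs by (simp add: continuous_on_eq_continuous_at)
    then have "(z \<longlongrightarrow> z0) (at s within ?I)"
      unfolding z_def[abs_def] z0_def z_def using cc by (auto simp: continuous_within intro: isCont_tendsto_compose)
    then show "\<forall>\<^sub>F x in at s within ?I. dist (z x) z0 < \<rho>" by (rule tendstoD) (fact \<rho>)
    \<comment> \<open>\<open>z'\<close> is known to be continuous only where the curve lies in the
      chart, so the bound is first obtained there and then combined with \<open>ev\<close>.\<close>
    have "continuous (at s within {x\<in>?I. c x \<in> fst \<phi>}) z'"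
      using C1_curve_velocity_continuous[OF c s01 \<phi>A] s cs
      by (simp add: z'_def[abs_def] continuous_on_eq_continuous_within)
    then have "\<forall>\<^sub>F x in at s within {x\<in>?I. c x \<in> fst \<phi>}. dist (z' x) (z' s) < 1"
      by (intro tendstoD) (auto simp: continuous_within)
    then have "\<forall>\<^sub>F x in at s within ?I. c x \<in> fst \<phi> \<longrightarrow> dist (z' x) (z' s) < 1"
      unfolding eventually_at_filter by (rule eventually_mono) auto
    with ev show "\<forall>\<^sub>F x in at s within ?I. norm (z' x) < K"
    proof eventually_elim
      case (elim x)
      then have "norm (z' x - z' s) < 1" by (simp add: dist_norm)
      moreover have "norm (z' x) \<le> norm (z' s) + norm (z' x - z' s)" by (rule norm_triangle_sub)
      ultimately show ?case by (simp add: K_def)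
    qed
  qed
  then obtain d where d: "0 < d" "\<And>x. x \<in> ?I \<Longrightarrow> x \<noteq> s \<Longrightarrow> dist x s < d \<Longrightarrow>
      c x \<in> fst \<phi> \<and> \<bar>\<tau> x - t0\<bar> < \<rho> \<and> dist (z x) z0 < \<rho> \<and> norm (z' x) < K"
    unfolding eventually_at by blast
  have loc: "c x \<in> fst \<phi>" "\<bar>\<tau> x - t0\<bar> < \<rho>" "dist (z x) z0 < \<rho>" "norm (z' x) < K"
    if "x \<in> ?I" "\<bar>x - s\<bar> < d" for x
    using d(2)[of x] that cs \<rho> by (cases "x = s"; auto simp: dist_real_def t0_def z0_def K_def)+
  show thesis
  proof
    fix x y assume xy: "s0 \<le> x" "x \<le> s" "s \<le> y" "y \<le> s1" "y - x < d"
    have "x \<le> y" using xy by simp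
    have sub: "{x..y} \<subseteq> ?I" using xy by auto
    have loc: "c w \<in> fst \<phi>" "\<bar>\<tau> w - t0\<bar> < \<rho>" "dist (z w) z0 < \<rho>" "norm (z' w) \<le> K"
      if "w \<in> {x..y}" for w
      using loc[of w] that xy sub by (auto simp: abs_less_iff)
    define \<Delta>z where "\<Delta>z = z y - z x"
    define \<Delta>\<tau> where "\<Delta>\<tau> = \<tau> y - \<tau> x"
    have iz: "(z' has_integral \<Delta>z) {x..y}"
      unfolding \<Delta>z_def
    proof (rule fundamental_theorem_of_calculus[OF \<open>x \<le> y\<close>])
      fix w assume w: "w \<in> {x..y}"
      have "(snd \<phi> \<circ> c has_vector_derivative v w \<phi>) (at w within ?I)"
        using loc(1)[OF w] w sub \<phi>A by (intro C1_curve_has_velocity[OF c s01]) (auto simp: charts_at_def)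
      then show "(z has_vector_derivative z' w) (at w within {x..y})"
        using sub unfolding z_def[abs_def] z'_def o_def by (rule has_vector_derivative_within_subset)
    qed
    have i\<tau>: "(\<tau>' has_integral \<Delta>\<tau>) {x..y}"
      unfolding \<Delta>\<tau>_def
      by (rule fundamental_theorem_of_calculus[OF \<open>x \<le> y\<close>])
        (rule has_vector_derivative_within_subset[OF \<tau>_deriv sub], use sub in blast)
    have iE: "(E l has_integral integral {x..y} (E l)) {x..y}"
      by (intro integrable_integral integrable_continuous_real continuous_on_subset[OF E_cont] sub)
    have iN: "(N has_integral integral {x..y} N) {x..y}"
      by (intro integrable_integral integrable_continuous_real continuous_on_subset[OF N_cont] sub)
    have const: "((\<lambda>_. k) has_integral k * (y - x)) {x..y}" for k :: real
      using has_integral_const_real[of k x y] \<open>x \<le> y\<close> by (simp add: mult.commute)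
    have \<Delta>\<tau>: "0 \<le> \<Delta>\<tau>" "\<Delta>\<tau> \<le> K' * (y - x)"
      using has_integral_nonneg[OF i\<tau>] has_integral_le[OF i\<tau> const] causal_components(1) K'(2) sub
      by auto
    have \<Delta>z: "norm \<Delta>z \<le> K * (y - x)"
      using has_integral_bound[OF _ iz[folded box_real(2)]] K loc(4) \<open>x \<le> y\<close> by simp
    have NC: "integral {x..y} N \<le> C * (y - x)"
      using has_integral_le[OF iN const] C(2) sub by auto
    have bl_left: "bounded_linear (\<lambda>e. a0 e u)" for u
      using bl by (simp add: bilinear_def linear_conv_bounded_linear)
    \<comment> \<open>\<open>u\<close> is left free: it is chosen only after integration. The first
      inequality will bound the kinetic term of the segment, the second the action itself.\<close>
    have point: "(1 - \<delta>) * (a0 (z' w) u - \<tau>' w * (a0 u u / 2)) \<le> N w"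
      "b0 (z' w) - V0 * \<tau>' w - \<delta> * (K + K') + (1 - \<delta>) * (a0 (z' w) u - \<tau>' w * (a0 u u / 2)) \<le> E l w"
      if w: "w \<in> {x..y}" for w u
    proof -
      have wI: "w \<in> ?I" using w sub by blast
      note cm = causal_components[OF wI] and vt = v_tangent[OF wI]
      have ch: "\<phi> \<in> charts_at A (c w)" using loc(1)[OF w] \<phi>A by (simp add: charts_at_def)
      note nw = near[OF loc(2)[OF w] loc(3)[OF w]]
      have "av w = a_coord \<phi> (\<tau> w) (z w) (z' w) (z' w)"
        unfolding av_def z_def z'_def by (rule a_eq_coord[OF ch vt vt])
      then have av: "(1 - \<delta>) * a0 (z' w) (z' w) \<le> av w"
        using nw by (simp add: abs_le_iff algebra_simps)
      have bw: "b0 (z' w) - \<delta> * K \<le> b (\<tau> w) (c w) (v w)"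
      proof -
        have "b (\<tau> w) (c w) (v w) = b_coord \<phi> (\<tau> w) (z w) (z' w)"
          unfolding z_def z'_def by (rule b_eq_coord[OF ch vt])
        moreover have "\<bar>b_coord \<phi> (\<tau> w) (z w) (z' w) - b0 (z' w)\<bar> \<le> \<delta> * norm (z' w)" using nw by blast
        moreover have "\<delta> * norm (z' w) \<le> \<delta> * K" using loc(4)[OF w] \<delta> by (intro mult_left_mono) auto
        ultimately show ?thesis by linarith
      qed
      have Vw: "V (\<tau> w) (c w) * \<tau>' w \<le> V0 * \<tau>' w + \<delta> * K'"
      proof -
        have "V (\<tau> w) (c w) \<le> V0 + \<delta>" using nw V_eq_coord[OF ch, of "\<tau> w"] by (simp add: z_def abs_le_iff)
        then have "V (\<tau> w) (c w) * \<tau>' w \<le> (V0 + \<delta>) * \<tau>' w" using cm(1) by (rule mult_right_mono)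
        moreover have "\<delta> * \<tau>' w \<le> \<delta> * K'" using K'(2)[OF wI] \<delta> by (intro mult_left_mono) auto
        ultimately show ?thesis by (simp add: algebra_simps)
      qed
      let ?Y = "a0 (z' w) u - \<tau>' w * (a0 u u / 2)"
      have key: "(1 - \<delta>) * ?Y \<le> N w \<and> (1 - \<delta>) * ?Y \<le> N w + 2 * l\<^sup>2 * \<tau>' w - 2 * l * sqrt (2 * \<tau>' w * N w - av w)"
      proof (cases "\<tau>' w = 0")
        case True
        \<comment> \<open>Where \<tau>' = 0, causality squeezes \<open>av w\<close> to 0, so the
          velocity in Q vanishes too and every minorant is 0.\<close>
        have "0 \<le> av w" unfolding av_def by (rule a_nonneg[OF \<tau>_T[OF wI] vt])
        then have av0: "av w = 0" using cm(3) True by simp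
        then have "a0 (z' w) (z' w) \<le> 0" using av \<delta> by (simp add: mult_le_0_iff)
        then have "z' w = 0" using a0_pos[of "z' w"] by fastforce
        then have "?Y = 0" using True bilinear_lzero[OF bl] by simp
        then show ?thesis using True av0 cm(2) by simp
      next
        case False
        then have \<tau>': "0 < \<tau>' w" using cm(1) by simp
        have "0 \<le> a0 (z' w - \<tau>' w *\<^sub>R u) (z' w - \<tau>' w *\<^sub>R u)" by (rule a0_nonneg)
        also have "\<dots> = a0 (z' w) (z' w) - 2 * \<tau>' w * ?Y"
          by (simp add: bilinear_lsub[OF bl] bilinear_rsub[OF bl] bilinear_lmul[OF bl]
              bilinear_rmul[OF bl] a0_sym[of u "z' w"] algebra_simps)
        finally have "(1 - \<delta>) * (2 * \<tau>' w * ?Y) \<le> (1 - \<delta>) * a0 (z' w) (z' w)"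
          using \<delta> by (intro mult_left_mono) auto
        then have "(1 - \<delta>) * (2 * \<tau>' w * ?Y) \<le> av w" using av by simp
        then have "(1 - \<delta>) * ?Y \<le> av w / (2 * \<tau>' w)" using \<tau>' by (simp add: field_simps)
        moreover have "av w / (2 * \<tau>' w) \<le> N w" using \<tau>' cm(3) by (simp add: field_simps)
        moreover have "2 * l * sqrt (2 * \<tau>' w * N w - av w) \<le> 2 * l\<^sup>2 * \<tau>' w + (N w - av w / (2 * \<tau>' w))"
          by (rule two_mult_sqrt_le[OF \<tau>' l cm(3)])
        ultimately show ?thesis by linarith
      qed
      then show "(1 - \<delta>) * ?Y \<le> N w" by blast
      have "E l w = N w + b (\<tau> w) (c w) (v w) - V (\<tau> w) (c w) * \<tau>' w
          + 2 * l\<^sup>2 * \<tau>' w - 2 * l * sqrt (2 * \<tau>' w * N w - av w)"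
        by (simp add: E_def N_def)
      then show "b0 (z' w) - V0 * \<tau>' w - \<delta> * (K + K') + (1 - \<delta>) * ?Y \<le> E l w"
        using key bw Vw by (simp only: distrib_left) linarith
    qed
    have iY: "((\<lambda>w. (1 - \<delta>) * (a0 (z' w) u - \<tau>' w * (a0 u u / 2))) has_integral
        (1 - \<delta>) * (a0 \<Delta>z u - \<Delta>\<tau> * (a0 u u / 2))) {x..y}" for u
      using has_integral_linear[OF iz bl_left[of u]]
      by (intro has_integral_mult_right has_integral_diff has_integral_mult_left i\<tau>) (simp add: o_def)
    have N_ge: "(1 - \<delta>) * (a0 \<Delta>z u - \<Delta>\<tau> * (a0 u u / 2)) \<le> C * (y - x)" for u
      using has_integral_le[OF iY iN point(1)] NC by (rule order_trans)
    have E_ge: "b0 \<Delta>z - V0 * \<Delta>\<tau> - \<delta> * (K + K') * (y - x) + (1 - \<delta>) * (a0 \<Delta>z u - \<Delta>\<tau> * (a0 u u / 2))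
        \<le> integral {x..y} (E l)" for u
    proof (rule has_integral_le[OF _ iE point(2)])
      have "((\<lambda>w. b0 (z' w)) has_integral b0 \<Delta>z) {x..y}"
        using has_integral_linear[OF iz] lin by (simp add: o_def linear_conv_bounded_linear)
      then show "((\<lambda>w. b0 (z' w) - V0 * \<tau>' w - \<delta> * (K + K') + (1 - \<delta>) * (a0 (z' w) u - \<tau>' w * (a0 u u / 2)))
        has_integral b0 \<Delta>z - V0 * \<Delta>\<tau> - \<delta> * (K + K') * (y - x) + (1 - \<delta>) * (a0 \<Delta>z u - \<Delta>\<tau> * (a0 u u / 2))) {x..y}"
        by (intro has_integral_add has_integral_diff const iY has_integral_mult_right i\<tau>)
    qed
    have err: "\<delta> * D * (y - x) \<le> \<eta> * (y - x)" using \<delta>(3) \<open>x \<le> y\<close> by (intro mult_right_mono) auto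
    have "0 \<le> \<delta> * C * (y - x)" "0 \<le> \<delta> * (K + K') * (y - x)"
      using \<delta> C(1) K K'(1) \<open>x \<le> y\<close> by auto
    note nonneg = this
    have D_split: "\<delta> * D * (y - x) = 4 * (\<delta> * C * (y - x)) + 2 * (\<delta> * (K + K') * (y - x))"
      by (simp add: D_def algebra_simps)
    have xI: "x \<in> {x..y}" and yI: "y \<in> {x..y}" using \<open>x \<le> y\<close> by auto
    have inv: "chart_inv \<phi> (z w) = c w" if "w \<in> {x..y}" for w
      using loc(1)[OF that] \<phi>A by (simp add: z_def)
    show "S (\<tau> x, c x) (\<tau> y, c y) \<le> ereal (integral {x..y} (E l) + \<eta> * (y - x))"
    proof (cases "\<Delta>\<tau> = 0")
      case True
      \<comment> \<open>Without elapsed time there is no displacement in Q: \<open>N_ge\<close>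
        holds for all multiples of \<Delta>z, and \<open>k\<close> is the multiple for which it
        would read C (y - x) + 1 \<le> C (y - x).\<close>
      have "a0 \<Delta>z \<Delta>z \<le> 0"
      proof (rule ccontr)
        assume "\<not> a0 \<Delta>z \<Delta>z \<le> 0"
        then have pos: "0 < (1 - \<delta>) * a0 \<Delta>z \<Delta>z" using \<delta> by simp
        define k where "k = (C * (y - x) + 1) / ((1 - \<delta>) * a0 \<Delta>z \<Delta>z)"
        have "(1 - \<delta>) * (k * a0 \<Delta>z \<Delta>z) \<le> C * (y - x)"
          using N_ge[of "k *\<^sub>R \<Delta>z"] True by (simp add: bilinear_rmul[OF bl])
        moreover have "k * ((1 - \<delta>) * a0 \<Delta>z \<Delta>z) = C * (y - x) + 1"
          unfolding k_def using pos by (metis less_irrefl nonzero_eq_divide_eq)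
        then have "(1 - \<delta>) * (k * a0 \<Delta>z \<Delta>z) = C * (y - x) + 1" by (simp only: mult_ac)
        ultimately show False by simp
      qed
      then have "\<Delta>z = 0" using a0_pos[of \<Delta>z] by fastforce
      then have "c x = c y" using inv[OF xI] inv[OF yI] by (simp add: \<Delta>z_def)
      then have "S (\<tau> x, c x) (\<tau> y, c y) = 0" using True by (simp add: \<Delta>\<tau>_def least_action_refl)
      moreover have "- (\<delta> * (K + K') * (y - x)) \<le> integral {x..y} (E l)"
        using E_ge[of 0] True \<open>\<Delta>z = 0\<close> bilinear_lzero[OF bl] linear_0[OF lin] by simp
      ultimately show ?thesis using err nonneg D_split by simp
    next
      case False
      then have \<Delta>\<tau>0: "0 < \<Delta>\<tau>" using \<Delta>\<tau>(1) by simp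
      then have lt: "\<tau> x < \<tau> y" by (simp add: \<Delta>\<tau>_def)
      define u where "u = inverse \<Delta>\<tau> *\<^sub>R \<Delta>z"
      have \<Delta>zu: "\<Delta>z = \<Delta>\<tau> *\<^sub>R u" using False by (simp add: u_def)
      define X where "X = \<Delta>\<tau> * (a0 u u / 2)"
      have Y: "a0 \<Delta>z u - \<Delta>\<tau> * (a0 u u / 2) = X" by (simp add: X_def \<Delta>zu bilinear_lmul[OF bl])
      have X0: "0 \<le> X" using \<Delta>\<tau>(1) a0_nonneg by (simp add: X_def)
      \<comment> \<open>\<open>u\<close> has no bound independent of the endpoints, as
        \<Delta>\<tau> may be tiny, but \<open>X\<close> is at most 2 C (y - x) because the minorant
        lies below \<open>N\<close>. Hence the error 2 \<delta> \<open>X\<close> is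
        negligible.\<close>
      have "X / 2 \<le> (1 - \<delta>) * X" using X0 \<delta>(2) mult_right_mono[of "1/2" "1 - \<delta>" X] by simp
      then have XC: "X \<le> 2 * (C * (y - x))" using N_ge[of u] unfolding Y by simp
      define M where "M = (1 + \<delta>) * (a0 u u / 2) + b0 u + \<delta> * norm u - V0 + \<delta>"
      have seg: "\<bar>t - t0\<bar> < \<rho> \<and> dist (z x + (t - \<tau> x) *\<^sub>R u) z0 < \<rho>" if t: "t \<in> {\<tau> x..\<tau> y}" for t
      proof
        show "\<bar>t - t0\<bar> < \<rho>" using loc(2)[OF xI] loc(2)[OF yI] t by (auto simp: abs_less_iff)
        \<comment> \<open>Points of the segment are convex combinations of its ends, and balls are
          convex, so the segment stays where the coefficients are nearly frozen.\<close>
        define k where "k = (t - \<tau> x) / \<Delta>\<tau>"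
        have k: "0 \<le> k" "k \<le> 1" using t \<Delta>\<tau>0 by (auto simp: k_def \<Delta>\<tau>_def)
        have "z x + (t - \<tau> x) *\<^sub>R u = (1 - k) *\<^sub>R z x + k *\<^sub>R z y"
          by (simp add: k_def u_def \<Delta>z_def algebra_simps divide_inverse)
        moreover have "(1 - k) *\<^sub>R z x + k *\<^sub>R z y \<in> ball z0 \<rho>"
          using loc(3)[OF xI] loc(3)[OF yI] k
          by (intro convexD[OF convex_ball]) (auto simp: dist_commute)
        ultimately show "dist (z x + (t - \<tau> x) *\<^sub>R u) z0 < \<rho>" by (simp add: dist_commute)
      qed
      have "S (\<tau> x, chart_inv \<phi> (z x)) (\<tau> y, chart_inv \<phi> (z x + (\<tau> y - \<tau> x) *\<^sub>R u))
          \<le> ereal (M * (\<tau> y - \<tau> x))"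
      proof (rule action_segment_le[OF \<phi>A lt])
        fix t assume "t \<in> {\<tau> x..\<tau> y}"
        from seg[OF this] have n: "\<bar>t - t0\<bar> < \<rho>" "dist (z x + (t - \<tau> x) *\<^sub>R u) z0 < \<rho>" by auto
        let ?z = "z x + (t - \<tau> x) *\<^sub>R u"
        show "t \<in> T \<and> ?z \<in> snd \<phi> ` fst \<phi>" using near[OF n] by blast
        have "\<bar>a_coord \<phi> t ?z u u - a0 u u\<bar> \<le> \<delta> * a0 u u" "\<bar>b_coord \<phi> t ?z u - b0 u\<bar> \<le> \<delta> * norm u"
          "\<bar>V t (chart_inv \<phi> ?z) - V0\<bar> \<le> \<delta>" using near[OF n] by auto
        then show "a_coord \<phi> t ?z u u / 2 + b_coord \<phi> t ?z u - V t (chart_inv \<phi> ?z) \<le> M"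
          unfolding M_def by (simp add: abs_le_iff algebra_simps add_divide_distrib)
      qed
      moreover have "z x + (\<tau> y - \<tau> x) *\<^sub>R u = z y"
        using \<Delta>zu by (simp add: \<Delta>z_def \<Delta>\<tau>_def algebra_simps)
      ultimately have "S (\<tau> x, c x) (\<tau> y, c y) \<le> ereal (M * \<Delta>\<tau>)"
        by (simp add: inv[OF xI] inv[OF yI] \<Delta>\<tau>_def)
      moreover have "M * \<Delta>\<tau> \<le> integral {x..y} (E l) + \<eta> * (y - x)"
      proof -
        have "M * \<Delta>\<tau> = (1 + \<delta>) * X + b0 \<Delta>z + \<delta> * norm \<Delta>z - V0 * \<Delta>\<tau> + \<delta> * \<Delta>\<tau>"
          using \<Delta>\<tau>0 by (simp add: M_def X_def \<Delta>zu linear_cmul[OF lin] algebra_simps)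
        moreover have "\<delta> * norm \<Delta>z + \<delta> * \<Delta>\<tau> \<le> \<delta> * (K + K') * (y - x)"
        proof -
          have "\<delta> * (norm \<Delta>z + \<Delta>\<tau>) \<le> \<delta> * (K * (y - x) + K' * (y - x))"
            using \<Delta>z \<Delta>\<tau>(2) \<delta> by (intro mult_left_mono add_mono) auto
          then show ?thesis by (simp add: algebra_simps)
        qed
        moreover have "(1 + \<delta>) * X \<le> (1 - \<delta>) * X + 4 * (\<delta> * C * (y - x))"
        proof -
          have "2 * \<delta> * X \<le> 2 * \<delta> * (2 * (C * (y - x)))" using XC \<delta> by (intro mult_left_mono) auto
          then show ?thesis by (simp add: algebra_simps)
        qed
        ultimately show ?thesis using E_ge[of u] err unfolding Y D_split by linarith
      qed
      ultimately show ?thesis using order_trans by fastforce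
    qed
  qed (fact d(1))
qed

text \<open>The local estimate is compatible with concatenation: \<open>S\<close> by the triangle
  inequality, the integral and the error \<eta> (y - x) by additivity. Subdivision therefore extends
  it to the whole piece with total error \<epsilon>.\<close>

lemma least_action_le_E:
  assumes l: "0 < l"
  shows "S (\<tau> s0, c s0) (\<tau> s1, c s1) \<le> ereal (integral {s0..s1} (E l))"
proof (rule ereal_le_epsilon2)
  fix \<epsilon> :: real assume "0 < \<epsilon>"
  define \<eta> where "\<eta> = \<epsilon> / (s1 - s0)"
  have \<eta>: "0 < \<eta>" using \<open>0 < \<epsilon>\<close> s01 by (simp add: \<eta>_def)
  have "s0 \<le> s0 \<longrightarrow> s1 \<le> s1 \<longrightarrow> S (\<tau> s0, c s0) (\<tau> s1, c s1) \<le> ereal (integral {s0..s1} (E l) + \<eta> * (s1 - s0))"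
  \<comment> \<open>\<open>Bolzano\<close> speaks of arbitrary real intervals; the two implications
    confine the property to subintervals of the piece.\<close>
  proof (rule Bolzano[where P = "\<lambda>x y. s0 \<le> x \<longrightarrow> y \<le> s1 \<longrightarrow>
        S (\<tau> x, c x) (\<tau> y, c y) \<le> ereal (integral {x..y} (E l) + \<eta> * (y - x))"])
    fix x y w
    assume xy: "s0 \<le> x \<longrightarrow> y \<le> s1 \<longrightarrow> S (\<tau> x, c x) (\<tau> y, c y) \<le> ereal (integral {x..y} (E l) + \<eta> * (y - x))"
      and yw: "s0 \<le> y \<longrightarrow> w \<le> s1 \<longrightarrow> S (\<tau> y, c y) (\<tau> w, c w) \<le> ereal (integral {y..w} (E l) + \<eta> * (w - y))"
      and le: "x \<le> y" "y \<le> w"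
    show "s0 \<le> x \<longrightarrow> w \<le> s1 \<longrightarrow> S (\<tau> x, c x) (\<tau> w, c w) \<le> ereal (integral {x..w} (E l) + \<eta> * (w - x))"
    proof (intro impI)
      assume *: "s0 \<le> x" "w \<le> s1"
      have "S (\<tau> x, c x) (\<tau> w, c w) \<le> ereal ((integral {x..y} (E l) + \<eta> * (y - x)) + (integral {y..w} (E l) + \<eta> * (w - y)))"
        by (rule least_action_triangle[OF \<tau>_T \<tau>_T]) (use * le xy yw in auto)
      moreover have "integral {x..y} (E l) + integral {y..w} (E l) = integral {x..w} (E l)"
        by (intro Henstock_Kurzweil_Integration.integral_combine integrable_continuous_real continuous_on_subset[OF E_cont] le)
          (use * in auto)
      ultimately show "S (\<tau> x, c x) (\<tau> w, c w) \<le> ereal (integral {x..w} (E l) + \<eta> * (w - x))"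
        by (simp add: algebra_simps)
    qed
  next
    fix s assume "s0 \<le> s" "s \<le> s1"
    then have "s \<in> {s0..s1}" by simp
    from local_estimate[OF l this \<eta>] obtain d where "0 < d" "\<And>x y. s0 \<le> x \<Longrightarrow> x \<le> s \<Longrightarrow> s \<le> y \<Longrightarrow> y \<le> s1 \<Longrightarrow> y - x < d \<Longrightarrow>
      S (\<tau> x, c x) (\<tau> y, c y) \<le> ereal (integral {x..y} (E l) + \<eta> * (y - x))" by blast
    then show "\<exists>d>0. \<forall>x y. x \<le> s \<and> s \<le> y \<and> y - x < d \<longrightarrow> s0 \<le> x \<longrightarrow> y \<le> s1 \<longrightarrow>
      S (\<tau> x, c x) (\<tau> y, c y) \<le> ereal (integral {x..y} (E l) + \<eta> * (y - x))" by blast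
  qed (use s01 in simp)
  then show "S (\<tau> s0, c s0) (\<tau> s1, c s1) \<le> ereal (integral {s0..s1} (E l)) + ereal \<epsilon>"
    using s01 by (simp add: \<eta>_def)
qed

lemma least_action_le_length:
  assumes "0 < l"
  shows "(\<lambda>s. sqrt (2 * \<tau>' s * N s - av s)) integrable_on {s0..s1}"
    and "S (\<tau> s0, c s0) (\<tau> s1, c s1) \<le> ereal (\<upsilon> s1 - \<upsilon> s0 + 2 * l\<^sup>2 * (\<tau> s1 - \<tau> s0)
      - 2 * l * integral {s0..s1} (\<lambda>s. sqrt (2 * \<tau>' s * N s - av s)))"
proof -
  let ?f = "\<lambda>s. sqrt (2 * \<tau>' s * N s - av s)"
  show i: "?f integrable_on {s0..s1}"
    by (intro integrable_continuous_real continuous_intros \<tau>'_cont N_cont av_cont)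
  have "(E l has_integral (\<upsilon> s1 - \<upsilon> s0) + 2 * l\<^sup>2 * (\<tau> s1 - \<tau> s0) - 2 * l * integral {s0..s1} ?f) {s0..s1}"
    unfolding E_def
    using fundamental_theorem_of_calculus[of s0 s1 \<upsilon> \<upsilon>', OF _ \<upsilon>_deriv]
      fundamental_theorem_of_calculus[of s0 s1 \<tau> \<tau>', OF _ \<tau>_deriv] s01
    by (intro has_integral_add has_integral_diff has_integral_mult_right integrable_integral i) auto
  then show "S (\<tau> s0, c s0) (\<tau> s1, c s1) \<le> ereal (\<upsilon> s1 - \<upsilon> s0 + 2 * l\<^sup>2 * (\<tau> s1 - \<tau> s0) - 2 * l * integral {s0..s1} ?f)"
    using least_action_le_E[OF assms] by (simp add: integral_unique)
qed

end

section \<open>The distance in terms of the action\<close>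

context gw_spacetime
begin

lemma C1_real_vector_derivative:
  assumes "C1_real {\<alpha>..\<beta>} f" "\<alpha> < \<beta>"
  shows "continuous_on {\<alpha>..\<beta>} (\<lambda>s. vector_derivative f (at s within {\<alpha>..\<beta>}))"
    and "s \<in> {\<alpha>..\<beta>} \<Longrightarrow>
      (f has_vector_derivative vector_derivative f (at s within {\<alpha>..\<beta>})) (at s within {\<alpha>..\<beta>})"
proof -
  from assms(1) obtain D where D: "continuous_on {\<alpha>..\<beta>} D"
    "\<And>s. s \<in> {\<alpha>..\<beta>} \<Longrightarrow> (f has_vector_derivative D s) (at s within {\<alpha>..\<beta>})"
    unfolding C1_real_def by blast
  have eq: "vector_derivative f (at s within {\<alpha>..\<beta>}) = D s" if "s \<in> {\<alpha>..\<beta>}" for s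
    by (rule vector_derivative_within_closed_interval[OF assms(2) that D(2)[OF that]])
  show "continuous_on {\<alpha>..\<beta>} (\<lambda>s. vector_derivative f (at s within {\<alpha>..\<beta>}))"
    by (rule continuous_on_eq[OF D(1)]) (simp add: eq)
  show "(f has_vector_derivative vector_derivative f (at s within {\<alpha>..\<beta>})) (at s within {\<alpha>..\<beta>})"
    if "s \<in> {\<alpha>..\<beta>}" using D(2)[OF that] eq[OF that] by simp
qed

abbreviation speed :: "real set \<Rightarrow> (real \<Rightarrow> 'q event) \<Rightarrow> real \<Rightarrow> real" where
  "speed I \<gamma> s \<equiv> sqrt (- gw_metric a b V (\<gamma> s) (velocity_M A I \<gamma> s) (velocity_M A I \<gamma> s))"

abbreviation t_of :: "'q event \<Rightarrow> real" where "t_of x \<equiv> fst x"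
abbreviation e_of :: "'q event \<Rightarrow> real \<times> 'q" where "e_of x \<equiv> (fst x, fst (snd x))"
abbreviation y_of :: "'q event \<Rightarrow> real" where "y_of x \<equiv> snd (snd x)"

lemma least_action_le_length_piece:
  assumes "\<alpha> < \<beta>" "C1_curve_M A T {\<alpha>..\<beta>} \<gamma>"
    and fd: "\<And>s. s \<in> {\<alpha>..\<beta>} \<Longrightarrow> fd_causal a b V (\<gamma> s) (velocity_M A {\<alpha>..\<beta>} \<gamma> s)" and "0 < l"
  shows "speed {\<alpha>..\<beta>} \<gamma> integrable_on {\<alpha>..\<beta>}"
    and "S (e_of (\<gamma> \<alpha>)) (e_of (\<gamma> \<beta>)) \<le> ereal (y_of (\<gamma> \<beta>) - y_of (\<gamma> \<alpha>)
      + 2 * l\<^sup>2 * (t_of (\<gamma> \<beta>) - t_of (\<gamma> \<alpha>)) - 2 * l * integral {\<alpha>..\<beta>} (speed {\<alpha>..\<beta>} \<gamma>))"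
proof -
  let ?I = "{\<alpha>..\<beta>}"
  let ?\<tau> = "\<lambda>s. fst (\<gamma> s)" and ?c = "\<lambda>s. fst (snd (\<gamma> s))" and ?\<upsilon> = "\<lambda>s. snd (snd (\<gamma> s))"
  have C1: "C1_real ?I ?\<tau>" "C1_curve A ?I ?c" "C1_real ?I ?\<upsilon>" "\<And>s. s \<in> ?I \<Longrightarrow> ?\<tau> s \<in> T"
    using assms(2) by (auto simp: C1_curve_M_def)
  interpret p: causal_C1_piece k A r T a b V \<alpha> \<beta> ?\<tau> "\<lambda>s. vector_derivative ?\<tau> (at s within ?I)"
    ?\<upsilon> "\<lambda>s. vector_derivative ?\<upsilon> (at s within ?I)" ?c
    by unfold_locales (use C1 C1_real_vector_derivative assms(1) fd in \<open>auto simp: velocity_M_def\<close>)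
  have eq: "speed ?I \<gamma> s = sqrt (2 * vector_derivative ?\<tau> (at s within ?I) * p.N s - p.av s)"
    if "s \<in> ?I" for s
    using p.minus_metric_eq[OF that] by (simp add: velocity_M_def)
  show "speed ?I \<gamma> integrable_on ?I"
    by (rule integrable_eq[OF p.least_action_le_length(1)[OF assms(4)]]) (use eq in simp)
  have "integral ?I (speed ?I \<gamma>)
      = integral ?I (\<lambda>s. sqrt (2 * vector_derivative ?\<tau> (at s within ?I) * p.N s - p.av s))"
    by (rule integral_cong) (rule eq)
  then show "S (e_of (\<gamma> \<alpha>)) (e_of (\<gamma> \<beta>)) \<le> ereal (y_of (\<gamma> \<beta>) - y_of (\<gamma> \<alpha>)
      + 2 * l\<^sup>2 * (t_of (\<gamma> \<beta>) - t_of (\<gamma> \<alpha>)) - 2 * l * integral {\<alpha>..\<beta>} (speed {\<alpha>..\<beta>} \<gamma>))"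
    using p.least_action_le_length(2)[OF assms(4)] by simp
qed

text \<open>\<open>lorentz_length\<close> takes derivatives within the whole interval, causality
  takes them within the pieces. They may differ at the break points, which the integral does not
  see.\<close>

lemma velocity_M_interior:
  assumes "s \<in> {\<alpha><..<\<beta>}" "{\<alpha>..\<beta>} \<subseteq> {s0..s1}"
  shows "velocity_M A {s0..s1} \<gamma> s = velocity_M A {\<alpha>..\<beta>} \<gamma> s"
proof -
  have "at s within {s0..s1} = at s within {\<alpha>..\<beta>}"
    by (rule at_within_nhd[of _ "{\<alpha><..<\<beta>}"]) (use assms in auto)
  then show ?thesis unfolding velocity_M_def velocity_def by (rule arg_cong)
qed

text \<open>Induction over the break points. Integrability of the speed is carried along so that the
  integrals over the pieces add up to the length.\<close>

lemma least_action_le_lorentz_length: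
  assumes "fd_causal_curve A T a b V s0 s1 \<gamma>" "0 < l"
  shows "S (e_of (\<gamma> s0)) (e_of (\<gamma> s1)) \<le> ereal (y_of (\<gamma> s1) - y_of (\<gamma> s0)
      + 2 * l\<^sup>2 * (t_of (\<gamma> s1) - t_of (\<gamma> s0)) - 2 * l * lorentz_length A a b V s0 s1 \<gamma>)"
proof -
  let ?F = "speed {s0..s1} \<gamma>"
  obtain n \<sigma> where \<sigma>: "\<sigma> (0::nat) = s0" "\<sigma> n = s1"
    and piece: "\<And>i. i < n \<Longrightarrow> \<sigma> i < \<sigma> (Suc i) \<and> C1_curve_M A T {\<sigma> i..\<sigma> (Suc i)} \<gamma> \<and>
      (\<forall>s\<in>{\<sigma> i..\<sigma> (Suc i)}. fd_causal a b V (\<gamma> s) (velocity_M A {\<sigma> i..\<sigma> (Suc i)} \<gamma> s))"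
    using assms(1) unfolding fd_causal_curve_def by blast
  have mono: "\<sigma> i \<le> \<sigma> j" if "i \<le> j" "j \<le> n" for i j
    using that
  proof (induction rule: dec_induct)
    case (step m)
    then show ?case using piece[of m] by simp
  qed simp
  have T: "fst (\<gamma> (\<sigma> m)) \<in> T" if "m \<le> n" "0 < n" for m
  proof (cases "m < n")
    case True
    then show ?thesis using piece[of m] by (auto simp: C1_curve_M_def)
  next
    case False
    then show ?thesis using piece[of "n - 1"] that by (auto simp: C1_curve_M_def)
  qed
  have "?F integrable_on {\<sigma> 0..\<sigma> m} \<and>
    S (e_of (\<gamma> (\<sigma> 0))) (e_of (\<gamma> (\<sigma> m))) \<le> ereal (y_of (\<gamma> (\<sigma> m)) - y_of (\<gamma> (\<sigma> 0))
      + 2 * l\<^sup>2 * (t_of (\<gamma> (\<sigma> m)) - t_of (\<gamma> (\<sigma> 0))) - 2 * l * integral {\<sigma> 0..\<sigma> m} ?F)"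
    if "m \<le> n" for m
    using that
  proof (induction m)
    case 0
    have "?F integrable_on {\<sigma> 0..\<sigma> 0}" using integrable_on_refl[of ?F "\<sigma> 0"] by simp
    then show ?case by (simp add: least_action_refl)
  next
    case (Suc m)
    let ?J = "{\<sigma> m..\<sigma> (Suc m)}"
    have pm: "\<sigma> m < \<sigma> (Suc m)" "C1_curve_M A T ?J \<gamma>"
      "\<And>s. s \<in> ?J \<Longrightarrow> fd_causal a b V (\<gamma> s) (velocity_M A ?J \<gamma> s)"
      using piece[of m] Suc.prems by auto
    note P = least_action_le_length_piece[OF pm assms(2)]
    have sub: "?J \<subseteq> {s0..s1}"
      using mono[of 0 m] mono[of "Suc m" n] Suc.prems \<sigma> by auto
    have i: "(speed ?J \<gamma> has_integral integral ?J (speed ?J \<gamma>)) ?J"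
      using P(1) by (rule integrable_integral)
    have i2: "(?F has_integral integral ?J (speed ?J \<gamma>)) ?J"
      using has_integral_spike_interior[OF i[folded box_real(2)], of ?F]
      by (simp add: box_real velocity_M_interior[OF _ sub])
    have le: "\<sigma> 0 \<le> \<sigma> m" "\<sigma> m \<le> \<sigma> (Suc m)" using mono Suc.prems by auto
    have IH: "?F integrable_on {\<sigma> 0..\<sigma> m}" "S (e_of (\<gamma> (\<sigma> 0))) (e_of (\<gamma> (\<sigma> m))) \<le>
      ereal (y_of (\<gamma> (\<sigma> m)) - y_of (\<gamma> (\<sigma> 0))
      + 2 * l\<^sup>2 * (t_of (\<gamma> (\<sigma> m)) - t_of (\<gamma> (\<sigma> 0))) - 2 * l * integral {\<sigma> 0..\<sigma> m} ?F)"
      using Suc by auto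
    have i3: "(?F has_integral integral {\<sigma> 0..\<sigma> m} ?F + integral ?J (speed ?J \<gamma>)) {\<sigma> 0..\<sigma> (Suc m)}"
      by (rule has_integral_combine[OF le integrable_integral[OF IH(1)] i2])
    have "fst (\<gamma> (\<sigma> 0)) \<in> T" "fst (\<gamma> (\<sigma> (Suc m))) \<in> T" using T Suc.prems by auto
    from least_action_triangle[OF this IH(2) P(2)] have
      "S (e_of (\<gamma> (\<sigma> 0))) (e_of (\<gamma> (\<sigma> (Suc m)))) \<le> ereal (y_of (\<gamma> (\<sigma> (Suc m))) - y_of (\<gamma> (\<sigma> 0))
      + 2 * l\<^sup>2 * (t_of (\<gamma> (\<sigma> (Suc m))) - t_of (\<gamma> (\<sigma> 0)))
      - 2 * l * (integral {\<sigma> 0..\<sigma> m} ?F + integral ?J (speed ?J \<gamma>)))"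
      by (simp add: algebra_simps)
    then show ?case using i3 by (auto simp: integral_unique)
  qed
  from this[of n] show ?thesis unfolding \<sigma> by (simp add: lorentz_length_def Let_def)
qed

section \<open>From the action to the distance: lifted curves and the closed formula\<close>

lemma causal_lift:
  assumes t01: "t0 < t1" and T: "t0 \<in> T" "t1 \<in> T" and c: "C1_curve A {t0..t1} c"
    and less: "action A a b V t0 t1 c < y1 - y0"
  obtains \<gamma> where "fd_causal_curve A T a b V t0 t1 \<gamma>" "\<gamma> t0 = (t0, c t0, y0)" "\<gamma> t1 = (t1, c t1, y1)"
    "lorentz_length A a b V t0 t1 \<gamma> = sqrt (2 * (t1 - t0) * (y1 - y0 - action A a b V t0 t1 c))"
proof -
  let ?I = "{t0..t1}"
  let ?v = "velocity A ?I c"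
  \<comment> \<open>The constant for which the lift ends at \<open>y1\<close>. The lift has squared
    speed 2 \<kappa>, so the assumed strict inequality is what makes it timelike.\<close>
  define \<kappa> where "\<kappa> = (y1 - y0 - action A a b V t0 t1 c) / (t1 - t0)"
  have \<kappa>: "0 < \<kappa>" using t01 less by (simp add: \<kappa>_def)
  define L where "L s = lagrangian a b V s (c s) (?v s)" for s
  define y where "y s = y0 + integral {t0..s} (\<lambda>s. L s + \<kappa>)" for s
  define \<gamma> where "\<gamma> s = (s, c s, y s)" for s
  have Lc: "continuous_on ?I L" unfolding L_def by (rule continuous_on_lagrangian[OF c t01 T])
  have "continuous_on ?I (\<lambda>s. L s + \<kappa>)" by (intro continuous_intros Lc)
  note Lkc = this
  have y': "(y has_vector_derivative L s + \<kappa>) (at s within ?I)" if "s \<in> ?I" for s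
    unfolding y_def using integral_has_vector_derivative[OF Lkc that]
    by (auto intro!: derivative_eq_intros)
  have id': "((\<lambda>s. s) has_vector_derivative 1) (at s within ?I)" for s :: real
    by (rule has_vector_derivative_id)
  have vel: "velocity_M A ?I \<gamma> s = (1, ?v s, L s + \<kappa>)" if s: "s \<in> ?I" for s
    using vector_derivative_within_closed_interval[OF t01 s id']
      vector_derivative_within_closed_interval[OF t01 s y'[OF s]]
    by (simp add: velocity_M_def \<gamma>_def)
  have g: "gw_metric a b V (\<gamma> s) (1, ?v s, L s + \<kappa>) (1, ?v s, L s + \<kappa>) = - 2 * \<kappa>" for s
    by (simp add: gw_metric_def \<gamma>_def L_def lagrangian_def)
  have fd: "fd_causal a b V (\<gamma> s) (velocity_M A ?I \<gamma> s)" if s: "s \<in> ?I" for s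
  proof -
    have sT: "s \<in> T" using T_Icc[OF T] s by blast
    have vt: "?v s \<in> tangent_space A (c s)" by (rule C1_curve_velocity_tangent[OF c t01 s])
    have "a s (c s) (?v s) (\<lambda>_. 0) = 0" using a_scale(1)[OF sT vt vt, of 0] by simp
    moreover have "0 \<le> a s (c s) (?v s) (?v s)" by (rule a_nonneg[OF sT vt])
    ultimately have "gw_metric a b V (\<gamma> s) (1, ?v s, L s + \<kappa>) (time_orientation V (\<gamma> s)) < 0"
      using \<kappa> b_zero[OF sT, of "c s"]
      by (simp add: gw_metric_def \<gamma>_def time_orientation_def L_def lagrangian_def)
    then show ?thesis using g \<kappa> by (simp add: fd_causal_def vel[OF s])
  qed
  have C1: "C1_curve_M A T ?I \<gamma>"
  proof -
    have "C1_real ?I y" unfolding C1_real_def using Lkc y' by blast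
    moreover have "C1_real ?I (\<lambda>s. s)"
      unfolding C1_real_def using id' by (intro exI[of _ "\<lambda>_. 1"]) auto
    ultimately show ?thesis using T_Icc[OF T] c by (auto simp: C1_curve_M_def \<gamma>_def)
  qed
  show thesis
  proof
    show "fd_causal_curve A T a b V t0 t1 \<gamma>"
      unfolding fd_causal_curve_def using t01 C1 fd
      by (intro conjI exI[of _ 1] exI[of _ "\<lambda>i. if i = 0 then t0 else t1"]) auto
    show "\<gamma> t0 = (t0, c t0, y0)" by (simp add: \<gamma>_def y_def)
    have "integral ?I (\<lambda>s. L s + \<kappa>) = integral ?I L + integral ?I (\<lambda>_. \<kappa>)"
      by (intro integral_add integrable_continuous_real Lc continuous_on_const)
    also have "integral ?I L = action A a b V t0 t1 c" by (simp add: action_def L_def[abs_def])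
    finally have "y t1 = y1" using t01 by (simp add: y_def \<kappa>_def)
    then show "\<gamma> t1 = (t1, c t1, y1)" by (simp add: \<gamma>_def)
    have "lorentz_length A a b V t0 t1 \<gamma> = integral ?I (\<lambda>_. sqrt (2 * \<kappa>))"
      unfolding lorentz_length_def Let_def by (rule integral_cong) (simp add: vel g)
    also have "\<dots> = sqrt (2 * \<kappa>) * sqrt ((t1 - t0)\<^sup>2)" using t01 by simp
    also have "\<dots> = sqrt (2 * (t1 - t0) * (y1 - y0 - action A a b V t0 t1 c))"
      unfolding real_sqrt_mult[symmetric] using t01 by (simp add: \<kappa>_def power2_eq_square field_simps)
    finally show "lorentz_length A a b V t0 t1 \<gamma> = sqrt (2 * (t1 - t0) * (y1 - y0 - action A a b V t0 t1 c))" .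
  qed
qed

theorem lorentz_dist_eq:
  assumes t01: "t0 < t1" and T: "t0 \<in> T" "t1 \<in> T"
    and \<sigma>: "S (t0, q0) (t1, q1) = ereal \<sigma>" and less: "\<sigma> < y1 - y0"
  shows "lorentz_dist A T a b V (t0, q0, y0) (t1, q1, y1) = ereal (sqrt (2 * (t1 - t0) * (y1 - y0 - \<sigma>)))"
    (is "?d = ereal ?D")
proof (rule antisym)
  show "?d \<le> ereal ?D"
    unfolding lorentz_dist_def
  proof (rule Sup_least)
    fix x assume "x \<in> insert 0 {ereal (lorentz_length A a b V s0 s1 \<gamma>) | s0 s1 \<gamma>.
      fd_causal_curve A T a b V s0 s1 \<gamma> \<and> \<gamma> s0 = (t0, q0, y0) \<and> \<gamma> s1 = (t1, q1, y1)}"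
    then consider "x = 0" | s0 s1 \<gamma> where "x = ereal (lorentz_length A a b V s0 s1 \<gamma>)"
      "fd_causal_curve A T a b V s0 s1 \<gamma>" "\<gamma> s0 = (t0, q0, y0)" "\<gamma> s1 = (t1, q1, y1)" by blast
    then show "x \<le> ereal ?D"
    proof cases
      case 1
      then show ?thesis using t01 less by simp
    next
      case 2
      let ?len = "lorentz_length A a b V s0 s1 \<gamma>"
      \<comment> \<open>For this l both 2 l^2 (t1 - t0) and y1 - y0 - \<sigma> equal D l, so the
        additive bound becomes length \<le> D.\<close>
      define l where "l = ?D / (2 * (t1 - t0))"
      have D: "0 < ?D" using t01 less by simp
      have l: "0 < l" using D t01 unfolding l_def by (intro divide_pos_pos) auto
      have D2: "?D\<^sup>2 = 2 * (t1 - t0) * (y1 - y0 - \<sigma>)" using t01 less by simp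
      have Dl: "?D = 2 * (t1 - t0) * l" using t01 by (simp add: l_def)
      have "2 * (t1 - t0) * (?D * l) = ?D\<^sup>2" using Dl by (simp add: power2_eq_square)
      then have lD: "?D * l = y1 - y0 - \<sigma>" unfolding D2 using t01 by simp
      have l2: "2 * l\<^sup>2 * (t1 - t0) = ?D * l" unfolding Dl by (simp add: power2_eq_square)
      have "\<sigma> \<le> y1 - y0 + 2 * l\<^sup>2 * (t1 - t0) - 2 * l * ?len"
        using least_action_le_lorentz_length[OF 2(2) l] 2(3,4) \<sigma> by simp
      then have "?len * l \<le> ?D * l" unfolding l2 using lD by (simp add: mult.commute)
      then show ?thesis using l 2(1) by (simp del: real_sqrt_le_iff)
    qed
  qed
  show "ereal ?D \<le> ?d"
  proof (rule ccontr)
    assume "\<not> ereal ?D \<le> ?d"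
    then have "?d < ereal ?D" by simp
    moreover have d0: "0 \<le> ?d" unfolding lorentz_dist_def by (rule Sup_upper) simp
    ultimately obtain \<rho> where \<rho>: "?d = ereal \<rho>" "0 \<le> \<rho>" "\<rho> < ?D" by (cases ?d) auto
    have "\<rho>\<^sup>2 < 2 * (t1 - t0) * (y1 - y0 - \<sigma>)"
      using power_strict_mono[OF \<rho>(3,2), of 2] t01 less by simp
    \<comment> \<open>The infimum need not be attained. A curve with action below this threshold has
      a lift longer than \<rho>, because 2 (t1 - t0) (y1 - y0 - threshold) = \<rho>^2.\<close>
    then have "\<sigma> < y1 - y0 - \<rho>\<^sup>2 / (2 * (t1 - t0))" using t01 by (simp add: field_simps)
    then have "S (t0, q0) (t1, q1) < ereal (y1 - y0 - \<rho>\<^sup>2 / (2 * (t1 - t0)))" using \<sigma> by simp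
    from least_action_lessD[OF t01 this] obtain c where c: "C1_curve A {t0..t1} c" "c t0 = q0" "c t1 = q1"
      and act: "action A a b V t0 t1 c < y1 - y0 - \<rho>\<^sup>2 / (2 * (t1 - t0))" by blast
    have "0 \<le> \<rho>\<^sup>2 / (2 * (t1 - t0))" using t01 by simp
    then have "action A a b V t0 t1 c < y1 - y0" using act by simp
    from causal_lift[OF t01 T c(1) this] obtain \<gamma> where \<gamma>: "fd_causal_curve A T a b V t0 t1 \<gamma>"
      "\<gamma> t0 = (t0, q0, y0)" "\<gamma> t1 = (t1, q1, y1)"
      "lorentz_length A a b V t0 t1 \<gamma> = sqrt (2 * (t1 - t0) * (y1 - y0 - action A a b V t0 t1 c))"
      using c(2,3) by metis
    have "\<rho>\<^sup>2 < 2 * (t1 - t0) * (y1 - y0 - action A a b V t0 t1 c)" using act t01 by (simp add: field_simps)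
    then have "\<rho> < lorentz_length A a b V t0 t1 \<gamma>" unfolding \<gamma>(4) by (rule real_less_rsqrt)
    moreover have "ereal (lorentz_length A a b V t0 t1 \<gamma>) \<le> ?d"
      unfolding lorentz_dist_def using \<gamma> by (intro Sup_upper) blast
    ultimately show False using \<rho>(1) by simp
  qed
qed

section \<open>Raising indices with the metric of Q and with the spacetime metric\<close>

lemma riesz_a:
  assumes t: "t \<in> T" and p: "tvec_linear A q p"
  obtains u where "u \<in> tangent_space A q" "\<And>w. w \<in> tangent_space A q \<Longrightarrow> a t q u w = p w"
proof -
  obtain \<phi> where \<phi>: "\<phi> \<in> charts_at A q" by (rule ex_chart)
  then have \<phi>A: "\<phi> \<in> A" and q: "q \<in> fst \<phi>" by (auto simp: charts_at_def)
  let ?z = "snd \<phi> q"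
  have z: "?z \<in> snd \<phi> ` fst \<phi>" using q by simp
  let ?B = "a_coord \<phi> t ?z"
  note bl = bilinear_a_coord[OF \<phi>A z t]
  define P where "P e = p (chart_vec A \<phi> q e)" for e
  have P: "linear P" unfolding P_def by (rule tvec_linear_chart[OF p \<phi>])
  \<comment> \<open>The metric as an endomorphism of the model space: definiteness makes it
    injective, finite dimension then makes it surjective.\<close>
  define G where "G e = (\<Sum>i\<in>Basis. ?B e i *\<^sub>R i)" for e
  have G: "G e \<bullet> i = ?B e i" if "i \<in> Basis" for e i using that by (simp add: G_def)
  have Bsum: "?B e f = (\<Sum>i\<in>Basis. (f \<bullet> i) *\<^sub>R ?B e i)" for e f
  proof -
    have l: "linear (?B e)" using bl by (simp add: bilinear_def)
    have "?B e f = ?B e (\<Sum>i\<in>Basis. (f \<bullet> i) *\<^sub>R i)" by (simp add: euclidean_representation)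
    then show ?thesis by (simp add: linear_sum[OF l] linear_cmul[OF l])
  qed
  have "linear G"
    by (rule linearI; rule euclidean_eqI)
      (simp_all add: G inner_add_left bilinear_ladd[OF bl] bilinear_lmul[OF bl])
  moreover have "inj G"
    unfolding linear_injective_0[OF \<open>linear G\<close>]
  proof (intro allI impI)
    fix e assume "G e = 0"
    then have "?B e i = 0" if "i \<in> Basis" for i using G[OF that, of e] by simp
    then have "?B e e = 0" by (simp add: Bsum[of e e])
    then show "e = 0" using a_coord_pos[OF \<phi>A z t, of e] by fastforce
  qed
  ultimately have "surj G" by (rule eucl.linear_inj_imp_surj)
  then obtain e where e: "G e = (\<Sum>i\<in>Basis. P i *\<^sub>R i)" by (metis surjD)
  have B: "?B e i = P i" if "i \<in> Basis" for i using G[OF that, of e] that by (simp add: e)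
  have BP: "?B e f = P f" for f
  proof -
    have "?B e f = (\<Sum>i\<in>Basis. (f \<bullet> i) *\<^sub>R P i)" by (simp add: Bsum[of e f] B)
    also have "\<dots> = P (\<Sum>i\<in>Basis. (f \<bullet> i) *\<^sub>R i)" by (simp add: linear_sum[OF P] linear_cmul[OF P])
    finally show ?thesis by (simp add: euclidean_representation)
  qed
  show thesis
  proof
    show u: "chart_vec A \<phi> q e \<in> tangent_space A q" by (rule chart_vec_tangent[OF \<phi>])
    show "a t q (chart_vec A \<phi> q e) w = p w" if w: "w \<in> tangent_space A q" for w
      using BP[of "w \<phi>"] tangent_eq_chart_vec[OF w \<phi>]
      unfolding a_eq_coord[OF \<phi> u w] by (simp add: chart_vec_self[OF \<phi>] P_def)
  qed
qed

lemma a_zero_right: "t \<in> T \<Longrightarrow> v \<in> tangent_space A q \<Longrightarrow> a t q v (\<lambda>_. 0) = 0"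
  using a_scale(1)[of t v q v 0] by simp

text \<open>Uniqueness for the definite description in \<open>sharp\<close>: the difference of the
  two vectors, tested against itself, has norm 0.\<close>

lemma a_nondegenerate:
  assumes t: "t \<in> T" and u: "u \<in> tangent_space A q" and u': "u' \<in> tangent_space A q"
    and eq: "\<And>w. w \<in> tangent_space A q \<Longrightarrow> a t q u w = a t q u' w"
  shows "u = u'"
proof -
  let ?w = "\<lambda>\<phi>. u \<phi> + (-1) *\<^sub>R u' \<phi>"
  have w: "?w \<in> tangent_space A q" by (intro tangent_add tangent_scale u u')
  have "a t q ?w (\<lambda>\<phi>. v \<phi> + w \<phi>) = a t q ?w v + a t q ?w w"
    if "v \<in> tangent_space A q" "w \<in> tangent_space A q" for v w
    using a_linear[OF t w] that unfolding tvec_linear_def by blast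
  from this[OF u tangent_scale[OF u', of "-1"]]
  have "a t q ?w ?w = a t q ?w u + a t q ?w (\<lambda>\<phi>. (-1) *\<^sub>R u' \<phi>)" .
  also have "\<dots> = a t q u ?w - a t q u' ?w"
    using a_scale(1)[OF t w u', of "-1"] a_sym[OF t w u] a_sym[OF t w u'] by simp
  finally have "a t q ?w ?w = 0" using eq[OF w] by simp
  then have "?w = (\<lambda>_. 0)" using a_pos[OF t w] by fastforce
  then show ?thesis by (auto simp: fun_eq_iff)
qed

lemma sharp_eqI:
  assumes "u \<in> X" "\<And>w. w \<in> X \<Longrightarrow> h u w = \<alpha> w"
    and "\<And>u'. u' \<in> X \<Longrightarrow> (\<And>w. w \<in> X \<Longrightarrow> h u' w = h u w) \<Longrightarrow> u' = u"
  shows "sharp X h \<alpha> = u"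
  unfolding sharp_def
proof (rule the_equality)
  show "u \<in> X \<and> (\<forall>w\<in>X. h u w = \<alpha> w)" using assms(1,2) by blast
  show "u' = u" if "u' \<in> X \<and> (\<forall>w\<in>X. h u' w = \<alpha> w)" for u'
    using assms(3)[of u'] that assms(2) by metis
qed

lemma sharp_a:
  assumes t: "t \<in> T" and p: "tvec_linear A q p"
  shows "sharp (tangent_space A q) (a t q) p \<in> tangent_space A q"
    and "w \<in> tangent_space A q \<Longrightarrow> a t q (sharp (tangent_space A q) (a t q) p) w = p w"
proof -
  obtain u where u: "u \<in> tangent_space A q" "\<And>w. w \<in> tangent_space A q \<Longrightarrow> a t q u w = p w"
    using riesz_a[OF t p] by blast
  have "sharp (tangent_space A q) (a t q) p = u"
    by (rule sharp_eqI[where h = "a t q", OF u a_nondegenerate[OF t _ u(1)]])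
  note eq = this
  show "sharp (tangent_space A q) (a t q) p \<in> tangent_space A q"
    "w \<in> tangent_space A q \<Longrightarrow> a t q (sharp (tangent_space A q) (a t q) p) w = p w"
    unfolding eq using u by blast+
qed

text \<open>The inverse spacetime metric evaluated on the covector \<mu> dt - \<kappa> p + \<kappa>
  dy, the shape of the differential of d. The Hamiltonian appears because the mixed terms of the
  metric shift p by b and its dt^2 term contributes V.\<close>

lemma gw_metric_sharp:
  fixes y :: real
  assumes t: "t \<in> T" and p: "tvec_linear A q p"
    and \<omega>: "\<And>w\<^sub>t w w\<^sub>y. w \<in> tangent_space A q \<Longrightarrow>
      \<omega> (w\<^sub>t, w, w\<^sub>y) = \<mu> * w\<^sub>t - \<kappa> * p w + \<kappa> * w\<^sub>y"
  defines "G \<equiv> sharp (tangent_space_M A (t, q, y)) (gw_metric a b V (t, q, y)) \<omega>"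
  shows "gw_metric a b V (t, q, y) G G = 2 * \<kappa>\<^sup>2 * hamiltonian A a b V t q p - 2 * \<kappa> * \<mu>"
proof -
  let ?X = "tangent_space A q"
  define u where "u = sharp ?X (a t q) (\<lambda>v. p v - b t q v)"
  have pb: "tvec_linear A q (\<lambda>v. p v - b t q v)"
    using p b_linear[OF t, of q] by (auto simp: tvec_linear_def algebra_simps)
  have u: "u \<in> ?X" "\<And>w. w \<in> ?X \<Longrightarrow> a t q u w = p w - b t q w"
    unfolding u_def using sharp_a[OF t pb] by auto
  let ?w = "\<lambda>\<phi>. (- \<kappa>) *\<^sub>R u \<phi>"
  have w: "?w \<in> ?X" by (rule tangent_scale[OF u(1)])
  \<comment> \<open>Found by solving the defining equation against the y-direction, then against
    vectors tangent to Q, then against the t-direction.\<close>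
  let ?G = "(- \<kappa>, ?w, b t q ?w + 2 * V t q * \<kappa> - \<mu>)"
  have "G = ?G"
    unfolding G_def
  proof (rule sharp_eqI)
    show "?G \<in> tangent_space_M A (t, q, y)" using w by (simp add: tangent_space_M_def)
    show "gw_metric a b V (t, q, y) ?G x = \<omega> x" if "x \<in> tangent_space_M A (t, q, y)" for x
    proof -
      obtain x1 x2 x3 where x: "x = (x1, x2, x3)" by (cases x) auto
      then have x2: "x2 \<in> ?X" using that by (simp add: tangent_space_M_def)
      show ?thesis
        unfolding x \<omega>[OF x2] using a_scale(2)[OF t u(1) x2, of "- \<kappa>"] u(2)[OF x2]
        by (simp add: gw_metric_def algebra_simps)
    qed
    fix x assume xM: "x \<in> tangent_space_M A (t, q, y)"
      and eq: "\<And>w. w \<in> tangent_space_M A (t, q, y) \<Longrightarrow>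
        gw_metric a b V (t, q, y) x w = gw_metric a b V (t, q, y) ?G w"
    obtain x1 x2 x3 where x: "x = (x1, x2, x3)" by (cases x) auto
    then have x2: "x2 \<in> ?X" using xM by (simp add: tangent_space_M_def)
    have eq': "a t q x2 w - x1 * (w\<^sub>y - b t q w) - (x3 - b t q x2) * w\<^sub>t - 2 * V t q * x1 * w\<^sub>t =
        a t q ?w w + \<kappa> * (w\<^sub>y - b t q w) - (2 * V t q * \<kappa> - \<mu>) * w\<^sub>t + 2 * V t q * \<kappa> * w\<^sub>t"
      if "w \<in> ?X" for w w\<^sub>t w\<^sub>y
      using eq[of "(w\<^sub>t, w, w\<^sub>y)"] that unfolding x
      by (simp add: tangent_space_M_def gw_metric_def algebra_simps)
    \<comment> \<open>Uniqueness follows the same triangular order: the y-direction fixes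
      \<open>x1\<close>, definiteness of the metric on Q fixes \<open>x2\<close>, the t-direction
      fixes \<open>x3\<close>.\<close>
    have x1: "x1 = - \<kappa>"
      using a_zero_right[OF t x2] a_zero_right[OF t w] b_zero[OF t, of q] eq'[OF tangent_0, of 1 0] eq'[OF tangent_0, of 0 0] by simp
    have "x2 = ?w"
      by (rule a_nondegenerate[OF t x2 w]) (use eq'[of _ 0 0] x1 in simp)
    moreover have "x3 = b t q ?w + 2 * V t q * \<kappa> - \<mu>"
      using eq'[OF tangent_0, of 0 1] eq'[OF tangent_0, of 0 0] x1 \<open>x2 = ?w\<close>
        a_zero_right[OF t w] b_zero[OF t, of q] by (simp add: algebra_simps)
    ultimately show "x = ?G" using x x1 by simp
  qed
  moreover have "a t q ?w ?w = \<kappa>\<^sup>2 * a t q u u"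
    using a_scale(1)[OF t w u(1), of "- \<kappa>"] a_scale(2)[OF t u(1) u(1), of "- \<kappa>"]
    by (simp add: power2_eq_square)
  ultimately show ?thesis
    by (simp add: gw_metric_def hamiltonian_def dual_form_def u_def[symmetric] power2_eq_square algebra_simps)
qed

end

section \<open>The eikonal equation\<close>

lemma isCont_tendsto_nhds: "isCont f x \<Longrightarrow> (f \<longlongrightarrow> f x) (nhds x)"
  by (simp add: isCont_def tendsto_at_iff_tendsto_nhds)

context gw_spacetime
begin

context
  fixes t0 t y0 y :: real and q0 q :: 'q and N :: "(real \<times> 'q) set"
  assumes T: "t0 \<in> T" "t \<in> T" and t0t: "t0 < t"
    and S_less: "S (t0, q0) (t, q) < ereal (y - y0)"
    and N: "open N" "(t, q) \<in> N" "N \<subseteq> T \<times> UNIV" "\<And>e. e \<in> N \<Longrightarrow> \<bar>S (t0, q0) e\<bar> \<noteq> \<infinity>"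
    and diff: "differentiable_E A (\<lambda>e. real_of_ereal (S (t0, q0) e)) (t, q)"
begin

definition "S' e = real_of_ereal (S (t0, q0) e)"

abbreviation "d x \<equiv> lorentz_dist A T a b V (t0, q0, y0) x"

definition "d' x = real_of_ereal (d x)"

definition "S_chart \<phi> p = S' (fst p, chart_inv \<phi> (snd p))"

definition "DS \<phi> = frechet_derivative (S_chart \<phi>) (at (t, snd \<phi> q))"

definition "D = sqrt (2 * (t - t0) * (y - y0 - S' (t, q)))"

lemma S_eq: "e \<in> N \<Longrightarrow> S (t0, q0) e = ereal (S' e)"
  using N(4) by (simp add: S'_def ereal_real)

lemma S'_less: "S' (t, q) < y - y0"
  using S_less S_eq[OF N(2)] by simp

lemma D_pos: "0 < D"
  using t0t S'_less by (simp add: D_def)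

lemma D_squared: "D\<^sup>2 = 2 * (t - t0) * (y - y0 - S' (t, q))"
  using t0t S'_less by (simp add: D_def)

lemma S_chart_has_derivative:
  assumes "\<phi> \<in> charts_at A q"
  shows "(S_chart \<phi> has_derivative DS \<phi>) (at (t, snd \<phi> q))"
proof -
  have "S_chart \<phi> differentiable (at (t, snd \<phi> q))"
    using diff assms by (simp add: differentiable_E_def S_chart_def[abs_def] S'_def case_prod_unfold)
  then show ?thesis unfolding DS_def by (simp add: frechet_derivative_works)
qed

lemma S_chart_at: "\<phi> \<in> charts_at A q \<Longrightarrow> S_chart \<phi> (t, snd \<phi> q) = S' (t, q)"
  by (simp add: S_chart_def charts_at_def)

text \<open>The formula for d is needed on a neighbourhood, not just at the point. Differentiability
  makes S continuous at (t, q), so y - y0 > S persists nearby, where S is finite by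
  assumption.\<close>

lemma eventually_dist_formula:
  assumes \<phi>: "\<phi> \<in> charts_at A q"
  shows "\<forall>\<^sub>F p in nhds (t, snd \<phi> q, y). fst p \<in> T \<and>
    d (fst p, chart_inv \<phi> (fst (snd p)), snd (snd p)) =
      ereal (sqrt (2 * (fst p - t0) * (snd (snd p) - y0 - S_chart \<phi> (fst p, fst (snd p)))))"
proof -
  have \<phi>A: "\<phi> \<in> A" and q: "q \<in> fst \<phi>" using \<phi> by (auto simp: charts_at_def)
  let ?p = "(t, snd \<phi> q, y)"
  have 1: "\<forall>\<^sub>F p in nhds ?p. p \<in> (T \<inter> {t0<..}) \<times> UNIV"
    by (rule eventually_nhds_in_open) (use open_T T t0t in \<open>auto intro!: open_Times\<close>)
  have "isCont (chart_inv \<phi>) (snd \<phi> q)"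
    using continuous_on_chart_inv[OF \<phi>A] q unfolding continuous_on_eq_continuous_at[OF open_img[OF \<phi>A]] by blast
  then have "isCont (\<lambda>p. (fst p, chart_inv \<phi> (fst (snd p)))) ?p"
    by (intro continuous_intros isCont_o2[of _ "\<lambda>p. fst (snd p)"]) simp
  then have "((\<lambda>p. (fst p, chart_inv \<phi> (fst (snd p)))) \<longlongrightarrow> (t, q)) (nhds ?p)"
    using isCont_tendsto_nhds \<phi>A q by fastforce
  then have 2: "\<forall>\<^sub>F p in nhds ?p. (fst p, chart_inv \<phi> (fst (snd p))) \<in> N"
    by (rule topological_tendstoD) (use N in auto)
  have "isCont (S_chart \<phi>) (t, snd \<phi> q)"
    using S_chart_has_derivative[OF \<phi>] has_derivative_continuous by blast
  then have "isCont (\<lambda>p. snd (snd p) - y0 - S_chart \<phi> (fst p, fst (snd p))) ?p"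
    by (intro continuous_intros isCont_o2[of _ "\<lambda>p. (fst p, fst (snd p))"]) simp
  then have "((\<lambda>p. snd (snd p) - y0 - S_chart \<phi> (fst p, fst (snd p))) \<longlongrightarrow> y - y0 - S' (t, q)) (nhds ?p)"
    using isCont_tendsto_nhds S_chart_at[OF \<phi>] by fastforce
  then have "\<forall>\<^sub>F p in nhds ?p. 0 < snd (snd p) - y0 - S_chart \<phi> (fst p, fst (snd p))"
    by (rule order_tendstoD) (use S'_less in simp)
  with 1 2 show ?thesis
  proof eventually_elim
    case (elim p)
    then show ?case
      using lorentz_dist_eq[OF _ T(1) _ S_eq[OF elim(2)], of "snd (snd p)" y0]
      by (auto simp: S_chart_def mem_Times_iff)
  qed
qed

lemma dist_finite_nhds: "\<exists>M. open M \<and> (t, q, y) \<in> M \<and> M \<subseteq> T \<times> UNIV \<and> (\<forall>x\<in>M. \<bar>d x\<bar> \<noteq> \<infinity>)"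
proof -
  obtain \<phi> where \<phi>: "\<phi> \<in> charts_at A q" by (rule ex_chart)
  then have \<phi>A: "\<phi> \<in> A" and q: "q \<in> fst \<phi>" by (auto simp: charts_at_def)
  let ?x = "(t, q, y)"
  have "isCont (snd \<phi>) q"
    using continuous_on_chart[OF \<phi>A] q unfolding continuous_on_eq_continuous_at[OF open_dom[OF \<phi>A]] by blast
  then have "isCont (\<lambda>x. (fst x, snd \<phi> (fst (snd x)), snd (snd x))) ?x"
    by (intro continuous_intros isCont_o2[of _ "\<lambda>p. fst (snd p)"]) simp
  then have "filterlim (\<lambda>x. (fst x, snd \<phi> (fst (snd x)), snd (snd x))) (nhds (t, snd \<phi> q, y)) (nhds ?x)"
    using isCont_tendsto_nhds by fastforce
  from eventually_compose_filterlim[OF eventually_dist_formula[OF \<phi>] this]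
  have "\<forall>\<^sub>F x in nhds ?x. fst x \<in> T \<and> \<bar>d (fst x, chart_inv \<phi> (snd \<phi> (fst (snd x))), snd (snd x))\<bar> \<noteq> \<infinity>"
    by (rule eventually_mono) simp
  moreover have "\<forall>\<^sub>F x in nhds ?x. x \<in> UNIV \<times> fst \<phi> \<times> UNIV"
    by (rule eventually_nhds_in_open) (use open_dom[OF \<phi>A] q in \<open>auto intro!: open_Times\<close>)
  ultimately have "\<forall>\<^sub>F x in nhds ?x. fst x \<in> T \<and> \<bar>d x\<bar> \<noteq> \<infinity>"
  proof eventually_elim
    case (elim x)
    then have "fst (snd x) \<in> fst \<phi>" by (simp add: mem_Times_iff)
    then show ?case using elim(1) chart_inv_left[OF \<phi>A] by simp
  qed
  then show ?thesis unfolding eventually_nhds by (fastforce simp: mem_Times_iff)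
qed

lemma dist_at: "d (t, q, y) = ereal D"
proof -
  obtain \<phi> where \<phi>: "\<phi> \<in> charts_at A q" by (rule ex_chart)
  from eventually_nhds_x_imp_x[OF eventually_dist_formula[OF \<phi>]] show ?thesis
    using \<phi> S_chart_at[OF \<phi>] by (simp add: D_def charts_at_def)
qed

text \<open>Half of d^2 is (t - t0) (y - y0 - S), so d times the differential of d is given by the
  product rule; D > 0 permits the division.\<close>

lemma chart_rep_has_derivative:
  assumes \<phi>: "\<phi> \<in> charts_at A q"
  shows "(chart_rep_M \<phi> d' has_derivative
    (\<lambda>h. ((y - y0 - S' (t, q)) * fst h + (t - t0) * (snd (snd h) - DS \<phi> (fst h, fst (snd h)))) / D))
    (at (t, snd \<phi> q, y))"
proof -
  let ?p = "(t, snd \<phi> q, y)"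
  let ?f = "\<lambda>p. (fst p - t0) * (snd (snd p) - y0 - S_chart \<phi> (fst p, fst (snd p)))"
  let ?g = "\<lambda>p. sqrt (2 * ?f p)"
  have "((\<lambda>p::real \<times> 'e \<times> real. (fst p, fst (snd p))) has_derivative (\<lambda>h. (fst h, fst (snd h)))) (at ?p)"
    by (auto intro!: derivative_eq_intros)
  from has_derivative_compose[OF this, of "S_chart \<phi>" "DS \<phi>"] S_chart_has_derivative[OF \<phi>]
  have comp: "((\<lambda>p. S_chart \<phi> (fst p, fst (snd p))) has_derivative (\<lambda>h. DS \<phi> (fst h, fst (snd h)))) (at ?p)"
    by simp
  have f: "(?f has_derivative (\<lambda>h. (t - t0) * (snd (snd h) - DS \<phi> (fst h, fst (snd h)))
      + fst h * (y - y0 - S' (t, q)))) (at ?p)"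
    by (auto intro!: derivative_eq_intros comp simp: S_chart_at[OF \<phi>])
  have fp: "2 * ?f ?p = D\<^sup>2" by (simp add: D_squared S_chart_at[OF \<phi>])
  have gd: "(?g has_derivative (\<lambda>h. (2 * ((t - t0) * (snd (snd h) - DS \<phi> (fst h, fst (snd h)))
      + fst h * (y - y0 - S' (t, q)))) * (inverse (sqrt (2 * ?f ?p)) / 2))) (at ?p)"
    by (intro has_derivative_real_sqrt has_derivative_mult_right f) (use fp D_pos in simp)
  have "sqrt (2 * ?f ?p) = D" unfolding fp using D_pos by simp
  have g: "(?g has_derivative (\<lambda>h. ((y - y0 - S' (t, q)) * fst h + (t - t0) * (snd (snd h) - DS \<phi> (fst h, fst (snd h)))) / D)) (at ?p)"
  proof -
    have "2 * (p * x + h * w) * (inverse D / 2) = (w * h + p * x) / D" for p x h w :: real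
      using D_pos by (simp add: field_simps)
    then show ?thesis using \<open>sqrt (2 * ?f ?p) = D\<close> gd by (simp only:)
  qed
  have "\<forall>\<^sub>F p in nhds ?p. d (fst p, chart_inv \<phi> (fst (snd p)), snd (snd p)) = ereal (?g p)"
    using eventually_dist_formula[OF \<phi>] by (rule eventually_mono) (simp only: mult.assoc)
  then obtain O' where O': "open O'" "?p \<in> O'" "\<And>p. p \<in> O' \<Longrightarrow>
      d (fst p, chart_inv \<phi> (fst (snd p)), snd (snd p)) = ereal (?g p)"
    unfolding eventually_nhds by blast
  show ?thesis
    by (rule has_derivative_transform_within_open[OF g O'(1,2)])
      (simp add: chart_rep_M_def d'_def O'(3) case_prod_unfold)
qed

lemma differentiable_dist: "differentiable_M A d' (t, q, y)"
  unfolding differentiable_M_def using chart_rep_has_derivative by (auto simp: differentiable_def)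

lemma linear_DS: "\<phi> \<in> charts_at A q \<Longrightarrow> linear (DS \<phi>)"
  using S_chart_has_derivative has_derivative_linear by blast

lemma deriv_S':
  assumes \<phi>: "\<phi> \<in> charts_at A q"
  shows "deriv (\<lambda>s. S' (s, q)) t = DS \<phi> (1, 0)"
proof -
  have "((\<lambda>s::real. (s, snd \<phi> q)) has_derivative (\<lambda>h. (h, 0))) (at t)"
    by (auto intro!: derivative_eq_intros)
  from has_derivative_compose[OF this S_chart_has_derivative[OF \<phi>]]
  have "((\<lambda>s. S' (s, q)) has_derivative (\<lambda>h. DS \<phi> (h, 0))) (at t)"
    using \<phi> by (simp add: S_chart_def charts_at_def)
  moreover have "DS \<phi> (h, 0) = DS \<phi> (1, 0) * h" for h
    using linear_cmul[OF linear_DS[OF \<phi>], of h "(1, 0)"] by simp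
  then have eq: "(\<lambda>h. DS \<phi> (h, 0)) = (*) (DS \<phi> (1, 0))" by (rule ext)
  ultimately have "((\<lambda>s. S' (s, q)) has_real_derivative DS \<phi> (1, 0)) (at t)"
    unfolding has_field_derivative_def by (simp only: eq)
  then show ?thesis by (rule DERIV_imp_deriv)
qed

lemma dQ_S':
  defines "\<phi> \<equiv> some_chart A q"
  shows "dQ A (\<lambda>q'. S' (t, q')) q v = DS \<phi> (0, v \<phi>)"
proof -
  have \<phi>: "\<phi> \<in> charts_at A q" unfolding \<phi>_def by (rule some_chart)
  have "((\<lambda>z. (t, z)) has_derivative (\<lambda>h. (0, h))) (at (snd \<phi> q))"
    by (auto intro!: derivative_eq_intros)
  from has_derivative_compose[OF this S_chart_has_derivative[OF \<phi>]]
  have "((\<lambda>q'. S' (t, q')) \<circ> chart_inv \<phi> has_derivative (\<lambda>h. DS \<phi> (0, h))) (at (snd \<phi> q))"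
    by (simp add: S_chart_def o_def)
  from frechet_derivative_at[OF this] show ?thesis
    unfolding dQ_def Let_def \<phi>_def[symmetric] by metis
qed

lemma eikonal:
  "gw_metric a b V (t, q, y) (gradient_M A a b V d' (t, q, y)) (gradient_M A a b V d' (t, q, y)) + 1 =
    2 * (t - t0)\<^sup>2 / D\<^sup>2 * (deriv (\<lambda>s. S' (s, q)) t + hamiltonian A a b V t q (dQ A (\<lambda>q'. S' (t, q')) q))"
proof -
  \<comment> \<open>\<open>dM\<close> and \<open>dQ\<close> are both defined through this chart, so
    the two differentials are compared on the same representative of a vector.\<close>
  define \<phi> where "\<phi> = some_chart A q"
  have \<phi>: "\<phi> \<in> charts_at A q" unfolding \<phi>_def by (rule some_chart)
  note lin = linear_DS[OF \<phi>]
  define St where "St = deriv (\<lambda>s. S' (s, q)) t"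
  define Sq where "Sq = dQ A (\<lambda>q'. S' (t, q')) q"
  have Sq: "Sq v = DS \<phi> (0, v \<phi>)" for v unfolding Sq_def \<phi>_def by (rule dQ_S')
  have DS: "DS \<phi> (h, e) = h * St + DS \<phi> (0, e)" for h e
    using linear_add[OF lin, of "h *\<^sub>R (1, 0)" "(0, e)"] linear_cmul[OF lin, of h "(1, 0)"]
    by (simp add: St_def deriv_S'[OF \<phi>])
  have tl: "tvec_linear A q Sq"
    unfolding tvec_linear_def Sq
    using linear_add[OF lin, of "(0, _)" "(0, _)"] linear_cmul[OF lin, of _ "(0, _)"] by simp
  \<comment> \<open>\<kappa> and \<mu> are the y- and t-components of the differential of d. As D^2
    = 2 (t - t0) (y - y0 - S), the product 2 \<kappa> \<mu> is 1 - 2 \<kappa>^2 \<open>St\<close>: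
    the 1 cancels the one in the eikonal equation and \<open>St\<close> joins the
    Hamiltonian.\<close>
  define \<kappa> where "\<kappa> = (t - t0) / D"
  define \<mu> where "\<mu> = (y - y0 - S' (t, q) - (t - t0) * St) / D"
  have dM: "dM A d' (t, q, y) (w\<^sub>t, w, w\<^sub>y) = \<mu> * w\<^sub>t - \<kappa> * Sq w + \<kappa> * w\<^sub>y" for w\<^sub>t w w\<^sub>y
    unfolding dM_def Let_def prod.case \<phi>_def[symmetric] frechet_derivative_at[OF chart_rep_has_derivative[OF \<phi>], symmetric]
    by (simp add: DS[of w\<^sub>t "w \<phi>"] Sq \<mu>_def \<kappa>_def divide_inverse algebra_simps)
  have "gw_metric a b V (t, q, y) (gradient_M A a b V d' (t, q, y)) (gradient_M A a b V d' (t, q, y)) =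
    2 * \<kappa>\<^sup>2 * hamiltonian A a b V t q Sq - 2 * \<kappa> * \<mu>"
    unfolding gradient_M_def by (rule gw_metric_sharp[OF T(2) tl dM])
  moreover have "2 * \<kappa> * \<mu> = 1 - 2 * \<kappa>\<^sup>2 * St"
  proof -
    have "2 * \<kappa> * \<mu> = (2 * (t - t0) * (y - y0 - S' (t, q)) - 2 * (t - t0)\<^sup>2 * St) / D\<^sup>2"
      by (simp add: \<kappa>_def \<mu>_def power2_eq_square algebra_simps)
    also have "\<dots> = 1 - 2 * \<kappa>\<^sup>2 * St"
      unfolding D_squared[symmetric] using D_pos by (simp add: diff_divide_distrib[of "D\<^sup>2"] \<kappa>_def power_divide)
    finally show ?thesis .
  qed
  moreover have "2 * (t - t0)\<^sup>2 / D\<^sup>2 = 2 * \<kappa>\<^sup>2" by (simp add: \<kappa>_def power_divide)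
  ultimately show ?thesis
    unfolding St_def[symmetric] Sq_def[symmetric] by (simp only: distrib_left)
qed

lemma eikonal_hamilton_jacobi:
  "(\<exists>M. open M \<and> (t, q, y) \<in> M \<and> M \<subseteq> T \<times> UNIV \<and> (\<forall>x\<in>M. \<bar>d x\<bar> \<noteq> \<infinity>)) \<and>
   differentiable_M A d' (t, q, y) \<and> 0 < d (t, q, y) \<and>
   gw_metric a b V (t, q, y) (gradient_M A a b V d' (t, q, y)) (gradient_M A a b V d' (t, q, y)) + 1 =
     2 * (t - t0)\<^sup>2 / (d' (t, q, y))\<^sup>2 *
       (deriv (\<lambda>s. S' (s, q)) t + hamiltonian A a b V t q (dQ A (\<lambda>q'. S' (t, q')) q)) \<and>
   (gw_metric a b V (t, q, y) (gradient_M A a b V d' (t, q, y)) (gradient_M A a b V d' (t, q, y)) + 1 = 0 \<longleftrightarrow>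
     deriv (\<lambda>s. S' (s, q)) t + hamiltonian A a b V t q (dQ A (\<lambda>q'. S' (t, q')) q) = 0)"
proof -
  have "d' (t, q, y) = D" by (simp add: d'_def dist_at)
  moreover have "2 * (t - t0)\<^sup>2 / D\<^sup>2 \<noteq> 0" using t0t D_pos by simp
  ultimately show ?thesis
    using dist_finite_nhds differentiable_dist D_pos unfolding eikonal by (simp add: dist_at)
qed

lemmas eikonal_hamilton_jacobi_expanded = eikonal_hamilton_jacobi[unfolded S'_def[abs_def] d'_def[abs_def]]

end

end

theorem mainTheorem3:
  fixes r :: nat
    and A :: "('q::t2_space, 'e::euclidean_space) chart set"
    and T :: "real set"
    and a :: "real \<Rightarrow> 'q \<Rightarrow> ('q, 'e) tvec \<Rightarrow> ('q, 'e) tvec \<Rightarrow> real"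
    and b :: "real \<Rightarrow> 'q \<Rightarrow> ('q, 'e) tvec \<Rightarrow> real"
    and V :: "real \<Rightarrow> 'q \<Rightarrow> real"
    and t0 t y0 y :: real and q0 q :: 'q
  defines "S \<equiv> least_action A a b V (t0, q0)"
    and "d \<equiv> lorentz_dist A T a b V (t0, q0, y0)"
  defines "S' \<equiv> \<lambda>e. real_of_ereal (S e)"
    and "d' \<equiv> \<lambda>x. real_of_ereal (d x)"
  defines "grad_d \<equiv> gradient_M A a b V d' (t, q, y)"
    and "S_t \<equiv> deriv (\<lambda>s. S' (s, q)) t"
    and "S_q \<equiv> dQ A (\<lambda>q'. S' (t, q')) q"
  assumes "2 \<le> r"
    and "Ck_manifold (r + 1) A" and "connected (UNIV :: 'q set)"
    and "open T" and "connected T"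
    and "Cr_metric r A T a" and "Cr_oneform r A T b" and "Cr_function r A T V"
    and "t0 \<in> T" and "t \<in> T" and "t0 < t"
    and "S (t, q) < ereal (y - y0)"
    and "\<exists>N. open N \<and> (t, q) \<in> N \<and> N \<subseteq> T \<times> UNIV \<and> (\<forall>e\<in>N. \<bar>S e\<bar> \<noteq> \<infinity>)"
    and "differentiable_E A S' (t, q)"
  shows "(\<exists>N. open N \<and> (t, q, y) \<in> N \<and> N \<subseteq> T \<times> UNIV \<and> (\<forall>x\<in>N. \<bar>d x\<bar> \<noteq> \<infinity>)) \<and>
     differentiable_M A d' (t, q, y) \<and>
     0 < d (t, q, y) \<and>
     gw_metric a b V (t, q, y) grad_d grad_d + 1 =
       2 * (t - t0)\<^sup>2 / (d' (t, q, y))\<^sup>2 * (S_t + hamiltonian A a b V t q S_q) \<and>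
     (gw_metric a b V (t, q, y) grad_d grad_d + 1 = 0 \<longleftrightarrow>
       S_t + hamiltonian A a b V t q S_q = 0)"
proof -
  \<comment> \<open>The first argument is \<open>r\<close> because the locale asks for class
    \<open>Suc k\<close> and the manifold has class \<open>r + 1\<close>.\<close>
  have gw: "gw_spacetime r A r T a b V"
    by unfold_locales (use assms in simp_all)
  have "\<exists>N. open N \<and> (t, q) \<in> N \<and> N \<subseteq> T \<times> UNIV \<and> (\<forall>e\<in>N. \<bar>S e\<bar> \<noteq> \<infinity>)" by fact
  then obtain N where N: "open N" "(t, q) \<in> N" "N \<subseteq> T \<times> UNIV" and fin: "\<forall>e\<in>N. \<bar>S e\<bar> \<noteq> \<infinity>"
    by (elim exE conjE)
  have fin': "\<bar>least_action A a b V (t0, q0) e\<bar> \<noteq> \<infinity>" if "e \<in> N" for e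
    using bspec[OF fin that] unfolding S_def .
  have S: "least_action A a b V (t0, q0) (t, q) < ereal (y - y0)"
    and diff: "differentiable_E A (\<lambda>e. real_of_ereal (least_action A a b V (t0, q0) e)) (t, q)"
    using \<open>S (t, q) < ereal (y - y0)\<close> \<open>differentiable_E A S' (t, q)\<close> by (simp_all add: S_def S'_def)
  note main = gw_spacetime.eikonal_hamilton_jacobi_expanded[OF gw \<open>t0 \<in> T\<close> \<open>t \<in> T\<close> \<open>t0 < t\<close> S N fin' diff]
  show ?thesis
    unfolding grad_d_def S_t_def S_q_def S'_def d'_def S_def d_def
    by (rule main)
qed

end
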